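(* Let $a>0$ and let $F=F^{1,a}\colon[0,\infty)\to[0,\infty)$ be the convex Orlicz function with $F(0)=0$, $F(t)=e^{-a}\,t\,(-\log t)^{-a}$ for $0<t<1/e$, and $F(t)=t^{1+a}$ for $t\ge 1/e$. Then there is a complemented subspace of the Orlicz sequence space $\ell_F$ with an unconditional basis but with no greedy basis.
   Context: Orlicz sequence space: for a convex function $F\colon[0,\infty)\to[0,\infty)$ with $F(0)=0$, $F(1)=1$, $\ell_F$ is the Banach space of real sequences $\alpha=(a_n)$ with $\sum_n F(|a_n|/t)<\infty$ for some $t>0$, normed by $\|\alpha\|_F=\inf\{t>0:\sum_nF(|a_n|/t)\le1\}$. Bases: a basis is a Schauder basis $(x_n)_{n=1}^\infty$ (indexed by $\mathbb{N}$, so the space is infinite-dimensional), and all bases are assumed semi-normalized, i.e. $0<\inf_n\|x_n\|\le\sup_n\|x_n\|<\infty$. A basis $(x_n)$ of $X$ with biorthogonal functionals $(x_n^* )$ is greedy if there is a constant $C$ such that for every $x\in X$, every $N\in\mathbb{N}$, and every set $\Lambda\subseteq\mathbb{N}$ with $|\Lambda|=N$ and $\min_{n\in\Lambda}|x_n^*(x)|\ge\max_{n\notin\Lambda}|x_n^*(x)|$, one has $\|x-\sum_{n\in\Lambda}x_n^*(x)x_n\|\le C\inf\{\|x-\sum_{n\in A}\alpha_n x_n\| : |A|=N,\ \alpha_n\in\mathbb{R}\}$. *)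

theory Defs
  imports "HOL-Analysis.Analysis" "HOL-Library.Function_Algebras"
begin

text \<open>Pointwise scalar multiplication, which together with the pointwise addition of
  \<^theory>\<open>HOL-Library.Function_Algebras\<close> makes \<open>nat \<Rightarrow> real\<close> a real vector space.\<close>

instantiation "fun" :: (type, real_vector) real_vector
begin

definition scaleR_fun :: "real \<Rightarrow> ('a \<Rightarrow> 'b) \<Rightarrow> 'a \<Rightarrow> 'b" where
  "scaleR_fun r f = (\<lambda>x. r *\<^sub>R f x)"

instance
  by standard (auto simp: scaleR_fun_def plus_fun_def fun_eq_iff scaleR_add_right scaleR_add_left)

end


section \<open>Orlicz sequence spaces\<close>

definition orlicz_function :: "(real \<Rightarrow> real) \<Rightarrow> bool" where
  "orlicz_function F \<longleftrightarrow> convex_on {0..} F \<and> (\<forall>t\<ge>0. F t \<ge> 0) \<and> F 0 = 0 \<and> F 1 = 1"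

definition orlicz_space :: "(real \<Rightarrow> real) \<Rightarrow> (nat \<Rightarrow> real) set" where
  "orlicz_space F = {\<alpha>. \<exists>t>0. summable (\<lambda>n. F (\<bar>\<alpha> n\<bar> / t))}"

text \<open>The explicit summability condition is needed because \<^const>\<open>suminf\<close> has an arbitrary value on
  divergent series.\<close>

definition orlicz_norm :: "(real \<Rightarrow> real) \<Rightarrow> (nat \<Rightarrow> real) \<Rightarrow> real" where
  "orlicz_norm F \<alpha> =
     Inf {t. t > 0 \<and> summable (\<lambda>n. F (\<bar>\<alpha> n\<bar> / t)) \<and> (\<Sum>n. F (\<bar>\<alpha> n\<bar> / t)) \<le> 1}"

text \<open>Only the values on \<open>[0,\<infinity>)\<close> matter; on negative arguments the function is set to \<open>0\<close>.\<close>

definition orlicz_F1 :: "real \<Rightarrow> real \<Rightarrow> real" where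
  "orlicz_F1 a t =
     (if t \<le> 0 then 0
      else if t < 1 / exp 1 then exp (- a) * t * (- ln t) powr (- a)
      else t powr (1 + a))"

lemma orlicz_function_orlicz_F1:
  assumes "a > 0"
  shows "orlicz_function (orlicz_F1 a)"
proof -
  define F where "F = orlicz_F1 a"
  define c :: real where "c = 1 / exp 1"
  define G where "G = (\<lambda>t. exp (- a) * t * (- ln t) powr (- a))"
  define H where "H = (\<lambda>t::real. t powr (1 + a))"
  define G' where
    "G' = (\<lambda>t. exp (- a) * ((- ln t) powr (- a) + a * (- ln t) powr (- a - 1)))"
  define H' where "H' = (\<lambda>t::real. (1 + a) * t powr a)"
  define S where "S = {0<..<c}"
  define T where "T = {c..}"
  have c: "0 < c" "c < 1" "ln c = -1"
    by (auto simp: c_def ln_div)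
  have F_eq: "F t = (if t \<in> S then G t else H t)" if "t > 0" for t
    using that by (auto simp: F_def orlicz_F1_def S_def G_def H_def c_def)
  have ln_c: "ln t \<le> -1" if "0 < t" "t \<le> c" for t
    using that c ln_mono[of t c] by simp
  have dG: "(G has_real_derivative G' t) (at t)" if "0 < t" "t \<le> c" for t
  proof -
    have "- ln t > 0" using ln_c[OF that] by simp
    then show ?thesis
      unfolding G_def G'_def using that
      by (auto intro!: derivative_eq_intros simp: field_simps)
  qed
  have dH: "(H has_real_derivative H' t) (at t)" if "0 < t" for t
    unfolding H_def H'_def using that
    by (auto intro!: derivative_eq_intros)
  have c_powr: "c powr r = exp (- r)" for r
    using c by (simp add: powr_def)
  have GH: "G c = H c" "G' c = H' c"
    unfolding G_def H_def G'_def H'_def c_powr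
    by (simp_all add: c(3)) (simp_all add: exp_diff exp_minus c_def divide_simps)
  have cl: "closure S = {0..c}" "closure T = T" "S \<union> T = {0<..}"
    using c by (auto simp: S_def T_def)
  have dF: "(F has_real_derivative (if t \<in> S then G' t else H' t)) (at t)" if "t > 0" for t
  proof -
    have "((\<lambda>t. if t \<in> S then G t else H t) has_vector_derivative
        (if t \<in> S then G' t else H' t)) (at t within {0<..})"
    proof (rule has_vector_derivative_If_within_closures[where T = T])
      assume "t \<in> S \<union> (closure S \<inter> closure T)"
      then have "t \<le> c"
        unfolding cl by (auto simp: S_def)
      then show "(G has_vector_derivative G' t) (at t within S \<union> (closure S \<inter> closure T))"
        unfolding has_real_derivative_iff_has_vector_derivative[symmetric]
        using that \<open>t \<le> c\<close> by (auto intro: has_field_derivative_at_within[OF dG])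
    next
      show "(H has_vector_derivative H' t) (at t within T \<union> (closure S \<inter> closure T))"
        unfolding has_real_derivative_iff_has_vector_derivative[symmetric]
        using that by (auto intro: has_field_derivative_at_within[OF dH])
    next
      assume "t \<in> closure S" "t \<in> closure T"
      then have "t = c"
        unfolding cl by (auto simp: T_def)
      then show "G t = H t" "G' t = H' t"
        using GH by simp_all
    qed (use that in \<open>auto simp: cl\<close>)
    then have "((\<lambda>t. if t \<in> S then G t else H t) has_real_derivative
        (if t \<in> S then G' t else H' t)) (at t)"
      unfolding has_real_derivative_iff_has_vector_derivative
      using that at_within_open[of t "{0<..}"] by simp
    then show ?thesis
      by (rule has_field_derivative_transform_within_open[where S = "{0<..}"])
        (use that F_eq in auto)
  qed
  have G'_mono: "G' s \<le> G' t" if "0 < s" "s \<le> t" "t \<le> c" for s t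
  proof -
    have "- ln t > 0" "- ln t \<le> - ln s"
      using that c ln_c[of t] by auto
    then show ?thesis
      unfolding G'_def using assms
      by (intro mult_left_mono add_mono powr_mono2') auto
  qed
  have H'_mono: "H' s \<le> H' t" if "0 < s" "s \<le> t" for s t
    unfolding H'_def using that assms by (intro mult_left_mono powr_mono2) auto
  have convex_pos: "convex_on {0<..} F"
  proof (rule convex_on_realI)
    fix s t :: real
    assume st: "s \<in> {0<..}" "t \<in> {0<..}" "s \<le> t"
    show "(if s \<in> S then G' s else H' s) \<le> (if t \<in> S then G' t else H' t)"
    proof (cases "s \<in> S \<and> t \<notin> S")
      case True
      then have "G' s \<le> G' c" "H' c \<le> H' t"
        using st c by (auto simp: S_def intro!: G'_mono H'_mono)
      then show ?thesis using True GH by simp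
    next
      case False
      then show ?thesis
        using st G'_mono H'_mono by (auto simp: S_def)
    qed
  qed (use dF in auto)
  have F0: "F 0 = 0"
    by (simp add: F_def orlicz_F1_def)
  have F1: "F 1 = 1"
    using c by (simp add: F_def orlicz_F1_def)
  have nonneg: "F t \<ge> 0" if "t \<ge> 0" for t
    using that by (simp add: F_def orlicz_F1_def)
  have star: "F (r * t) \<le> r * F t" if "0 < r" "r \<le> 1" "0 < t" for r t
  proof -
    have G_star: "G (q * t) \<le> q * G t" if "0 < q" "q \<le> 1" "0 < t" "t \<le> c" for q t
    proof -
      have "- ln t > 0" "- ln t \<le> - ln (q * t)"
        using that c ln_c[of t] by (auto simp: ln_mult)
      then have "(- ln (q * t)) powr (- a) \<le> (- ln t) powr (- a)"
        using assms by (intro powr_mono2') auto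
      then have "(exp (- a) * (q * t)) * (- ln (q * t)) powr (- a) \<le>
          (exp (- a) * (q * t)) * (- ln t) powr (- a)"
        using that by (intro mult_left_mono) auto
      then show ?thesis
        by (simp add: G_def algebra_simps)
    qed
    have H_star: "H (q * t) \<le> q * H t" if "0 < q" "q \<le> 1" "0 < t" for q t
    proof -
      have "q powr a \<le> 1"
        using that assms powr_mono2[of a q 1] by simp
      then have "q * q powr a * (t * t powr a) \<le> q * 1 * (t * t powr a)"
        using that by (intro mult_right_mono mult_left_mono) auto
      then show ?thesis
        using that by (simp add: H_def powr_add powr_mult algebra_simps)
    qed
    show ?thesis
    proof (cases "r * t \<in> S \<and> t \<notin> S")
      case True
      then have t: "r * t < c" "c \<le> t"
        using that by (auto simp: S_def)
      have "F (r * t) = G ((r * t / c) * c)"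
        using True that c by (simp add: F_eq)
      also have "\<dots> \<le> (r * t / c) * H c"
        using GH G_star[of "r * t / c" c] that t c by simp
      also have "(r * t / c) * H c \<le> (r * t / c) * ((c / t) * H t)"
        using H_star[of "c / t" t] t that c by (intro mult_left_mono) auto
      also have "\<dots> = r * F t"
        using that c True by (simp add: F_eq)
      finally show ?thesis .
    next
      case False
      have "r * t \<le> 1 * t"
        using that by (intro mult_right_mono) auto
      then have "r * t < c" if "t < c"
        using that by linarith
      then show ?thesis
        using False that G_star[of r t] H_star[of r t] by (auto simp: F_eq S_def)
    qed
  qed
  have "convex_on {0..} F"
  proof (rule convex_onI)
    fix u x y :: real
    assume u: "0 < u" "u < 1" and xy: "x \<in> {0..}" "y \<in> {0..}"
    consider "x = 0" "y = 0" | "x = 0" "y > 0" | "x > 0" "y = 0" | "x > 0" "y > 0"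
      using xy by fastforce
    then show "F ((1 - u) *\<^sub>R x + u *\<^sub>R y) \<le> (1 - u) * F x + u * F y"
    proof cases
      case 4
      then show ?thesis
        using convex_onD[OF convex_pos, of u x y] u by simp
    qed (use u F0 star[of u y] star[of "1 - u" x] in auto)
  qed simp
  then show ?thesis
    using F0 F1 nonneg by (simp add: orlicz_function_def F_def)
qed


section \<open>Complemented subspaces and bases\<close>

text \<open>Below, a normed space is given by a subspace of a real vector space together with a function
  \<open>nrm\<close> which is only relevant on that subspace.\<close>

definition bounded_projection_onto ::
  "'a::real_vector set \<Rightarrow> ('a \<Rightarrow> real) \<Rightarrow> 'a set \<Rightarrow> ('a \<Rightarrow> 'a) \<Rightarrow> bool" where
  "bounded_projection_onto V nrm Y P \<longleftrightarrow>
     (\<forall>u\<in>V. \<forall>v\<in>V. P (u + v) = P u + P v) \<and>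
     (\<forall>r. \<forall>v\<in>V. P (r *\<^sub>R v) = r *\<^sub>R P v) \<and>
     (\<exists>K. \<forall>v\<in>V. nrm (P v) \<le> K * nrm v) \<and>
     P ` V = Y \<and> (\<forall>y\<in>Y. P y = y)"

definition complemented_subspace ::
  "'a::real_vector set \<Rightarrow> ('a \<Rightarrow> real) \<Rightarrow> 'a set \<Rightarrow> bool" where
  "complemented_subspace V nrm Y \<longleftrightarrow>
     Y \<subseteq> V \<and> subspace Y \<and> (\<exists>P. bounded_projection_onto V nrm Y P)"

definition nrm_sums ::
  "('a::real_vector \<Rightarrow> real) \<Rightarrow> (nat \<Rightarrow> 'a) \<Rightarrow> 'a \<Rightarrow> bool" where
  "nrm_sums nrm f s \<longleftrightarrow> (\<lambda>N. nrm (s - (\<Sum>n<N. f n))) \<longlonglongrightarrow> 0"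

definition semi_normalized :: "('a::real_vector \<Rightarrow> real) \<Rightarrow> (nat \<Rightarrow> 'a) \<Rightarrow> bool" where
  "semi_normalized nrm x \<longleftrightarrow>
     0 < (INF n. nrm (x n)) \<and> bdd_above (range (\<lambda>n. nrm (x n)))"

text \<open>All bases are assumed to be semi-normalized.\<close>

definition basis_of ::
  "('a::real_vector \<Rightarrow> real) \<Rightarrow> 'a set \<Rightarrow> (nat \<Rightarrow> 'a) \<Rightarrow> bool" where
  "basis_of nrm Y x \<longleftrightarrow>
     range x \<subseteq> Y \<and> semi_normalized nrm x \<and>
     (\<forall>v\<in>Y. \<exists>!c. nrm_sums nrm (\<lambda>n. c n *\<^sub>R x n) v)"

text \<open>\<open>basis_coord nrm x n\<close> is the biorthogonal functional \<open>x\<^sub>n\<^sup>*\<close> of a basis \<open>x\<close>.\<close>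

definition basis_coord ::
  "('a::real_vector \<Rightarrow> real) \<Rightarrow> (nat \<Rightarrow> 'a) \<Rightarrow> nat \<Rightarrow> 'a \<Rightarrow> real" where
  "basis_coord nrm x n v = (THE c. nrm_sums nrm (\<lambda>k. c k *\<^sub>R x k) v) n"

definition unconditional_basis ::
  "('a::real_vector \<Rightarrow> real) \<Rightarrow> 'a set \<Rightarrow> (nat \<Rightarrow> 'a) \<Rightarrow> bool" where
  "unconditional_basis nrm Y x \<longleftrightarrow>
     basis_of nrm Y x \<and>
     (\<forall>v\<in>Y. \<forall>\<pi>. bij \<pi> \<longrightarrow>
        nrm_sums nrm (\<lambda>n. basis_coord nrm x (\<pi> n) v *\<^sub>R x (\<pi> n)) v)"

text \<open>The error of the best approximation of \<open>v\<close> by combinations of \<open>N\<close> basis vectors.\<close>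

definition best_error ::
  "('a::real_vector \<Rightarrow> real) \<Rightarrow> (nat \<Rightarrow> 'a) \<Rightarrow> nat \<Rightarrow> 'a \<Rightarrow> real" where
  "best_error nrm x N v =
     Inf {nrm (v - (\<Sum>n\<in>A. \<alpha> n *\<^sub>R x n)) | A \<alpha>. finite A \<and> card A = N}"

definition greedy_basis ::
  "('a::real_vector \<Rightarrow> real) \<Rightarrow> 'a set \<Rightarrow> (nat \<Rightarrow> 'a) \<Rightarrow> bool" where
  "greedy_basis nrm Y x \<longleftrightarrow>
     basis_of nrm Y x \<and>
     (\<exists>C. \<forall>v\<in>Y. \<forall>N. \<forall>\<Lambda>. finite \<Lambda> \<and> card \<Lambda> = N \<and>
        (\<forall>i\<in>\<Lambda>. \<forall>j. j \<notin> \<Lambda> \<longrightarrow> \<bar>basis_coord nrm x i v\<bar> \<ge> \<bar>basis_coord nrm x j v\<bar>) \<longrightarrow>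
        nrm (v - (\<Sum>n\<in>\<Lambda>. basis_coord nrm x n v *\<^sub>R x n)) \<le> C * best_error nrm x N v)"

end

theory Submission
  imports Defs
begin

text \<open>
  The subspace consists of the sequences that are constant on the members of a partition
  of the index set into intervals, and averaging over the intervals is a bounded projection. In
  normalized coordinates it is a Musielak--Orlicz space with functions close to
  \<open>F (s\<^sub>j t) / F s\<^sub>j = t (1 + log (1 / t) / b\<^sub>j) powr (- a)\<close>, where \<open>s\<^sub>j = exp (- b\<^sub>j)\<close>. The interval
  lengths are chosen so that this space is essentially an \<open>l\<^sub>1\<close>-sum of finite-dimensional symmetric
  spaces \<open>E\<^sub>k\<close> of dimension \<open>N\<^sub>k\<close>, where the distance \<open>D\<^sub>k\<close> of \<open>E\<^sub>k\<close> to \<open>l\<^sub>1\<close> tends to infinity, while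
  any \<open>h (N\<^sub>k)\<close> disjoint vectors beyond the \<open>k\<close>-th block are uniformly equivalent to the \<open>l\<^sub>1\<close>-basis,
  for a function \<open>h\<close> growing as fast as needed.

  Let \<open>x\<close> be a greedy basis with coordinates \<open>x\<^sub>n\<^sup>*\<close>. It is unconditional and democratic, and a gliding
  hump shows that sums of \<open>n\<close> basis vectors have norm \<open>\<ge> c n\<close>; hence the coordinates of a vector lie
  in weak \<open>l\<^sub>1\<close>. Put \<open>\<sigma>\<^sub>n = (\<Sum>\<^sub>j \<bar>x\<^sub>n\<^sup>* e\<^sub>j\<bar>\<^sup>2) powr (1 / 2)\<close> with \<open>j\<close> in block \<open>k\<close>. By Khinchine's
  inequality the vector \<open>\<Sum>\<^sub>n \<sigma>\<^sub>n x\<^sub>n\<close> has norm \<open>O (N\<^sub>k / D\<^sub>k)\<close>. On the other hand, the identity of \<open>E\<^sub>k\<close>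
  has trace \<open>N\<^sub>k\<close>. The part of this trace that passes through the later blocks is \<open>O (N\<^sub>k / D\<^sub>k)\<close>, since
  those blocks look like \<open>L\<^sub>1\<close>; the part that passes through small coefficients \<open>x\<^sub>n\<^sup>* e\<^sub>i\<close> of the
  remaining blocks is small by the weak \<open>l\<^sub>1\<close> estimate; and only \<open>O (N\<^sub>k)\<close> indices \<open>n\<close> have a large
  coefficient there. So \<open>\<sigma>\<^sub>n\<close> is bounded below on a set of at least \<open>c N\<^sub>k\<close> indices \<open>n\<close>, and the sum of
  the corresponding basis vectors has norm both \<open>\<ge> c N\<^sub>k\<close> and \<open>O (N\<^sub>k / D\<^sub>k)\<close>, which is absurd for
  large \<open>k\<close>.
\<close>


section \<open>Consequences of greediness\<close>

locale normed_subspace =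
  fixes Y :: "'a::real_vector set" and nrm :: "'a \<Rightarrow> real"
  assumes subspace_Y: "subspace Y"
    and nrm_triangle: "u \<in> Y \<Longrightarrow> v \<in> Y \<Longrightarrow> nrm (u + v) \<le> nrm u + nrm v"
    and nrm_scale: "v \<in> Y \<Longrightarrow> nrm (r *\<^sub>R v) = \<bar>r\<bar> * nrm v"
    and nrm_nonneg: "v \<in> Y \<Longrightarrow> 0 \<le> nrm v"
begin

lemma add_in: "u \<in> Y \<Longrightarrow> v \<in> Y \<Longrightarrow> u + v \<in> Y"
  and scale_in: "v \<in> Y \<Longrightarrow> r *\<^sub>R v \<in> Y"
  and diff_in: "u \<in> Y \<Longrightarrow> v \<in> Y \<Longrightarrow> u - v \<in> Y"
  and zero_in: "0 \<in> Y"
  using subspace_Y by (auto simp: subspace_add subspace_scale subspace_diff subspace_0)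

lemma sum_in: "(\<And>n. n \<in> A \<Longrightarrow> f n \<in> Y) \<Longrightarrow> sum f A \<in> Y"
  using subspace_Y by (rule subspace_sum)

lemma nrm_zero [simp]: "nrm 0 = 0"
  using nrm_scale[OF zero_in, of 0] by simp

lemma nrm_diff_le: "u \<in> Y \<Longrightarrow> v \<in> Y \<Longrightarrow> nrm (u - v) \<le> nrm u + nrm v"
  using nrm_triangle[of u "(-1) *\<^sub>R v"] nrm_scale[of v "-1"] scale_in[of v "-1"] by simp

lemma nrm_sum_le: "(\<And>n. n \<in> A \<Longrightarrow> f n \<in> Y) \<Longrightarrow> nrm (sum f A) \<le> (\<Sum>n\<in>A. nrm (f n))"
proof (induction A rule: infinite_finite_induct)
  case (insert n A)
  then show ?case
    using nrm_triangle[of "f n" "sum f A"] sum_in[of A f] by force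
qed auto

lemma nrm_sums_finite:
  assumes "finite A" "\<And>n. n \<notin> A \<Longrightarrow> f n = 0"
  shows "nrm_sums nrm f (sum f A)"
proof -
  obtain m where m: "A \<subseteq> {..<m}"
    using assms(1) finite_nat_iff_bounded by auto
  have "sum f {..<N} = sum f A" if "N \<ge> m" for N
    using m that by (intro sum.mono_neutral_right) (auto intro: assms(2))
  then have "eventually (\<lambda>N. nrm (sum f A - sum f {..<N}) = 0) sequentially"
    by (intro eventually_sequentiallyI[of m]) simp
  then show ?thesis
    unfolding nrm_sums_def by (rule tendsto_eventually)
qed

lemma nrm_sums_add:
  assumes "nrm_sums nrm f u" "nrm_sums nrm g v" "u \<in> Y" "v \<in> Y" "range f \<subseteq> Y" "range g \<subseteq> Y"
  shows "nrm_sums nrm (\<lambda>n. f n + g n) (u + v)"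
  unfolding nrm_sums_def
proof (rule tendsto_sandwich)
  let ?U = "\<lambda>N. u - (\<Sum>n<N. f n)" and ?V = "\<lambda>N. v - (\<Sum>n<N. g n)"
  have UV: "?U N \<in> Y" "?V N \<in> Y" for N
    using assms by (auto intro!: diff_in sum_in)
  have eq: "u + v - (\<Sum>n<N. f n + g n) = ?U N + ?V N" for N
    by (simp add: sum.distrib)
  show "eventually (\<lambda>N. 0 \<le> nrm (u + v - (\<Sum>n<N. f n + g n))) sequentially"
    unfolding eq using UV by (intro always_eventually allI nrm_nonneg add_in)
  show "eventually (\<lambda>N. nrm (u + v - (\<Sum>n<N. f n + g n)) \<le> nrm (?U N) + nrm (?V N)) sequentially"
    unfolding eq using UV by (intro always_eventually allI nrm_triangle)
  show "(\<lambda>N. nrm (?U N) + nrm (?V N)) \<longlonglongrightarrow> 0"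
    using tendsto_add[OF assms(1,2)[unfolded nrm_sums_def]] by simp
qed auto

lemma nrm_sums_scale:
  assumes "nrm_sums nrm f u" "u \<in> Y" "range f \<subseteq> Y"
  shows "nrm_sums nrm (\<lambda>n. r *\<^sub>R f n) (r *\<^sub>R u)"
proof -
  have "nrm (r *\<^sub>R u - (\<Sum>n<N. r *\<^sub>R f n)) = \<bar>r\<bar> * nrm (u - (\<Sum>n<N. f n))" for N
    using assms by (subst nrm_scale[symmetric])
      (auto intro!: diff_in sum_in simp: scaleR_right_diff_distrib scaleR_sum_right)
  then show ?thesis
    using tendsto_mult_left[OF assms(1)[unfolded nrm_sums_def], of "\<bar>r\<bar>"]
    by (simp add: nrm_sums_def)
qed

text \<open>A coefficient in \<open>[-1, 1]\<close> is a convex combination of the signs 1 and -1.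
  The induction moves one term at a time, with either sign, into \<open>w\<close>, so that only sign
  choices remain to be bounded.\<close>

lemma nrm_convex_bound:
  assumes "finite A" "w \<in> Y" "\<And>n. n \<in> A \<Longrightarrow> f n \<in> Y" "\<And>n. n \<in> A \<Longrightarrow> \<bar>l n\<bar> \<le> 1"
    and "\<And>S. S \<subseteq> A \<Longrightarrow> nrm (w + (\<Sum>n\<in>S. f n) - (\<Sum>n\<in>A - S. f n)) \<le> B"
  shows "nrm (w + (\<Sum>n\<in>A. l n *\<^sub>R f n)) \<le> B"
  using assms
proof (induction A arbitrary: w rule: finite_induct)
  case (insert m A)
  let ?s = "\<Sum>n\<in>A. l n *\<^sub>R f n"
  have sY: "?s \<in> Y" "f m \<in> Y"
    using insert.prems by (auto intro!: sum_in scale_in)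
  have plus: "nrm ((w + f m) + ?s) \<le> B"
  proof (rule insert.IH)
    fix S assume S: "S \<subseteq> A"
    then have "m \<notin> S" "finite S" "insert m A - insert m S = A - S"
      using insert.hyps finite_subset by auto
    then show "nrm (w + f m + (\<Sum>n\<in>S. f n) - (\<Sum>n\<in>A - S. f n)) \<le> B"
      using insert.prems(4)[of "insert m S"] S by (simp add: add.assoc insert_mono subset_insertI2)
  qed (use insert.prems in \<open>auto intro: add_in\<close>)
  have minus: "nrm ((w - f m) + ?s) \<le> B"
  proof (rule insert.IH)
    fix S assume S: "S \<subseteq> A"
    then have "m \<notin> S" "finite S" "insert m A - S = insert m (A - S)" "m \<notin> A - S"
      using insert.hyps finite_subset by auto
    then show "nrm (w - f m + (\<Sum>n\<in>S. f n) - (\<Sum>n\<in>A - S. f n)) \<le> B"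
      using insert.prems(4)[of S] S insert.hyps by (auto simp: algebra_simps)
  qed (use insert.prems in \<open>auto intro: diff_in\<close>)
  define p q where "p = (1 + l m) / 2" and "q = (1 - l m) / 2"
  have pq: "p \<ge> 0" "q \<ge> 0" "p + q = 1" "p - q = l m"
    using insert.prems(3)[of m] by (auto simp: p_def q_def field_simps)
  have "w + (\<Sum>n\<in>insert m A. l n *\<^sub>R f n) = (w + ?s) + l m *\<^sub>R f m"
    using insert.hyps by simp
  also have "\<dots> = (p + q) *\<^sub>R (w + ?s) + (p - q) *\<^sub>R f m"
    by (simp add: pq)
  also have "\<dots> = p *\<^sub>R ((w + f m) + ?s) + q *\<^sub>R ((w - f m) + ?s)"
    by (simp add: scaleR_add_left scaleR_add_right scaleR_diff_left scaleR_diff_right)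
  finally have "nrm (w + (\<Sum>n\<in>insert m A. l n *\<^sub>R f n))
      \<le> p * nrm ((w + f m) + ?s) + q * nrm ((w - f m) + ?s)"
    using nrm_triangle[of "p *\<^sub>R ((w + f m) + ?s)" "q *\<^sub>R ((w - f m) + ?s)"] sY insert.prems(1) pq
    by (simp add: nrm_scale add_in diff_in scale_in)
  also have "\<dots> \<le> p * B + q * B"
    using plus minus pq by (intro add_mono mult_left_mono)
  also have "\<dots> = B"
    by (simp add: distrib_right[symmetric] pq)
  finally show ?case .
next
  case empty
  then show ?case using empty.prems(4)[of "{}"] by simp
qed

end

section \<open>Greedy bases are unconditional and democratic\<close>

locale greedy_setting = normed_subspace +
  fixes x
  assumes greedy: "greedy_basis nrm Y x"
begin

abbreviation xs where "xs \<equiv> basis_coord nrm x"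

lemma basis: "basis_of nrm Y x"
  using greedy by (simp add: greedy_basis_def)

lemma x_in: "x n \<in> Y"
  using basis by (auto simp: basis_of_def)

lemma coord_sums: "v \<in> Y \<Longrightarrow> nrm_sums nrm (\<lambda>n. xs n v *\<^sub>R x n) v"
  using basis theI'[of "\<lambda>c. nrm_sums nrm (\<lambda>k. c k *\<^sub>R x k) v"]
  unfolding basis_of_def basis_coord_def by (metis (no_types))

lemma coord_unique:
  assumes "v \<in> Y" "nrm_sums nrm (\<lambda>n. c n *\<^sub>R x n) v"
  shows "xs n v = c n"
proof -
  have "\<exists>!c. nrm_sums nrm (\<lambda>n. c n *\<^sub>R x n) v"
    using basis assms(1) by (auto simp: basis_of_def)
  then have "(THE c. nrm_sums nrm (\<lambda>k. c k *\<^sub>R x k) v) = c"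
    by (rule the1_equality[of "\<lambda>c. nrm_sums nrm (\<lambda>k. c k *\<^sub>R x k) v", OF _ assms(2)])
  then show ?thesis
    by (simp add: basis_coord_def)
qed

lemma coord_add: "u \<in> Y \<Longrightarrow> v \<in> Y \<Longrightarrow> xs n (u + v) = xs n u + xs n v"
  using nrm_sums_add[OF coord_sums coord_sums, of u v]
  by (intro coord_unique add_in) (auto simp: scaleR_add_left intro: scale_in x_in)

lemma coord_scale: "v \<in> Y \<Longrightarrow> xs n (r *\<^sub>R v) = r * xs n v"
  using nrm_sums_scale[OF coord_sums, of v r]
  by (intro coord_unique scale_in) (auto intro: scale_in x_in)

lemma coord_finite_sum:
  assumes "finite A"
  shows "xs n (\<Sum>k\<in>A. c k *\<^sub>R x k) = (if n \<in> A then c n else 0)"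
proof -
  let ?c = "\<lambda>n. if n \<in> A then c n else 0"
  have "nrm_sums nrm (\<lambda>k. ?c k *\<^sub>R x k) (\<Sum>k\<in>A. ?c k *\<^sub>R x k)"
    using assms by (intro nrm_sums_finite) auto
  also have "(\<Sum>k\<in>A. ?c k *\<^sub>R x k) = (\<Sum>k\<in>A. c k *\<^sub>R x k)"
    by (intro sum.cong) auto
  finally show ?thesis
    by (intro coord_unique) (auto intro!: sum_in scale_in x_in)
qed

lemma coord_basis: "xs n (x m) = (if n = m then 1 else 0)"
  using coord_finite_sum[of "{m}" n "\<lambda>_. 1"] by auto

lemma nrm_x_bounds: "\<exists>c>0. \<exists>C. \<forall>n. c \<le> nrm (x n) \<and> nrm (x n) \<le> C"
proof -
  have sn: "0 < (INF n. nrm (x n))" "bdd_above (range (\<lambda>n. nrm (x n)))"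
    using basis by (auto simp: basis_of_def semi_normalized_def)
  have "bdd_below (range (\<lambda>n. nrm (x n)))"
    using nrm_nonneg x_in by (intro bdd_belowI[of _ 0]) auto
  then have "(INF n. nrm (x n)) \<le> nrm (x n)" for n
    by (rule cINF_lower) simp
  moreover obtain C where "\<And>n. nrm (x n) \<le> C"
    using sn(2) by (auto simp: bdd_above_def)
  ultimately show ?thesis
    using sn(1) by blast
qed

text \<open>A single term of the expansion is the difference of two consecutive remainders; the
  norms of the remainders converge, hence are bounded, and \<open>nrm (x n)\<close> is bounded
  below.\<close>

lemma coord_bounded:
  assumes v: "v \<in> Y"
  shows "\<exists>t>0. \<forall>n. \<bar>xs n v\<bar> \<le> t"
proof -
  obtain c C where c: "c > 0" "\<And>n. c \<le> nrm (x n)"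
    using nrm_x_bounds by blast
  let ?e = "\<lambda>N. nrm (v - (\<Sum>n<N. xs n v *\<^sub>R x n))"
  have "?e \<longlonglongrightarrow> 0"
    using coord_sums[OF v] by (simp add: nrm_sums_def)
  then have "Bseq ?e"
    using convergentI convergent_imp_Bseq by blast
  then obtain B where B: "\<And>N. ?e N \<le> B"
    unfolding Bseq_def real_norm_def by (meson abs_le_D1)
  have "\<bar>xs n v\<bar> \<le> 2 * B / c" for n
  proof -
    let ?s = "\<lambda>N. \<Sum>n<N. xs n v *\<^sub>R x n"
    have "\<bar>xs n v\<bar> * c \<le> \<bar>xs n v\<bar> * nrm (x n)"
      by (intro mult_left_mono c) auto
    also have "\<dots> = nrm (xs n v *\<^sub>R x n)"
      by (simp add: nrm_scale x_in)
    also have "xs n v *\<^sub>R x n = (v - ?s n) - (v - ?s (Suc n))"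
      by simp
    also have "nrm \<dots> \<le> ?e n + ?e (Suc n)"
      by (intro nrm_diff_le diff_in sum_in scale_in x_in v)
    also have "\<dots> \<le> 2 * B"
      using B[of n] B[of "Suc n"] by simp
    finally show ?thesis
      using c(1) by (simp add: field_simps)
  qed
  then have "\<bar>xs n v\<bar> \<le> max 1 (2 * B / c)" for n
    by (meson max.coboundedI2)
  then show ?thesis
    by (intro exI[of _ "max 1 (2 * B / c)"]) auto
qed

lemma best_error_le:
  assumes "finite A" "v \<in> Y"
  shows "best_error nrm x (card A) v \<le> nrm (v - (\<Sum>n\<in>A. \<alpha> n *\<^sub>R x n))"
  unfolding best_error_def
  using assms
  by (intro cInf_lower bdd_belowI[of _ 0]) (auto intro!: nrm_nonneg diff_in sum_in scale_in x_in)

lemma greedy_constant: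
  "\<exists>C. \<forall>v\<in>Y. \<forall>\<Lambda>. finite \<Lambda> \<longrightarrow> (\<forall>i\<in>\<Lambda>. \<forall>j. j \<notin> \<Lambda> \<longrightarrow> \<bar>xs i v\<bar> \<ge> \<bar>xs j v\<bar>) \<longrightarrow>
    nrm (v - (\<Sum>n\<in>\<Lambda>. xs n v *\<^sub>R x n)) \<le> C * best_error nrm x (card \<Lambda>) v"
proof -
  obtain C where "\<forall>v\<in>Y. \<forall>N. \<forall>\<Lambda>. finite \<Lambda> \<and> card \<Lambda> = N \<and>
        (\<forall>i\<in>\<Lambda>. \<forall>j. j \<notin> \<Lambda> \<longrightarrow> \<bar>xs i v\<bar> \<ge> \<bar>xs j v\<bar>) \<longrightarrow>
        nrm (v - (\<Sum>n\<in>\<Lambda>. xs n v *\<^sub>R x n)) \<le> C * best_error nrm x N v"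
    using greedy unfolding greedy_basis_def by (elim conjE exE)
  then show ?thesis
    by (intro exI[of _ C]) simp
qed

text \<open>Raising the coefficients on \<open>A\<close> above all the others turns \<open>A\<close> into a greedy set.\<close>

lemma suppression:
  "\<exists>K. \<forall>v\<in>Y. \<forall>A. finite A \<longrightarrow> nrm (v - (\<Sum>n\<in>A. xs n v *\<^sub>R x n)) \<le> K * nrm v"
proof -
  obtain C where C: "\<forall>v\<in>Y. \<forall>\<Lambda>. finite \<Lambda> \<longrightarrow> (\<forall>i\<in>\<Lambda>. \<forall>j. j \<notin> \<Lambda> \<longrightarrow> \<bar>xs i v\<bar> \<ge> \<bar>xs j v\<bar>) \<longrightarrow>
    nrm (v - (\<Sum>n\<in>\<Lambda>. xs n v *\<^sub>R x n)) \<le> C * best_error nrm x (card \<Lambda>) v"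
    using greedy_constant by (elim exE)
  show ?thesis
  proof (intro exI[of _ "\<bar>C\<bar>"] ballI allI impI)
    fix v A assume v: "v \<in> Y" and A: "finite (A :: nat set)"
    obtain t where t: "t > 0" "\<And>n. \<bar>xs n v\<bar> \<le> t"
      using coord_bounded[OF v] by blast
    define w where "w = v + (\<Sum>n\<in>A. (t - xs n v) *\<^sub>R x n)"
    have sY: "(\<Sum>n\<in>A. (t - xs n v) *\<^sub>R x n) \<in> Y"
      by (intro sum_in scale_in x_in)
    have w: "w \<in> Y"
      unfolding w_def by (intro add_in v sY)
    have xw: "xs n w = (if n \<in> A then t else xs n v)" for n
      unfolding w_def using coord_finite_sum[OF A, of n "\<lambda>n. t - xs n v"]
      by (simp add: coord_add[OF v sY])
    have "(\<Sum>n\<in>A. xs n w *\<^sub>R x n) = (\<Sum>n\<in>A. t *\<^sub>R x n)"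
      by (simp add: xw)
    then have "w - (\<Sum>n\<in>A. xs n w *\<^sub>R x n) = v - (\<Sum>n\<in>A. xs n v *\<^sub>R x n)"
      by (simp add: w_def scaleR_diff_left sum_subtractf)
    moreover have "nrm (w - (\<Sum>n\<in>A. xs n w *\<^sub>R x n)) \<le> C * best_error nrm x (card A) w"
      using t by (intro C[rule_format] w A) (auto simp: xw)
    \<comment> \<open>Subtracting the raise on \<open>A\<close> is a competitor with
      \<open>card A\<close> terms, and it leaves \<open>v\<close> itself.\<close>
    moreover have "best_error nrm x (card A) w \<le> nrm (w - (\<Sum>n\<in>A. (t - xs n v) *\<^sub>R x n))"
      by (rule best_error_le[OF A w])
    moreover have "w - (\<Sum>n\<in>A. (t - xs n v) *\<^sub>R x n) = v"
      by (simp add: w_def)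
    moreover have "best_error nrm x (card A) w \<ge> 0"
      unfolding best_error_def using w A
      by (intro cInf_greatest) (auto intro!: nrm_nonneg diff_in sum_in scale_in x_in)
    ultimately show "nrm (v - (\<Sum>n\<in>A. xs n v *\<^sub>R x n)) \<le> \<bar>C\<bar> * nrm v"
      using mult_right_mono[OF abs_ge_self[of C], of "best_error nrm x (card A) w"]
        mult_left_mono[of "best_error nrm x (card A) w" "nrm v" "\<bar>C\<bar>"]
      by simp
  qed
qed

text \<open>Suppression bounds the partial sums over finite sets by \<open>1 + K\<close>. A choice
  of signs is a difference of two such projections, and \<open>nrm_convex_bound\<close> passes from
  signs to multipliers of modulus at most 1.\<close>

lemma multiplier_bound:
  "\<exists>K. \<forall>v\<in>Y. \<forall>A l. finite A \<longrightarrow> (\<forall>n\<in>A. \<bar>l n\<bar> \<le> 1) \<longrightarrow>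
     nrm (\<Sum>n\<in>A. (l n * xs n v) *\<^sub>R x n) \<le> K * nrm v"
proof -
  obtain K where K: "\<And>v A. v \<in> Y \<Longrightarrow> finite A \<Longrightarrow>
      nrm (v - (\<Sum>n\<in>A. xs n v *\<^sub>R x n)) \<le> K * nrm v"
    using suppression by blast
  have P: "nrm (\<Sum>n\<in>A. xs n v *\<^sub>R x n) \<le> (1 + K) * nrm v" if "v \<in> Y" "finite A" for v A
    using nrm_diff_le[of v "v - (\<Sum>n\<in>A. xs n v *\<^sub>R x n)"] K[OF that] that(1)
    by (simp add: diff_in sum_in scale_in x_in algebra_simps)
  show ?thesis
  proof (intro exI[of _ "2 * (1 + K)"] ballI allI impI)
    fix v A and l :: "nat \<Rightarrow> real"
    assume v: "v \<in> Y" and A: "finite (A :: nat set)" and l: "\<forall>n\<in>A. \<bar>l n\<bar> \<le> 1"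
    have "nrm (0 + (\<Sum>n\<in>A. l n *\<^sub>R (xs n v *\<^sub>R x n))) \<le> 2 * (1 + K) * nrm v"
    proof (rule nrm_convex_bound)
      fix S assume S: "S \<subseteq> A"
      then have fS: "finite S" "finite (A - S)"
        using A finite_subset by auto
      have "nrm (0 + (\<Sum>n\<in>S. xs n v *\<^sub>R x n) - (\<Sum>n\<in>A - S. xs n v *\<^sub>R x n))
          \<le> nrm (\<Sum>n\<in>S. xs n v *\<^sub>R x n) + nrm (\<Sum>n\<in>A - S. xs n v *\<^sub>R x n)"
        by (simp add: nrm_diff_le sum_in scale_in x_in)
      also have "\<dots> \<le> 2 * (1 + K) * nrm v"
        using P[OF v fS(1)] P[OF v fS(2)] by (simp add: algebra_simps)
      finally show "nrm (0 + (\<Sum>n\<in>S. xs n v *\<^sub>R x n) - (\<Sum>n\<in>A - S. xs n v *\<^sub>R x n))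
          \<le> 2 * (1 + K) * nrm v" .
    qed (use A l in \<open>auto intro: zero_in scale_in x_in\<close>)
    then show "nrm (\<Sum>n\<in>A. (l n * xs n v) *\<^sub>R x n) \<le> 2 * (1 + K) * nrm v"
      by simp
  qed
qed

text \<open>All coefficients of the sum over \<open>A \<union> B\<close> are equal, so
  \<open>A\<close> is a greedy set for it, while removing \<open>B\<close> is a competitor with as
  many terms.\<close>

lemma disjoint_democracy:
  "\<exists>K. \<forall>A B. finite A \<longrightarrow> finite B \<longrightarrow> A \<inter> B = {} \<longrightarrow> card A = card B \<longrightarrow>
     nrm (\<Sum>n\<in>B. x n) \<le> K * nrm (\<Sum>n\<in>A. x n)"
proof -
  obtain C where C: "\<forall>v\<in>Y. \<forall>\<Lambda>. finite \<Lambda> \<longrightarrow> (\<forall>i\<in>\<Lambda>. \<forall>j. j \<notin> \<Lambda> \<longrightarrow> \<bar>xs i v\<bar> \<ge> \<bar>xs j v\<bar>) \<longrightarrow>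
    nrm (v - (\<Sum>n\<in>\<Lambda>. xs n v *\<^sub>R x n)) \<le> C * best_error nrm x (card \<Lambda>) v"
    using greedy_constant by (elim exE)
  show ?thesis
  proof (intro exI[of _ "\<bar>C\<bar>"] allI impI)
    fix A B :: "nat set" assume AB: "finite A" "finite B" "A \<inter> B = {}" "card A = card B"
    define w where "w = (\<Sum>n\<in>A \<union> B. 1 *\<^sub>R x n)"
    have w: "w \<in> Y"
      unfolding w_def by (intro sum_in scale_in x_in)
    have xw: "xs n w = (if n \<in> A \<union> B then 1 else 0)" for n
      unfolding w_def using AB by (subst coord_finite_sum) auto
    have w_eq: "w = (\<Sum>n\<in>A. x n) + (\<Sum>n\<in>B. x n)"
      using AB by (simp add: w_def sum.union_disjoint)
    have "nrm (w - (\<Sum>n\<in>A. xs n w *\<^sub>R x n)) \<le> C * best_error nrm x (card A) w"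
      using AB by (intro C[rule_format] w) (auto simp: xw)
    moreover have "(\<Sum>n\<in>A. xs n w *\<^sub>R x n) = (\<Sum>n\<in>A. x n)"
      by (simp add: xw)
    then have "w - (\<Sum>n\<in>A. xs n w *\<^sub>R x n) = (\<Sum>n\<in>B. x n)"
      by (simp add: w_eq)
    moreover have "best_error nrm x (card B) w \<le> nrm (w - (\<Sum>n\<in>B. 1 *\<^sub>R x n))"
      by (rule best_error_le[OF AB(2) w])
    moreover have "w - (\<Sum>n\<in>B. 1 *\<^sub>R x n) = (\<Sum>n\<in>A. x n)"
      by (simp add: w_eq)
    moreover have "best_error nrm x (card A) w \<ge> 0"
      unfolding best_error_def using w AB
      by (intro cInf_greatest) (auto intro!: nrm_nonneg diff_in sum_in scale_in x_in)
    ultimately show "nrm (\<Sum>n\<in>B. x n) \<le> \<bar>C\<bar> * nrm (\<Sum>n\<in>A. x n)"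
      using mult_right_mono[OF abs_ge_self[of C], of "best_error nrm x (card A) w"] AB(4)
        mult_left_mono[of "best_error nrm x (card A) w" "nrm (\<Sum>n\<in>A. x n)" "\<bar>C\<bar>"]
      by simp
  qed
qed

end

section \<open>Averages over signs\<close>

text \<open>A choice of signs is encoded by the set where the sign is 1, so that an average over
  independent signs on \<open>A\<close> is a sum over \<open>Pow A\<close> divided by
  \<open>2 ^ card A\<close>.\<close>

definition sg :: "'a set \<Rightarrow> 'a \<Rightarrow> real" where
  "sg S n = (if n \<in> S then 1 else - 1)"

lemma abs_sg [simp]: "\<bar>sg S n\<bar> = 1"
  by (simp add: sg_def)

lemma sg_sq [simp]: "sg S n * sg S n = 1"
  by (simp add: sg_def)

lemma sum_Pow_insert:
  assumes "finite A" "a \<notin> A"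
  shows "(\<Sum>S\<in>Pow (insert a A). f S) = (\<Sum>S\<in>Pow A. f S + f (insert a S))"
proof -
  have "inj_on (insert a) (Pow A)"
    using assms(2) by (auto simp: inj_on_def)
  moreover have "Pow A \<inter> insert a ` Pow A = {}"
    using assms(2) by auto
  ultimately show ?thesis
    using assms(1) by (simp add: Pow_insert sum.union_disjoint sum.reindex sum.distrib)
qed

lemma sg_insert:
  assumes "a \<notin> S"
  shows "sg (insert a S) a = 1" "sg S a = - 1" "n \<noteq> a \<Longrightarrow> sg (insert a S) n = sg S n"
  using assms by (auto simp: sg_def)

lemma sum_sg_insert:
  assumes "finite A" "a \<notin> A" "S \<subseteq> A"
  shows "(\<Sum>n\<in>insert a A. sg S n * c n) = (\<Sum>n\<in>A. sg S n * c n) - c a"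
    and "(\<Sum>n\<in>insert a A. sg (insert a S) n * c n) = (\<Sum>n\<in>A. sg S n * c n) + c a"
proof -
  have "a \<notin> S" using assms by auto
  moreover have "(\<Sum>n\<in>A. sg (insert a S) n * c n) = (\<Sum>n\<in>A. sg S n * c n)"
    using assms by (intro sum.cong) (auto simp: sg_def)
  ultimately show "(\<Sum>n\<in>insert a A. sg S n * c n) = (\<Sum>n\<in>A. sg S n * c n) - c a"
    and "(\<Sum>n\<in>insert a A. sg (insert a S) n * c n) = (\<Sum>n\<in>A. sg S n * c n) + c a"
    using assms by (auto simp: sg_insert)
qed

lemma sum_sg_orthogonal:
  assumes "finite A" "n \<in> A" "m \<in> A"
  shows "(\<Sum>S\<in>Pow A. sg S n * sg S m) = (if n = m then 2 ^ card A else 0)"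
proof (cases "n = m")
  case True
  then show ?thesis using assms by (simp add: card_Pow)
next
  case False
  define B where "B = A - {n}"
  have B: "A = insert n B" "finite B" "n \<notin> B"
    using assms by (auto simp: B_def)
  have "(\<Sum>S\<in>Pow A. sg S n * sg S m) = (\<Sum>S\<in>Pow B. 0)"
    unfolding B(1) sum_Pow_insert[OF B(2,3)]
    using False B by (intro sum.cong) (auto simp: sg_def)
  then show ?thesis using False by simp
qed

text \<open>Adjoining \<open>a\<close> replaces each sum \<open>X\<close> by the pair
  \<open>X - c a\<close> and \<open>X + c a\<close>, in which the mixed terms cancel.\<close>

lemma sg_second_moment:
  assumes "finite A"
  shows "(\<Sum>S\<in>Pow A. (\<Sum>n\<in>A. sg S n * c n)\<^sup>2) = 2 ^ card A * (\<Sum>n\<in>A. (c n)\<^sup>2)"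
  using assms
proof (induction A rule: finite_induct)
  case (insert a A)
  have "(\<Sum>S\<in>Pow (insert a A). (\<Sum>n\<in>insert a A. sg S n * c n)\<^sup>2)
      = (\<Sum>S\<in>Pow A. 2 * (\<Sum>n\<in>A. sg S n * c n)\<^sup>2 + 2 * (c a)\<^sup>2)"
    unfolding sum_Pow_insert[OF insert.hyps(1,2)]
  proof (intro sum.cong refl)
    fix S assume "S \<in> Pow A"
    then show "(\<Sum>n\<in>insert a A. sg S n * c n)\<^sup>2 + (\<Sum>n\<in>insert a A. sg (insert a S) n * c n)\<^sup>2
        = 2 * (\<Sum>n\<in>A. sg S n * c n)\<^sup>2 + 2 * (c a)\<^sup>2"
      by (simp only: sum_sg_insert[OF insert.hyps(1,2)] Pow_iff)
        (simp add: power2_eq_square algebra_simps)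
  qed
  also have "\<dots> = 2 * (2 ^ card A * (\<Sum>n\<in>A. (c n)\<^sup>2)) + 2 ^ card A * (2 * (c a)\<^sup>2)"
    using insert by (simp add: sum.distrib sum_distrib_left[symmetric] card_Pow)
  finally show ?case
    using insert.hyps by (simp add: algebra_simps)
qed simp

lemma sg_fourth_moment:
  assumes "finite A"
  shows "(\<Sum>S\<in>Pow A. (\<Sum>n\<in>A. sg S n * c n) ^ 4) \<le> 2 ^ card A * (3 * (\<Sum>n\<in>A. (c n)\<^sup>2)\<^sup>2)"
  using assms
proof (induction A rule: finite_induct)
  case (insert a A)
  let ?X = "\<lambda>S. \<Sum>n\<in>A. sg S n * c n" and ?s = "\<Sum>n\<in>A. (c n)\<^sup>2"
  have "(\<Sum>S\<in>Pow (insert a A). (\<Sum>n\<in>insert a A. sg S n * c n) ^ 4)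
      = (\<Sum>S\<in>Pow A. 2 * ?X S ^ 4 + 12 * (c a)\<^sup>2 * (?X S)\<^sup>2 + 2 * (c a) ^ 4)"
    unfolding sum_Pow_insert[OF insert.hyps(1,2)]
  proof (intro sum.cong refl)
    fix S assume "S \<in> Pow A"
    then show "(\<Sum>n\<in>insert a A. sg S n * c n) ^ 4 + (\<Sum>n\<in>insert a A. sg (insert a S) n * c n) ^ 4
        = 2 * ?X S ^ 4 + 12 * (c a)\<^sup>2 * (?X S)\<^sup>2 + 2 * (c a) ^ 4"
      by (simp only: sum_sg_insert[OF insert.hyps(1,2)] Pow_iff)
        (simp add: power2_eq_square power4_eq_xxxx algebra_simps)
  qed
  also have "\<dots> = 2 * (\<Sum>S\<in>Pow A. ?X S ^ 4) + 12 * (c a)\<^sup>2 * (2 ^ card A * ?s)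
      + 2 ^ card A * (2 * (c a) ^ 4)"
    using insert.hyps
    by (simp add: sum.distrib sum_distrib_left[symmetric] card_Pow sg_second_moment)
  \<comment> \<open>Enlarging the last coefficient from 2 to 6 completes the square
    \<open>3 * (s + (c a)\<^sup>2)\<^sup>2\<close>, where \<open>s\<close> is the sum of squares
    over \<open>A\<close>.\<close>
  also have "\<dots> \<le> 2 * (2 ^ card A * (3 * ?s\<^sup>2)) + 12 * (c a)\<^sup>2 * (2 ^ card A * ?s)
      + 2 ^ card A * (6 * (c a) ^ 4)"
    using insert.IH by (intro add_mono mult_left_mono) auto
  also have "\<dots> = 2 ^ card (insert a A) * (3 * (\<Sum>n\<in>insert a A. (c n)\<^sup>2)\<^sup>2)"
    using insert.hyps by (simp add: power2_eq_square power4_eq_xxxx algebra_simps)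
  finally show ?case .
qed simp

text \<open>Khinchine's inequality, from \<open>\<bar>y\<bar> \<ge> y\<^sup>2 - (4 / 27) * y ^ 4\<close> and the moments above.\<close>

lemma Khinchine:
  assumes "finite A"
  shows "sqrt (\<Sum>n\<in>A. (c n)\<^sup>2) \<le> 9 / 5 * ((\<Sum>S\<in>Pow A. \<bar>\<Sum>n\<in>A. sg S n * c n\<bar>) / 2 ^ card A)"
proof -
  define s where "s = sqrt (\<Sum>n\<in>A. (c n)\<^sup>2)"
  let ?X = "\<lambda>S. \<Sum>n\<in>A. sg S n * c n"
  have s2: "s\<^sup>2 = (\<Sum>n\<in>A. (c n)\<^sup>2)" "s \<ge> 0"
    by (auto simp: s_def sum_nonneg)
  show ?thesis
  proof (cases "s = 0")
    case True
    then show ?thesis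
      using s_def by (simp add: sum_nonneg)
  next
    case False
    then have s: "s > 0" using s2 by simp
    \<comment> \<open>The difference of the two sides factors with a double root at
      \<open>\<bar>y\<bar> = 3 / 2\<close>.\<close>
    have elem: "y\<^sup>2 - 4 / 27 * y ^ 4 \<le> \<bar>y\<bar>" for y :: real
    proof -
      have "0 \<le> \<bar>y\<bar> * ((2 * \<bar>y\<bar> - 3)\<^sup>2 * (\<bar>y\<bar> + 3)) / 27"
        by simp
      also have "\<dots> = \<bar>y\<bar> - \<bar>y\<bar>\<^sup>2 + 4 / 27 * \<bar>y\<bar> ^ 4"
        by (simp only: power2_eq_square power4_eq_xxxx) (simp add: field_simps)
      finally show ?thesis by simp
    qed
    \<comment> \<open>With \<open>y = X / s\<close> the two moments leave
      \<open>s * (1 - 3 * 4 / 27) = 5 / 9 * s\<close>, whence the constant 9 / 5.\<close>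
    have "2 ^ card A * (5 / 9 * s) = (2 ^ card A * s\<^sup>2) / s - 4 / 27 * (2 ^ card A * (3 * (s\<^sup>2)\<^sup>2)) / s ^ 3"
      using s by (simp add: field_simps power2_eq_square power3_eq_cube)
    also have "\<dots> \<le> (2 ^ card A * s\<^sup>2) / s - 4 / 27 * (\<Sum>S\<in>Pow A. ?X S ^ 4) / s ^ 3"
      using sg_fourth_moment[OF assms, of c] s
      unfolding s2(1)[symmetric] by (intro diff_left_mono divide_right_mono mult_left_mono) auto
    also have "\<dots> = (\<Sum>S\<in>Pow A. s * ((?X S / s)\<^sup>2 - 4 / 27 * (?X S / s) ^ 4))"
      unfolding s2(1) sg_second_moment[OF assms, symmetric] using s
      by (simp add: sum_subtractf sum_divide_distrib sum_distrib_left power_divide field_simps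
          power2_eq_square power3_eq_cube power4_eq_xxxx)
    also have "\<dots> \<le> (\<Sum>S\<in>Pow A. s * \<bar>?X S / s\<bar>)"
      using s by (intro sum_mono mult_left_mono elem) auto
    also have "\<dots> = (\<Sum>S\<in>Pow A. \<bar>?X S\<bar>)"
      using s by (intro sum.cong) auto
    finally show ?thesis
      unfolding s_def[symmetric] by (simp add: field_simps)
  qed
qed

section \<open>Democratic systems in sequence lattices\<close>

lemma sum_fun_apply [simp]: "(\<Sum>a\<in>A. f a) i = (\<Sum>a\<in>A. f a i)"
  for f :: "'a \<Rightarrow> 'b \<Rightarrow> 'c::comm_monoid_add"
  by (induction A rule: infinite_finite_induct) (auto simp: zero_fun_def plus_fun_def)

lemma fun_ops_apply [simp]:
  fixes u v :: "'a \<Rightarrow> real"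
  shows "(u + v) i = u i + v i" "(u - v) i = u i - v i" "(r *\<^sub>R u) i = r * u i"
    "(0 :: 'a \<Rightarrow> real) i = 0"
  by (auto simp: plus_fun_def fun_diff_def scaleR_fun_def zero_fun_def)

definition unit_seq :: "nat \<Rightarrow> nat \<Rightarrow> real" where
  "unit_seq j i = (if i = j then 1 else 0)"

definition prj :: "nat set \<Rightarrow> (nat \<Rightarrow> real) \<Rightarrow> nat \<Rightarrow> real" where
  "prj S u i = (if i \<in> S then u i else 0)"

lemma prj_finite: "finite S \<Longrightarrow> prj S u = (\<Sum>j\<in>S. u j *\<^sub>R unit_seq j)"
  by (auto simp: prj_def unit_seq_def fun_eq_iff if_distrib cong: if_cong)

text \<open>At most \<open>2 * W / m\<close> values lie in the top layer from \<open>m / 2\<close>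
  to the maximum \<open>m\<close>, so their squares sum to at most \<open>2 * W * m\<close>. The
  other values are below \<open>m / 2\<close> and contribute \<open>4 * W * (m / 2)\<close> by
  induction.\<close>

lemma sum_squares_le_of_weak:
  fixes f :: "'a \<Rightarrow> real"
  assumes "finite A" "\<And>n. n \<in> A \<Longrightarrow> 0 \<le> f n" "\<And>n. n \<in> A \<Longrightarrow> f n \<le> b"
    and "\<And>t. t > 0 \<Longrightarrow> t * card {n\<in>A. t \<le> f n} \<le> W" "0 \<le> b" "0 \<le> W"
  shows "(\<Sum>n\<in>A. (f n)\<^sup>2) \<le> 4 * W * b"
  using assms
proof (induction "card A" arbitrary: A b rule: less_induct)
  case less
  show ?case
  proof (cases "\<exists>n\<in>A. f n > 0")
    case False
    then have "f n = 0" if "n \<in> A" for n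
      using less.prems(2)[OF that] that by force
    then show ?thesis using less.prems by simp
  next
    case True
    define m where "m = Max (f ` A)"
    have m_ge: "f n \<le> m" if "n \<in> A" for n
      unfolding m_def using less.prems(1) that by simp
    obtain n0 where n0: "n0 \<in> A" "f n0 = m"
      using True Max_in[of "f ` A"] less.prems(1) unfolding m_def by fastforce
    have m: "m > 0" "m \<le> b"
      using True m_ge n0 less.prems(3)[of n0] by force+
    define A' where "A' = {n\<in>A. f n < m / 2}"
    have "n0 \<notin> A'"
      using n0 m by (simp add: A'_def)
    then have "A' \<noteq> A"
      using n0(1) by metis
    then have A': "A' \<subset> A" "A - A' = {n\<in>A. m / 2 \<le> f n}"
      by (auto simp: A'_def psubset_eq)
    have "(\<Sum>n\<in>A'. (f n)\<^sup>2) \<le> 4 * W * (m / 2)"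
    proof (rule less.hyps)
      show "card A' < card A"
        using A' less.prems(1) by (intro psubset_card_mono)
      fix t :: real assume t: "t > 0"
      have "card {n\<in>A'. t \<le> f n} \<le> card {n\<in>A. t \<le> f n}"
        using less.prems(1) A'(1) by (intro card_mono) auto
      then show "t * card {n\<in>A'. t \<le> f n} \<le> W"
        using less.prems(4)[OF t] t mult_left_mono[of "real (card {n\<in>A'. t \<le> f n})" _ t]
        by (meson less_imp_le of_nat_mono order_trans)
    qed (use less.prems A' m in \<open>auto simp: A'_def intro: finite_subset\<close>)
    moreover have "(\<Sum>n\<in>A - A'. (f n)\<^sup>2) \<le> (\<Sum>n\<in>A - A'. m\<^sup>2)"
      using m_ge less.prems(2) by (intro sum_mono power_mono) auto
    moreover have "(\<Sum>n\<in>A - A'. m\<^sup>2) = 2 * m * (m / 2 * card {n\<in>A. m / 2 \<le> f n})"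
      unfolding A'(2) by (simp add: power2_eq_square)
    moreover have "\<dots> \<le> 2 * m * W"
      using less.prems(4)[of "m / 2"] m by (intro mult_left_mono) auto
    moreover have "(\<Sum>n\<in>A. (f n)\<^sup>2) = (\<Sum>n\<in>A'. (f n)\<^sup>2) + (\<Sum>n\<in>A - A'. (f n)\<^sup>2)"
      using less.prems(1) A'(1) by (simp add: sum.subset_diff[of A' A] psubset_imp_subset)
    ultimately have "(\<Sum>n\<in>A. (f n)\<^sup>2) \<le> 4 * W * m"
      by (simp add: algebra_simps)
    also have "\<dots> \<le> 4 * W * b"
      using m less.prems by (intro mult_left_mono) auto
    finally show ?thesis .
  qed
qed

text \<open>The properties of the coordinate space on which the argument rests. Up to the end of
  block \<open>k\<close> the norm is at least the \<open>l1\<close>-norm divided by a multiple of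
  \<open>D k\<close> (\<open>initial_l1\<close>), and up to constants the flat vector of the block
  attains this (\<open>block_norm\<close>). The number of vectors in \<open>disjoint_l1_nat\<close>
  bounds the number of rounding patterns in \<open>trace_bound\<close>. By \<open>M_double\<close> a
  block has at least half of the coordinates of the initial segment that it ends.\<close>

locale sequence_lattice = normed_subspace Y nn
  for Y :: "(nat \<Rightarrow> real) set" and nn :: "(nat \<Rightarrow> real) \<Rightarrow> real" +
  fixes M :: "nat \<Rightarrow> nat" and D :: "nat \<Rightarrow> real" and C :: real
  assumes solid: "u \<in> Y \<Longrightarrow> (\<And>i. \<bar>v i\<bar> \<le> \<bar>u i\<bar>) \<Longrightarrow> v \<in> Y \<and> nn v \<le> nn u"
    and coordinate_le: "u \<in> Y \<Longrightarrow> \<bar>u i\<bar> \<le> nn u"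
    and unit_in: "unit_seq j \<in> Y"
    and nn_unit: "nn (unit_seq j) \<le> C"
    and C_ge_1: "1 \<le> C"
    and l2_le: "u \<in> Y \<Longrightarrow> finite J \<Longrightarrow> sqrt (\<Sum>j\<in>J. (u j)\<^sup>2) \<le> C * nn u"
    and tails: "u \<in> Y \<Longrightarrow> (\<lambda>n. nn (prj {n..} u)) \<longlonglongrightarrow> 0"
    and M_double: "2 * M k \<le> M (Suc k)"
    and M_ge: "k \<le> M k"
    and D_pos: "D k > 0"
    and D_lim: "filterlim D at_top sequentially"
    and block_norm: "nn (prj {M k..<M (Suc k)} (\<lambda>_. 1)) \<le> C * (real (card {M k..<M (Suc k)}) / D k)"
    and initial_l1: "u \<in> Y \<Longrightarrow> (\<Sum>i<M (Suc k). \<bar>u i\<bar>) \<le> C * D k * nn u"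
    and disjoint_l1_nat: "finite (T :: nat set) \<Longrightarrow> card T \<le> (2 * (M (Suc k))\<^sup>2 + 1) ^ M (Suc k) \<Longrightarrow>
        (\<And>t. t \<in> T \<Longrightarrow> z t \<in> Y) \<Longrightarrow>
        (\<And>t i. t \<in> T \<Longrightarrow> i < M (Suc k) \<Longrightarrow> z t i = 0) \<Longrightarrow>
        (\<And>s t i. s \<in> T \<Longrightarrow> t \<in> T \<Longrightarrow> s \<noteq> t \<Longrightarrow> z s i = 0 \<or> z t i = 0) \<Longrightarrow>
        (\<Sum>t\<in>T. nn (z t)) \<le> C * nn (\<Sum>t\<in>T. z t)"
begin

lemma solid_in: "u \<in> Y \<Longrightarrow> (\<And>i. \<bar>v i\<bar> \<le> \<bar>u i\<bar>) \<Longrightarrow> v \<in> Y"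
  and solid_le: "u \<in> Y \<Longrightarrow> (\<And>i. \<bar>v i\<bar> \<le> \<bar>u i\<bar>) \<Longrightarrow> nn v \<le> nn u"
  using solid by blast+

lemma prj_in: "u \<in> Y \<Longrightarrow> prj S u \<in> Y"
  and prj_le: "u \<in> Y \<Longrightarrow> nn (prj S u) \<le> nn u"
  using solid[of u "prj S u"] by (auto simp: prj_def)

lemma nn_const_0 [simp]: "nn (\<lambda>_. 0) = 0"
  using nrm_zero by (simp only: zero_fun_def)

text \<open>The locale assumption is tied to the index type \<open>nat\<close>; a bijection carries
  it over to other types, such as the functions that index the pieces in
  \<open>trace_bound\<close>.\<close>

lemma disjoint_l1:
  assumes "finite T" "card T \<le> (2 * (M (Suc k))\<^sup>2 + 1) ^ M (Suc k)" "\<And>t. t \<in> T \<Longrightarrow> z t \<in> Y"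
    and "\<And>t i. t \<in> T \<Longrightarrow> i < M (Suc k) \<Longrightarrow> z t i = 0"
    and "\<And>s t i. s \<in> T \<Longrightarrow> t \<in> T \<Longrightarrow> s \<noteq> t \<Longrightarrow> z s i = 0 \<or> z t i = 0"
  shows "(\<Sum>t\<in>T. nn (z t)) \<le> C * nn (\<Sum>t\<in>T. z t)"
proof -
  obtain h where h: "bij_betw h {0..<card T} T"
    using ex_bij_betw_nat_finite[OF assms(1)] by blast
  have hT: "h t \<in> T" if "t \<in> {0..<card T}" for t
    using h that by (auto simp: bij_betw_def)
  have inj: "h s \<noteq> h t" if "s \<in> {0..<card T}" "t \<in> {0..<card T}" "s \<noteq> t" for s t
    using h that by (auto simp: bij_betw_def inj_on_def)
  have "(\<Sum>t\<in>{0..<card T}. nn (z (h t))) \<le> C * nn (\<Sum>t\<in>{0..<card T}. z (h t))"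
    by (rule disjoint_l1_nat[of _ k]) (use assms hT inj in \<open>simp_all\<close>)
  then show ?thesis
    using sum.reindex_bij_betw[OF h, of "\<lambda>t. nn (z t)"] sum.reindex_bij_betw[OF h, of z] by simp
qed

lemma nn_initial_le: "nn (prj {..<q} u) \<le> C * (\<Sum>i<q. \<bar>u i\<bar>)"
proof -
  have "nn (\<Sum>i<q. u i *\<^sub>R unit_seq i) \<le> (\<Sum>i<q. nn (u i *\<^sub>R unit_seq i))"
    by (intro nrm_sum_le scale_in unit_in)
  also have "\<dots> \<le> (\<Sum>i<q. \<bar>u i\<bar> * C)"
    by (intro sum_mono) (simp add: nrm_scale unit_in nn_unit mult_left_mono)
  finally show ?thesis
    by (simp add: prj_finite sum_distrib_left mult.commute)
qed

end

text \<open>What is kept of a greedy basis, with a common constant \<open>K\<close>: bounded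
  coordinates, unconditionality in the form \<open>multiplier\<close>, and democracy for disjoint
  sets.\<close>

locale democratic_system = sequence_lattice +
  fixes x :: "nat \<Rightarrow> nat \<Rightarrow> real" and xs :: "nat \<Rightarrow> (nat \<Rightarrow> real) \<Rightarrow> real" and K :: real
  assumes x_in: "x n \<in> Y"
    and xs_add: "u \<in> Y \<Longrightarrow> v \<in> Y \<Longrightarrow> xs n (u + v) = xs n u + xs n v"
    and xs_scale: "u \<in> Y \<Longrightarrow> xs n (r *\<^sub>R u) = r * xs n u"
    and xs_x: "xs n (x m) = (if n = m then 1 else 0)"
    and expansion: "u \<in> Y \<Longrightarrow> nrm_sums nn (\<lambda>n. xs n u *\<^sub>R x n) u"
    and K_ge_1: "1 \<le> K"
    and nn_x: "nn (x n) \<le> K"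
    and xs_le: "u \<in> Y \<Longrightarrow> \<bar>xs n u\<bar> \<le> K * nn u"
    and multiplier: "u \<in> Y \<Longrightarrow> finite A \<Longrightarrow> (\<And>n. n \<in> A \<Longrightarrow> \<bar>l n\<bar> \<le> 1) \<Longrightarrow>
        nn (\<Sum>n\<in>A. (l n * xs n u) *\<^sub>R x n) \<le> K * nn u"
    and democracy: "finite A \<Longrightarrow> finite B \<Longrightarrow> A \<inter> B = {} \<Longrightarrow> card A = card B \<Longrightarrow>
        nn (\<Sum>n\<in>B. x n) \<le> K * nn (\<Sum>n\<in>A. x n)"
begin

lemma xs_zero: "xs n 0 = 0"
  using xs_scale[OF zero_in, of n 0] by simp

lemma xs_sum: "(\<And>k. k \<in> A \<Longrightarrow> f k \<in> Y) \<Longrightarrow> xs n (\<Sum>k\<in>A. f k) = (\<Sum>k\<in>A. xs n (f k))"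
  by (induction A rule: infinite_finite_induct) (auto simp: xs_zero xs_add sum_in)

lemma xs_diff: "u \<in> Y \<Longrightarrow> v \<in> Y \<Longrightarrow> xs n (u - v) = xs n u - xs n v"
  using xs_add[of u "(-1) *\<^sub>R v" n] xs_scale[of v n "-1"] scale_in[of v "-1"] by simp

lemma xs_combination:
  "finite A \<Longrightarrow> xs n (\<Sum>k\<in>A. c k *\<^sub>R x k) = (if n \<in> A then c n else 0)"
  by (subst xs_sum) (auto simp: scale_in x_in xs_scale xs_x if_distrib cong: if_cong)

text \<open>The multiplier is \<open>c n / d n\<close>. Where \<open>d n = 0\<close> also
  \<open>c n = 0\<close>, in agreement with the value 0 of a quotient by 0.\<close>

lemma compare:
  assumes "finite A" "\<And>n. n \<in> A \<Longrightarrow> \<bar>c n\<bar> \<le> \<bar>d n\<bar>"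
  shows "nn (\<Sum>n\<in>A. c n *\<^sub>R x n) \<le> K * nn (\<Sum>n\<in>A. d n *\<^sub>R x n)"
proof -
  have "nn (\<Sum>n\<in>A. (c n / d n * xs n (\<Sum>n\<in>A. d n *\<^sub>R x n)) *\<^sub>R x n)
      \<le> K * nn (\<Sum>n\<in>A. d n *\<^sub>R x n)"
    using assms by (intro multiplier) (auto intro!: sum_in scale_in x_in simp: divide_le_eq)
  moreover have "(\<Sum>n\<in>A. (c n / d n * xs n (\<Sum>n\<in>A. d n *\<^sub>R x n)) *\<^sub>R x n) = (\<Sum>n\<in>A. c n *\<^sub>R x n)"
    using assms by (intro sum.cong refl) (force simp: xs_combination)
  ultimately show ?thesis by simp
qed

section \<open>Gliding hump and the lower \<open>l1\<close> estimate for sums of basis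
  vectors\<close>

lemma close_pair:
  assumes "infinite I" "0 < (d::real)"
  shows "\<exists>n\<in>I. \<exists>n'\<in>I. n \<noteq> n' \<and> (\<forall>i<q. \<bar>x n i - x n' i\<bar> \<le> d)"
proof -
  \<comment> \<open>Pigeonhole: the first \<open>q\<close> coordinates of \<open>x n\<close>,
    bounded by \<open>K\<close>, are rounded to multiples of \<open>d\<close>, which leaves finitely
    many patterns for infinitely many \<open>n\<close>.\<close>
  define \<phi> where "\<phi> = (\<lambda>n. restrict (\<lambda>i. \<lfloor>x n i / d\<rfloor>) {..<q})"
  define L where "L = \<lceil>K / d\<rceil> + 1"
  have "\<lfloor>x n i / d\<rfloor> \<in> {- L..L}" for n i
  proof -
    have "\<bar>x n i\<bar> \<le> K"
      using coordinate_le[OF x_in, of n i] nn_x[of n] by simp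
    then have "\<bar>x n i / d\<bar> \<le> K / d"
      using assms(2) by (simp add: divide_right_mono)
    then have "x n i / d \<le> K / d" "- (K / d) \<le> x n i / d"
      by linarith+
    then show ?thesis unfolding L_def atLeastAtMost_iff by linarith
  qed
  then have "\<phi> ` I \<subseteq> PiE {..<q} (\<lambda>_. {- L..L})"
    by (simp add: \<phi>_def image_subset_iff restrict_PiE_iff)
  then have "finite (\<phi> ` I)"
    using finite_PiE[of "{..<q}" "\<lambda>_. {- L..L}"] finite_subset by auto
  then obtain n where n: "n \<in> I" "infinite {m\<in>I. \<phi> m = \<phi> n}"
    using pigeonhole_infinite[OF assms(1), of \<phi>] by blast
  then obtain n' where n': "n' \<in> I" "\<phi> n' = \<phi> n" "n' \<noteq> n"
    using finite_subset[of "{m\<in>I. \<phi> m = \<phi> n}" "{n}"] by blast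
  have "\<bar>x n i - x n' i\<bar> \<le> d" if "i < q" for i
  proof -
    have "\<lfloor>x n i / d\<rfloor> = \<lfloor>x n' i / d\<rfloor>"
      using n'(2) that unfolding \<phi>_def by (metis lessThan_iff restrict_apply')
    then have "\<bar>x n i / d - x n' i / d\<bar> \<le> 1"
      by linarith
    then show ?thesis
      using assms(2) by (simp add: diff_divide_distrib[symmetric] divide_le_eq)
  qed
  then show ?thesis using n n' by metis
qed

text \<open>The invariant of the induction on \<open>r\<close> in \<open>gliding_hump\<close>: each
  round contributes two new indices and one vector \<open>z s\<close> on fresh coordinates, at the
  price of an error \<open>d\<close>.\<close>

definition hump where
  "hump A0 d q0 r I c z q \<longleftrightarrow>
    finite I \<and> I \<inter> A0 = {} \<and> card I = 2 * r \<and> (\<forall>n. \<bar>c n\<bar> \<le> 1) \<and>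
    nn ((\<Sum>n\<in>I. c n *\<^sub>R x n) - (\<Sum>s<r. z s)) \<le> real r * d \<and>
    (\<forall>s<r. z s \<in> Y \<and> 1 / K - d \<le> nn (z s) \<and> (\<forall>i. i < q0 \<or> q \<le> i \<longrightarrow> z s i = 0)) \<and>
    (\<forall>s<r. \<forall>t<r. s \<noteq> t \<longrightarrow> (\<forall>i. z s i = 0 \<or> z t i = 0)) \<and> q0 \<le> q"

lemma humpD:
  assumes "hump A0 d q0 r I c z q"
  shows "finite I" "I \<inter> A0 = {}" "card I = 2 * r" "\<bar>c n\<bar> \<le> 1"
    "nn ((\<Sum>n\<in>I. c n *\<^sub>R x n) - (\<Sum>s<r. z s)) \<le> real r * d"
    "s < r \<Longrightarrow> z s \<in> Y" "s < r \<Longrightarrow> 1 / K - d \<le> nn (z s)"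
    "s < r \<Longrightarrow> i < q0 \<or> q \<le> i \<Longrightarrow> z s i = 0"
    "s < r \<Longrightarrow> t < r \<Longrightarrow> s \<noteq> t \<Longrightarrow> z s i = 0 \<or> z t i = 0" "q0 \<le> q"
  using assms by (simp_all only: hump_def) metis+

text \<open>If \<open>x n\<close> and \<open>x n'\<close> almost agree on the first \<open>q\<close>
  coordinates, their difference is nearly supported beyond \<open>q\<close>, and its norm is at
  least \<open>1 / K\<close> because its \<open>n\<close>-th basis coordinate is 1. Cutting off its
  tail as well gives the next hump.\<close>

lemma gliding_hump:
  assumes "finite A0" "0 < d"
  shows "\<exists>I c z q. hump A0 d q0 r I c z q"
proof (induction r)
  case 0
  have "hump A0 d q0 0 {} (\<lambda>_. 0) (\<lambda>_. 0) q0"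
    by (simp add: hump_def)
  then show ?case by blast
next
  case (Suc r)
  then obtain I c z q where hump: "hump A0 d q0 r I c z q"
    by blast
  note I = humpD(1-4)[OF hump] and near = humpD(5)[OF hump] and z = humpD(6-8)[OF hump]
    and disj = humpD(9)[OF hump] and q = humpD(10)[OF hump]
  \<comment> \<open>The head is a sum of \<open>q\<close> terms of norm at most
    \<open>C * d1\<close>, so it stays within \<open>d / 2\<close>; the \<open>+ 1\<close> covers
    \<open>q = 0\<close>.\<close>
  define d1 where "d1 = d / (2 * C * (q + 1))"
  have d1: "d1 > 0"
    using assms(2) C_ge_1 by (simp add: d1_def)
  have "infinite (- (I \<union> A0))"
    using I(1) assms(1) by (simp add: Compl_eq_Diff_UNIV)
  then obtain n n' where n: "n \<notin> I \<union> A0" "n' \<notin> I \<union> A0" "n \<noteq> n'"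
    and close: "\<And>i. i < q \<Longrightarrow> \<bar>x n i - x n' i\<bar> \<le> d1"
    using close_pair[OF _ d1, of "- (I \<union> A0)" q] by blast
  define w where "w = x n - x n'"
  have w: "w \<in> Y"
    unfolding w_def by (intro diff_in x_in)
  have "xs n w = 1"
    using n by (simp add: w_def xs_diff x_in xs_x)
  then have nn_w: "1 / K \<le> nn w"
    using xs_le[OF w, of n] K_ge_1 by (simp add: divide_le_eq mult.commute)
  have "eventually (\<lambda>m. nn (prj {m..} w) < d / 2) sequentially"
    using tails[OF w] assms(2) by (intro order_tendstoD(2)) auto
  then obtain q1 where q1: "\<And>m. m \<ge> q1 \<Longrightarrow> nn (prj {m..} w) < d / 2"
    unfolding eventually_sequentially by blast
  define q' where "q' = max q q1"
  have small1: "nn (prj {q'..} w) < d / 2"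
    by (intro q1) (simp add: q'_def)
  have "nn (prj {..<q} w) \<le> C * (\<Sum>i<q. \<bar>w i\<bar>)"
    by (rule nn_initial_le)
  also have "\<dots> \<le> C * (\<Sum>i<q. d1)"
    using C_ge_1 close by (intro mult_left_mono sum_mono) (auto simp: w_def)
  also have "\<dots> = (d / 2) * (q / (q + 1))"
    using C_ge_1 by (simp add: d1_def)
  also have "\<dots> \<le> (d / 2) * 1"
    using assms(2) by (intro mult_left_mono) auto
  finally have small2: "nn (prj {..<q} w) \<le> d / 2" by simp
  define zr where "zr = prj {q..<q'} w"
  have zr: "zr \<in> Y"
    unfolding zr_def by (intro prj_in w)
  have "w - zr = prj {..<q} w + prj {q'..} w"
    by (rule ext) (auto simp: zr_def prj_def q'_def)
  then have near_w: "nn (w - zr) \<le> d"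
    using nrm_triangle[OF prj_in[OF w] prj_in[OF w], of "{..<q}" "{q'..}"] small1 small2 by simp
  have nn_zr: "1 / K - d \<le> nn zr"
    using nrm_triangle[OF diff_in[OF w zr] zr] near_w nn_w by simp
  define I' c' z' where "I' = insert n (insert n' I)" and "c' = c(n := 1, n' := - 1)"
    and "z' = z(r := zr)"
  have I': "finite I'" "I' \<inter> A0 = {}" "card I' = 2 * Suc r" "\<And>n. \<bar>c' n\<bar> \<le> 1"
    using I n by (auto simp: I'_def c'_def)
  have "(\<Sum>n\<in>I. c' n *\<^sub>R x n) = (\<Sum>n\<in>I. c n *\<^sub>R x n)"
    using n by (intro sum.cong) (auto simp: c'_def)
  then have sum_I': "(\<Sum>n\<in>I'. c' n *\<^sub>R x n) = (\<Sum>n\<in>I. c n *\<^sub>R x n) + w"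
    using n I(1) by (simp add: I'_def c'_def w_def)
  have sum_z': "(\<Sum>s<Suc r. z' s) = (\<Sum>s<r. z s) + zr"
    by (simp add: z'_def)
  have zsum: "(\<Sum>s<r. z s) \<in> Y"
    using z(1) by (intro sum_in) auto
  have "(\<Sum>n\<in>I'. c' n *\<^sub>R x n) - (\<Sum>s<Suc r. z' s)
      = ((\<Sum>n\<in>I. c n *\<^sub>R x n) - (\<Sum>s<r. z s)) + (w - zr)"
    unfolding sum_I' sum_z' by simp
  then have "nn ((\<Sum>n\<in>I'. c' n *\<^sub>R x n) - (\<Sum>s<Suc r. z' s))
      \<le> nn ((\<Sum>n\<in>I. c n *\<^sub>R x n) - (\<Sum>s<r. z s)) + nn (w - zr)"
    by (simp only:) (intro nrm_triangle diff_in sum_in scale_in x_in w zr zsum)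
  also have "\<dots> \<le> real r * d + d"
    using near near_w by (rule add_mono)
  finally have "nn ((\<Sum>n\<in>I'. c' n *\<^sub>R x n) - (\<Sum>s<Suc r. z' s)) \<le> Suc r * d"
    by (simp only: of_nat_Suc distrib_right mult_1_left add.commute)
  moreover have "z' s \<in> Y \<and> 1 / K - d \<le> nn (z' s) \<and> (\<forall>i. i < q0 \<or> q' \<le> i \<longrightarrow> z' s i = 0)"
    if "s < Suc r" for s
    using that z zr nn_zr q by (auto simp: z'_def zr_def prj_def q'_def less_Suc_eq)
  moreover have "z' s i = 0 \<or> z' t i = 0" if "s < Suc r" "t < Suc r" "s \<noteq> t" for s t i
    using that disj[of s t i] z(3)[of s i] z(3)[of t i]
    by (auto simp: z'_def zr_def prj_def less_Suc_eq)
  moreover have "q0 \<le> q'"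
    using q by (simp add: q'_def)
  ultimately have "hump A0 d q0 (Suc r) I' c' z' q'"
    unfolding hump_def using I' by (intro conjI allI impI) (auto simp del: sum.lessThan_Suc of_nat_Suc)
  then show ?case by blast
qed

definition lower where "lower = 1 / (4 * C * K ^ 3)"

lemma lower_pos: "lower > 0"
  using C_ge_1 K_ge_1 by (simp add: lower_def)

lemma le_disjoint_bound: "n \<le> (2 * n\<^sup>2 + 1) ^ n"
proof (cases "n = 0")
  case False
  then have "2 ^ n \<le> (2 * n\<^sup>2 + 1) ^ n"
    by (intro power_mono) auto
  then show ?thesis
    using less_exp[of n] by linarith
qed simp

text \<open>Humps beyond \<open>M (Suc r)\<close> add up as in \<open>l1\<close>, so some sum of
  \<open>2 * r\<close> basis vectors outside \<open>A\<close> has norm of order \<open>r\<close>.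
  Each half of these indices is then compared with \<open>A\<close> by democracy.\<close>

lemma l1_democracy:
  assumes "finite A"
  shows "lower * card A \<le> nn (\<Sum>n\<in>A. x n)"
proof -
  define r where "r = card A"
  \<comment> \<open>Each of the errors \<open>d\<close> and \<open>C * d\<close> is at most
    \<open>1 / (4 * K)\<close>, so half of \<open>1 / K\<close> survives.\<close>
  define d where "d = 1 / (4 * C * K)"
  have d: "d > 0"
    using C_ge_1 K_ge_1 by (simp add: d_def)
  obtain I c z q where hump: "hump A d (M (Suc r)) r I c z q"
    using gliding_hump[OF assms d] by blast
  note I = humpD(1-4)[OF hump] and near = humpD(5)[OF hump] and z = humpD(6-8)[OF hump]
    and disj = humpD(9)[OF hump]
  have "r \<le> M (Suc r)"
    using M_ge[of "Suc r"] by simp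
  then have "card {..<r} \<le> (2 * (M (Suc r))\<^sup>2 + 1) ^ M (Suc r)"
    using le_disjoint_bound[of "M (Suc r)"] by simp
  then have "(\<Sum>s<r. nn (z s)) \<le> C * nn (\<Sum>s<r. z s)"
    using z disj by (intro disjoint_l1) auto
  moreover have "(\<Sum>s<r. 1 / K - d) \<le> (\<Sum>s<r. nn (z s))"
    using z(2) by (intro sum_mono) auto
  moreover have "nn (\<Sum>s<r. z s) \<le> nn (\<Sum>n\<in>I. c n *\<^sub>R x n) + r * d"
  proof -
    have mem: "(\<Sum>s<r. z s) \<in> Y" "(\<Sum>n\<in>I. c n *\<^sub>R x n) \<in> Y"
      using z(1) by (auto intro!: sum_in scale_in x_in)
    show ?thesis
      using nrm_diff_le[of "\<Sum>n\<in>I. c n *\<^sub>R x n" "(\<Sum>n\<in>I. c n *\<^sub>R x n) - (\<Sum>s<r. z s)"]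
        near mem by (simp add: diff_in)
  qed
  moreover have "C * nn (\<Sum>s<r. z s) \<le> C * (nn (\<Sum>n\<in>I. c n *\<^sub>R x n) + r * d)"
    using calculation C_ge_1 by (intro mult_left_mono) auto
  ultimately have "r * (1 / K - d) \<le> C * (nn (\<Sum>n\<in>I. c n *\<^sub>R x n) + r * d)"
    by simp
  also have "\<dots> \<le> C * (K * nn (\<Sum>n\<in>I. x n) + r * d)"
    using C_ge_1 compare[OF I(1), of c "\<lambda>_. 1"] I(4) by (intro mult_left_mono add_right_mono) auto
  finally have "r * (1 / K - d - C * d) \<le> C * K * nn (\<Sum>n\<in>I. x n)"
    by (simp add: algebra_simps)
  moreover have "1 / (2 * K) \<le> 1 / K - d - C * d"
  proof -
    have "d \<le> 1 / (4 * K)" "C * d = 1 / (4 * K)"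
      using C_ge_1 K_ge_1 by (auto simp: d_def field_simps)
    then show ?thesis using K_ge_1 by (simp add: field_simps)
  qed
  ultimately have "r * (1 / (2 * K)) \<le> C * K * nn (\<Sum>n\<in>I. x n)"
    using mult_left_mono[of "1 / (2 * K)" "1 / K - d - C * d" "real r"] by linarith
  moreover obtain J where J: "J \<subseteq> I" "card J = r" "finite J"
    using obtain_subset_with_card_n[of r I] I(1,3) by auto
  have "nn (\<Sum>n\<in>I. x n) \<le> nn (\<Sum>n\<in>J. x n) + nn (\<Sum>n\<in>I - J. x n)"
    using J I(1) nrm_triangle[of "\<Sum>n\<in>I - J. x n" "\<Sum>n\<in>J. x n"]
    by (simp add: sum.subset_diff[of J I] sum_in x_in)
  moreover have "nn (\<Sum>n\<in>J. x n) \<le> K * nn (\<Sum>n\<in>A. x n)"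
    using J I(2) assms by (intro democracy) (auto simp: r_def)
  moreover have "nn (\<Sum>n\<in>I - J. x n) \<le> K * nn (\<Sum>n\<in>A. x n)"
    using J I assms by (intro democracy) (auto simp: r_def card_Diff_subset)
  moreover have "C * K * nn (\<Sum>n\<in>I. x n) \<le> C * K * (2 * (K * nn (\<Sum>n\<in>A. x n)))"
    using calculation C_ge_1 K_ge_1 by (intro mult_left_mono) auto
  ultimately have "r * (1 / (2 * K)) \<le> C * K * (2 * (K * nn (\<Sum>n\<in>A. x n)))"
    by linarith
  then show ?thesis
    using C_ge_1 K_ge_1 by (simp add: lower_def r_def field_simps power3_eq_cube)
qed

definition W where "W = K / lower"

lemma W_pos: "W > 0"
  using lower_pos K_ge_1 by (simp add: W_def)

text \<open>A multiplier of modulus at most 1 flattens the coefficients on \<open>A\<close> to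
  \<open>t\<close>, and \<open>l1_democracy\<close> bounds the flat sum from below.\<close>

lemma weak_l1:
  assumes "u \<in> Y" "finite A" "t > 0" "\<And>n. n \<in> A \<Longrightarrow> t \<le> \<bar>xs n u\<bar>"
  shows "t * card A \<le> W * nn u"
proof -
  have "nn (\<Sum>n\<in>A. (t / xs n u * xs n u) *\<^sub>R x n) \<le> K * nn u"
    using assms by (intro multiplier) (auto simp: divide_le_eq)
  also have "(\<Sum>n\<in>A. (t / xs n u * xs n u) *\<^sub>R x n) = t *\<^sub>R (\<Sum>n\<in>A. x n)"
    unfolding scaleR_sum_right using assms(3,4) by (intro sum.cong refl) force
  also have "nn (t *\<^sub>R (\<Sum>n\<in>A. x n)) = t * nn (\<Sum>n\<in>A. x n)"
    using assms(3) by (simp add: nrm_scale sum_in x_in)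
  finally have "t * nn (\<Sum>n\<in>A. x n) \<le> K * nn u" .
  moreover have "t * (lower * card A) \<le> t * nn (\<Sum>n\<in>A. x n)"
    using assms by (intro mult_left_mono l1_democracy) auto
  ultimately show ?thesis
    using lower_pos by (simp add: W_def field_simps)
qed

lemma small_squares:
  assumes "u \<in> Y" "finite A" "\<And>n. n \<in> A \<Longrightarrow> \<bar>xs n u\<bar> \<le> b" "0 \<le> b"
  shows "(\<Sum>n\<in>A. (xs n u)\<^sup>2) \<le> 4 * (W * nn u) * b"
proof -
  have "(\<Sum>n\<in>A. \<bar>xs n u\<bar>\<^sup>2) \<le> 4 * (W * nn u) * b"
    using assms W_pos nrm_nonneg[OF assms(1)]
    by (intro sum_squares_le_of_weak) (auto intro!: weak_l1)
  then show ?thesis by simp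
qed

lemma all_squares:
  assumes "u \<in> Y" "finite A"
  shows "(\<Sum>n\<in>A. (xs n u)\<^sup>2) \<le> 4 * W * K * (nn u)\<^sup>2"
  using small_squares[OF assms, of "K * nn u"] assms xs_le nrm_nonneg[OF assms(1)] K_ge_1
  by (simp add: power2_eq_square mult_ac)


section \<open>Sign averages and square functions of one block\<close>

definition block where "block k = {M k..<M (Suc k)}"

definition bsize where "bsize k = real (card (block k))"

definition sgv where "sgv k S = (\<Sum>j\<in>block k. sg S j *\<^sub>R unit_seq j)"

definition \<sigma> where "\<sigma> k n = sqrt (\<Sum>j\<in>block k. (xs n (unit_seq j))\<^sup>2)"

text \<open>A change of signs of the basis, truncated to the first \<open>R\<close> vectors. It is
  bounded uniformly in \<open>R\<close> and \<open>S\<close>, and averages over \<open>S\<close>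
  isolate diagonal terms.\<close>

definition Wop where "Wop R S u = (\<Sum>n<R. (sg S n * xs n u) *\<^sub>R x n)"

lemma finite_block [simp]: "finite (block k)"
  by (simp add: block_def)

lemma sgv_in: "sgv k S \<in> Y"
  unfolding sgv_def by (intro sum_in scale_in unit_in)

lemma nn_sgv: "nn (sgv k S) \<le> C * (bsize k / D k)"
proof -
  have "prj (block k) (\<lambda>_. 1) = (\<Sum>j\<in>block k. 1 *\<^sub>R unit_seq j)"
    by (simp add: prj_finite)
  then have "prj (block k) (\<lambda>_. 1) \<in> Y"
    using sum_in[of "block k" unit_seq] unit_in by simp
  moreover have "\<bar>sgv k S i\<bar> \<le> \<bar>prj (block k) (\<lambda>_. 1) i\<bar>" for i
    by (auto simp: sgv_def unit_seq_def prj_def if_distrib cong: if_cong)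
  ultimately have "nn (sgv k S) \<le> nn (prj (block k) (\<lambda>_. 1))"
    by (rule solid_le)
  then show ?thesis
    using block_norm[of k] by (simp add: block_def bsize_def)
qed

lemma xs_sgv: "xs n (sgv k S) = (\<Sum>j\<in>block k. sg S j * xs n (unit_seq j))"
  unfolding sgv_def by (subst xs_sum) (auto simp: scale_in unit_in xs_scale)

lemma \<sigma>_nonneg: "0 \<le> \<sigma> k n"
  by (simp add: \<sigma>_def sum_nonneg)

lemma \<sigma>_sq: "(\<sigma> k n)\<^sup>2 = (\<Sum>j\<in>block k. (xs n (unit_seq j))\<^sup>2)"
  by (simp add: \<sigma>_def sum_nonneg)

text \<open>By Khinchine, \<open>\<sigma> k n\<close> is at most a multiple of the average of
  \<open>\<bar>xs n (sgv k S)\<bar>\<close> over \<open>S\<close>. Unconditionality, used once for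
  this comparison and once to insert the absolute values, reduces everything to the norm of
  \<open>sgv k S\<close>, which is at most that of the flat vector.\<close>

lemma nn_\<sigma>_sum:
  assumes "\<And>n. \<bar>e n\<bar> \<le> 1"
  shows "nn (\<Sum>n<R. (e n * \<sigma> k n) *\<^sub>R x n) \<le> 9 / 5 * K\<^sup>2 * (C * (bsize k / D k))"
proof -
  let ?P = "Pow (block k)" and ?c = "9 / 5 / 2 ^ card (block k) :: real"
  define g where "g = (\<lambda>n. ?c * (\<Sum>S\<in>?P. \<bar>xs n (sgv k S)\<bar>))"
  have c: "?c \<ge> 0" by simp
  have g: "\<sigma> k n \<le> g n" "0 \<le> g n" for n
    using Khinchine[of "block k" "\<lambda>j. xs n (unit_seq j)"]
    by (auto simp: \<sigma>_def g_def xs_sgv intro!: sum_nonneg)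
  have le: "\<bar>e n * \<sigma> k n\<bar> \<le> \<bar>g n\<bar>" for n
    using mult_mono[OF assms[of n] g(1)[of n]] \<sigma>_nonneg[of k n] g(2)[of n]
    by (simp add: abs_mult)
  have "nn (\<Sum>n<R. (e n * \<sigma> k n) *\<^sub>R x n) \<le> K * nn (\<Sum>n<R. g n *\<^sub>R x n)"
    using le by (intro compare) auto
  also have "K * nn (\<Sum>n<R. g n *\<^sub>R x n) \<le> K * (?c * (\<Sum>S\<in>?P. K * (C * (bsize k / D k))))"
  proof (intro mult_left_mono)
    have "nn (\<Sum>n<R. g n *\<^sub>R x n) = nn (?c *\<^sub>R (\<Sum>S\<in>?P. \<Sum>n<R. \<bar>xs n (sgv k S)\<bar> *\<^sub>R x n))"
      by (simp add: g_def sum_distrib_left scaleR_sum_left scaleR_sum_right sum.swap[of _ ?P])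
    also have "\<dots> = ?c * nn (\<Sum>S\<in>?P. \<Sum>n<R. \<bar>xs n (sgv k S)\<bar> *\<^sub>R x n)"
      using c by (subst nrm_scale) (auto intro!: sum_in scale_in x_in)
    also have "\<dots> \<le> ?c * (\<Sum>S\<in>?P. nn (\<Sum>n<R. \<bar>xs n (sgv k S)\<bar> *\<^sub>R x n))"
      using c by (intro mult_left_mono nrm_sum_le sum_in scale_in x_in)
    also have "\<dots> \<le> ?c * (\<Sum>S\<in>?P. K * (C * (bsize k / D k)))"
    proof (intro mult_left_mono sum_mono c)
      fix S
      have "(\<Sum>n<R. \<bar>xs n (sgv k S)\<bar> *\<^sub>R x n) = (\<Sum>n<R. (sgn (xs n (sgv k S)) * xs n (sgv k S)) *\<^sub>R x n)"
        by (intro sum.cong refl) (simp only: abs_sgn mult.commute)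
      then have "nn (\<Sum>n<R. \<bar>xs n (sgv k S)\<bar> *\<^sub>R x n)
          = nn (\<Sum>n<R. (sgn (xs n (sgv k S)) * xs n (sgv k S)) *\<^sub>R x n)"
        by (rule arg_cong)
      also have "\<dots> \<le> K * nn (sgv k S)"
        by (intro multiplier sgv_in) (auto simp: abs_sgn_eq)
      also have "\<dots> \<le> K * (C * (bsize k / D k))"
        using K_ge_1 by (intro mult_left_mono nn_sgv) auto
      finally show "nn (\<Sum>n<R. \<bar>xs n (sgv k S)\<bar> *\<^sub>R x n) \<le> K * (C * (bsize k / D k))" .
    qed
    finally show "nn (\<Sum>n<R. g n *\<^sub>R x n) \<le> ?c * (\<Sum>S\<in>?P. K * (C * (bsize k / D k)))" .
  qed (use K_ge_1 in simp)
  also have "\<dots> = 9 / 5 * K\<^sup>2 * (C * (bsize k / D k))"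
    by (simp add: card_Pow power2_eq_square)
  finally show ?thesis .
qed

lemma Wop_in: "Wop R S u \<in> Y"
  unfolding Wop_def by (intro sum_in scale_in x_in)

lemma Wop_le: "u \<in> Y \<Longrightarrow> nn (Wop R S u) \<le> K * nn u"
  unfolding Wop_def by (intro multiplier) auto

lemma Wop_add: "u \<in> Y \<Longrightarrow> v \<in> Y \<Longrightarrow> Wop R S (u + v) = Wop R S u + Wop R S v"
  by (simp add: Wop_def xs_add distrib_left scaleR_add_left sum.distrib)

lemma Wop_scale: "u \<in> Y \<Longrightarrow> Wop R S (r *\<^sub>R u) = r *\<^sub>R Wop R S u"
  by (simp add: Wop_def xs_scale scaleR_sum_right mult_ac)

lemma Wop_zero: "Wop R S 0 = 0"
  by (simp add: Wop_def xs_zero)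

lemma Wop_sum: "(\<And>a. a \<in> A \<Longrightarrow> f a \<in> Y) \<Longrightarrow> Wop R S (\<Sum>a\<in>A. f a) = (\<Sum>a\<in>A. Wop R S (f a))"
  by (induction A rule: infinite_finite_induct) (auto simp: Wop_zero Wop_add sum_in)

text \<open>The trace of an operator on the span of a block that factors through the later blocks. On a
  finite set of vectors the latter look like \<open>L\<^sub>1\<close>: after rounding, everything happens in the span of
  disjoint vectors whose number is bounded in terms of \<open>M (Suc k)\<close> only.\<close>

lemma trace_bound:
  "\<bar>\<Sum>j\<in>block k. Wop R S (prj {M (Suc k)..} (Wop R S (unit_seq j))) j\<bar>
    \<le> 5 * K\<^sup>2 * C ^ 4 * (bsize k / D k)"
proof (cases "block k = {}")
  case True
  then show ?thesis using C_ge_1 D_pos[of k] by (simp add: bsize_def)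
next
  case False
  let ?B = "block k" and ?M = "M (Suc k)"
  define N where "N = card ?B"
  have N: "N \<ge> 1" "bsize k = N" "N \<le> ?M"
    using False by (auto simp: N_def bsize_def block_def Suc_le_eq card_gt_0_iff)
  \<comment> \<open>Rounding with step \<open>1 / m\<close> costs \<open>nn h / m\<close>, hence at
    most \<open>K * C / N\<close> for each of the \<open>N\<close> vectors \<open>y j\<close>: a
    bounded total.\<close>
  define m where "m = N\<^sup>2"
  have m: "m \<ge> 1"
    using N(1) by (simp add: m_def)
  define y where "y = (\<lambda>j. prj {?M..} (Wop R S (unit_seq j)))"
  have y_in: "y j \<in> Y" for j
    unfolding y_def by (intro prj_in Wop_in)
  have nn_y: "nn (y j) \<le> K * C" for j
  proof -
    have "nn (y j) \<le> nn (Wop R S (unit_seq j))"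
      unfolding y_def by (intro prj_le Wop_in)
    also have "\<dots> \<le> K * nn (unit_seq j)"
      by (intro Wop_le unit_in)
    also have "\<dots> \<le> K * C"
      using K_ge_1 nn_unit by (intro mult_left_mono) auto
    finally show ?thesis .
  qed
  \<comment> \<open>\<open>h\<close> dominates every \<open>\<bar>y j\<bar>\<close>, so the ratios
    \<open>y j i / h i\<close> lie in \<open>[-1, 1]\<close> and can be rounded on a finite
    grid.\<close>
  define h where "h = (\<Sum>j\<in>?B. (\<lambda>i. \<bar>y j i\<bar>))"
  have h_eq: "h i = (\<Sum>j\<in>?B. \<bar>y j i\<bar>)" for i
    by (simp add: h_def)
  have abs_y: "(\<lambda>i. \<bar>y j i\<bar>) \<in> Y" "nn (\<lambda>i. \<bar>y j i\<bar>) \<le> K * C" for j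
    using solid[OF y_in, of "\<lambda>i. \<bar>y j i\<bar>" j] nn_y[of j] by auto
  have h_in: "h \<in> Y"
    unfolding h_def by (intro sum_in abs_y)
  have nn_h: "nn h \<le> N * (K * C)"
  proof -
    have "nn h \<le> (\<Sum>j\<in>?B. nn (\<lambda>i. \<bar>y j i\<bar>))"
      unfolding h_def by (intro nrm_sum_le abs_y)
    also have "\<dots> \<le> (\<Sum>j\<in>?B. K * C)"
      by (intro sum_mono abs_y)
    finally show ?thesis by (simp add: N_def)
  qed
  have h_nonneg: "0 \<le> h i" for i
    by (simp add: h_eq sum_nonneg)
  have y_le_h: "\<bar>y j i\<bar> \<le> h i" if "j \<in> ?B" for i j
    unfolding h_eq using that by (intro member_le_sum) auto
  \<comment> \<open>A pattern records the rounded ratios of all \<open>j\<close> at one coordinate.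
    The level sets of \<open>pat\<close> cut \<open>h\<close> into disjoint pieces
    \<open>z t\<close>, and \<open>y j\<close> is nearly
    \<open>\<Sum>t\<in>T. (t j / m) *\<^sub>R z t\<close>.\<close>
  define pat where "pat = (\<lambda>i. restrict (\<lambda>j. \<lfloor>m * y j i / h i\<rfloor>) ?B)"
  define T where "T = PiE ?B (\<lambda>_. {- int m..int m})"
  define z where "z = (\<lambda>t i. if pat i = t then h i else 0)"
  have T: "finite T" "card T \<le> (2 * ?M\<^sup>2 + 1) ^ ?M"
  proof -
    show "finite T"
      unfolding T_def by (intro finite_PiE) auto
    have "card T = (2 * m + 1) ^ N"
      by (simp add: T_def card_PiE N_def nat_add_distrib nat_mult_distrib)
    also have "\<dots> \<le> (2 * ?M\<^sup>2 + 1) ^ N"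
      using N(3) by (intro power_mono) (auto simp: m_def power_mono)
    also have "\<dots> \<le> (2 * ?M\<^sup>2 + 1) ^ ?M"
      using N(3) by (intro power_increasing) auto
    finally show "card T \<le> (2 * ?M\<^sup>2 + 1) ^ ?M" .
  qed
  have pat_T: "pat i \<in> T" for i
  proof -
    have "\<lfloor>m * y j i / h i\<rfloor> \<in> {- int m..int m}" if "j \<in> ?B" for j
    proof -
      have "\<bar>y j i / h i\<bar> \<le> 1"
        using y_le_h[OF that, of i] h_nonneg[of i] by (simp add: divide_le_eq)
      then have "m * \<bar>y j i / h i\<bar> \<le> m"
        using mult_left_mono[of "\<bar>y j i / h i\<bar>" 1 "real m"] by simp
      then have "\<bar>m * y j i / h i\<bar> \<le> m"
        by (simp add: abs_mult)
      from abs_le_D1[OF this] abs_le_D2[OF this]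
      have "- real m \<le> m * y j i / h i" "m * y j i / h i \<le> real m"
        by simp_all
      then show ?thesis
        unfolding atLeastAtMost_iff by (simp add: floor_le_iff le_floor_iff)
    qed
    then show ?thesis
      by (auto simp: pat_def T_def)
  qed
  have z_in: "z t \<in> Y" for t
    by (rule solid_in[OF h_in]) (simp add: z_def)
  define err where "err = (\<lambda>j. y j - (\<Sum>t\<in>T. (t j / m) *\<^sub>R z t))"
  have err_in: "err j \<in> Y" for j
    unfolding err_def by (intro diff_in sum_in scale_in y_in z_in)
  have err_le: "\<bar>err j i\<bar> \<le> \<bar>((1 / m) *\<^sub>R h) i\<bar>" if j: "j \<in> ?B" for i j
  proof -
    have "(\<Sum>t\<in>T. (t j / m) *\<^sub>R z t) i = (\<Sum>t\<in>T. if t = pat i then pat i j / m * h i else 0)"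
      unfolding sum_fun_apply by (intro sum.cong) (auto simp: z_def)
    also have "\<dots> = pat i j / m * h i"
      using pat_T T(1) by simp
    finally have eq: "err j i = y j i - \<lfloor>m * y j i / h i\<rfloor> / m * h i"
      using j by (simp add: err_def pat_def)
    show ?thesis
    proof (cases "h i = 0")
      case True
      then show ?thesis using eq y_le_h[OF j, of i] by simp
    next
      case False
      then have hi: "h i > 0" using h_nonneg[of i] by simp
      have "y j i - \<lfloor>m * y j i / h i\<rfloor> / m * h i = (m * y j i / h i - \<lfloor>m * y j i / h i\<rfloor>) * (h i / m)"
        using hi m by (simp add: field_simps)
      moreover have "\<bar>m * y j i / h i - \<lfloor>m * y j i / h i\<rfloor>\<bar> \<le> 1"
        by linarith
      ultimately have "\<bar>err j i\<bar> \<le> 1 * (h i / m)"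
        unfolding eq using hi m by (simp only: abs_mult) (intro mult_mono, auto)
      then show ?thesis using hi by simp
    qed
  qed
  have nn_err: "nn (err j) \<le> K * C / N" if "j \<in> ?B" for j
  proof -
    have "nn (err j) \<le> nn ((1 / m) *\<^sub>R h)"
      using err_le[OF that] by (intro solid_le scale_in h_in)
    also have "\<dots> = (1 / m) * nn h"
      by (simp add: nrm_scale h_in)
    also have "\<dots> \<le> (1 / m) * (N * (K * C))"
      using nn_h by (intro mult_left_mono) auto
    finally show ?thesis
      using N(1) by (simp add: m_def power2_eq_square field_simps)
  qed
  have y_eq: "y j = (\<Sum>t\<in>T. (t j / m) *\<^sub>R z t) + err j" for j
    by (simp add: err_def)
  let ?E = "bsize k / D k"
  \<comment> \<open>This lets bounded errors be absorbed into multiples of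
    \<open>bsize k / D k\<close>.\<close>
  have one_le: "1 \<le> C * ?E"
  proof -
    obtain j where j: "j \<in> ?B" using False by blast
    have "1 \<le> \<bar>sgv k {} j\<bar>"
      using j by (simp add: sgv_def unit_seq_def sg_def if_distrib cong: if_cong)
    also have "\<dots> \<le> nn (sgv k {})"
      by (intro coordinate_le sgv_in)
    finally show ?thesis using nn_sgv[of k "{}"] by simp
  qed
  \<comment> \<open>\<open>H Q t\<close> is the coefficient of \<open>z t\<close> in the sum of the
    rounded vectors with signs \<open>Q\<close>. The weighted sum of its absolute values over
    \<open>t\<close> is controlled by \<open>disjoint_l1\<close>; by Khinchine, its average over
    \<open>Q\<close> controls the Euclidean norm of the coefficients \<open>t j / m\<close> over
    \<open>j\<close>, as Cauchy--Schwarz will require.\<close>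
  define H where "H = (\<lambda>Q t. \<Sum>j\<in>?B. sg Q j * (t j / m))"
  have H_sum: "(\<Sum>t\<in>T. \<bar>H Q t\<bar> * nn (z t)) \<le> C * (2 * (K * C * (C * ?E)))" for Q
  proof -
    have "(\<Sum>t\<in>T. nn (H Q t *\<^sub>R z t)) \<le> C * nn (\<Sum>t\<in>T. H Q t *\<^sub>R z t)"
    proof (rule disjoint_l1[OF T])
      fix t i assume "i < ?M"
      then have "h i = 0"
        by (simp add: h_eq y_def prj_def)
      then show "(H Q t *\<^sub>R z t) i = 0"
        by (simp add: z_def)
    qed (use z_in scale_in in blast, simp add: z_def)
    moreover have "nn (\<Sum>t\<in>T. H Q t *\<^sub>R z t) \<le> 2 * (K * C * (C * ?E))"
    proof -
      have "(\<Sum>t\<in>T. H Q t *\<^sub>R z t) = (\<Sum>j\<in>?B. sg Q j *\<^sub>R (\<Sum>t\<in>T. (t j / m) *\<^sub>R z t))"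
        by (simp add: H_def scaleR_sum_left scaleR_sum_right sum.swap[of _ T])
      moreover have "(\<Sum>t\<in>T. (t j / m) *\<^sub>R z t) = y j - err j" for j
        by (simp add: err_def)
      ultimately have "(\<Sum>t\<in>T. H Q t *\<^sub>R z t)
          = (\<Sum>j\<in>?B. sg Q j *\<^sub>R y j) - (\<Sum>j\<in>?B. sg Q j *\<^sub>R err j)"
        by (simp add: scaleR_right_diff_distrib sum_subtractf)
      then have "nn (\<Sum>t\<in>T. H Q t *\<^sub>R z t)
          \<le> nn (\<Sum>j\<in>?B. sg Q j *\<^sub>R y j) + nn (\<Sum>j\<in>?B. sg Q j *\<^sub>R err j)"
        by (simp only:) (intro nrm_diff_le sum_in scale_in y_in err_in)
      also have "\<dots> \<le> K * C * (C * ?E) + K * C * (C * ?E)"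
      proof (intro add_mono)
        have "Wop R S (sgv k Q) = (\<Sum>j\<in>?B. sg Q j *\<^sub>R Wop R S (unit_seq j))"
          unfolding sgv_def by (subst Wop_sum) (auto simp: scale_in unit_in Wop_scale)
        then have "(\<Sum>j\<in>?B. sg Q j *\<^sub>R y j) = prj {?M..} (Wop R S (sgv k Q))"
          by (intro ext) (simp add: y_def prj_def)
        then have "nn (\<Sum>j\<in>?B. sg Q j *\<^sub>R y j) = nn (prj {?M..} (Wop R S (sgv k Q)))"
          by (rule arg_cong)
        also have "\<dots> \<le> nn (Wop R S (sgv k Q))"
          by (intro prj_le Wop_in)
        also have "\<dots> \<le> K * nn (sgv k Q)"
          by (intro Wop_le sgv_in)
        also have "\<dots> \<le> K * 1 * (C * ?E)"
          using K_ge_1 by (simp only: mult_1_right) (intro mult_left_mono nn_sgv, auto)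
        also have "\<dots> \<le> K * C * (C * ?E)"
          using K_ge_1 C_ge_1 one_le by (intro mult_right_mono mult_left_mono) auto
        finally show "nn (\<Sum>j\<in>?B. sg Q j *\<^sub>R y j) \<le> K * C * (C * ?E)" .
      next
        have "nn (\<Sum>j\<in>?B. sg Q j *\<^sub>R err j) \<le> (\<Sum>j\<in>?B. nn (sg Q j *\<^sub>R err j))"
          by (intro nrm_sum_le scale_in err_in)
        also have "\<dots> \<le> (\<Sum>j\<in>?B. K * C / N)"
          by (intro sum_mono) (simp add: nrm_scale err_in nn_err)
        also have "\<dots> = K * C * 1"
          using N by (simp add: N_def[symmetric])
        also have "\<dots> \<le> K * C * (C * ?E)"
          using K_ge_1 C_ge_1 one_le by (intro mult_left_mono) auto
        finally show "nn (\<Sum>j\<in>?B. sg Q j *\<^sub>R err j) \<le> K * C * (C * ?E)" .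
      qed
      finally show ?thesis by (simp only: mult_2)
    qed
    ultimately have bounds: "nn (\<Sum>t\<in>T. H Q t *\<^sub>R z t) \<le> 2 * (K * C * (C * ?E))"
      "(\<Sum>t\<in>T. nn (H Q t *\<^sub>R z t)) \<le> C * nn (\<Sum>t\<in>T. H Q t *\<^sub>R z t)"
      by blast+
    have "(\<Sum>t\<in>T. nn (H Q t *\<^sub>R z t)) \<le> C * (2 * (K * C * (C * ?E)))"
      using C_ge_1 by (intro order_trans[OF bounds(2)] mult_left_mono bounds(1)) auto
    then show ?thesis
      by (simp add: nrm_scale z_in)
  qed
  let ?V = "\<lambda>t. Wop R S (z t)"
  have "(\<Sum>j\<in>?B. Wop R S (y j) j) = (\<Sum>j\<in>?B. (\<Sum>t\<in>T. t j / m * ?V t j) + Wop R S (err j) j)"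
  proof (intro sum.cong refl)
    fix j
    have "Wop R S (y j) = Wop R S (\<Sum>t\<in>T. (t j / m) *\<^sub>R z t) + Wop R S (err j)"
      by (subst y_eq, rule Wop_add) (auto intro!: sum_in scale_in z_in err_in)
    also have "Wop R S (\<Sum>t\<in>T. (t j / m) *\<^sub>R z t) = (\<Sum>t\<in>T. (t j / m) *\<^sub>R ?V t)"
      by (subst Wop_sum) (auto simp: scale_in z_in Wop_scale)
    finally show "Wop R S (y j) j = (\<Sum>t\<in>T. t j / m * ?V t j) + Wop R S (err j) j"
      by simp
  qed
  also have "\<dots> = (\<Sum>t\<in>T. \<Sum>j\<in>?B. t j / m * ?V t j) + (\<Sum>j\<in>?B. Wop R S (err j) j)"
    by (simp add: sum.distrib sum.swap[of _ T])
  finally have split: "(\<Sum>j\<in>?B. Wop R S (y j) j)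
      = (\<Sum>t\<in>T. \<Sum>j\<in>?B. t j / m * ?V t j) + (\<Sum>j\<in>?B. Wop R S (err j) j)" .
  have "\<bar>\<Sum>t\<in>T. \<Sum>j\<in>?B. t j / m * ?V t j\<bar> \<le> (\<Sum>t\<in>T. \<bar>\<Sum>j\<in>?B. t j / m * ?V t j\<bar>)"
    by (rule sum_abs)
  also have "\<dots> \<le> (\<Sum>t\<in>T. 9 / 5 / 2 ^ N * (\<Sum>Q\<in>Pow ?B. \<bar>H Q t\<bar>) * (C * (K * nn (z t))))"
  proof (rule sum_mono)
    fix t
    have "\<bar>\<Sum>j\<in>?B. t j / m * ?V t j\<bar> \<le> sqrt (\<Sum>j\<in>?B. (t j / m)\<^sup>2) * sqrt (\<Sum>j\<in>?B. (?V t j)\<^sup>2)"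
      unfolding real_sqrt_mult[symmetric]
      using Cauchy_Schwarz_ineq_sum[of "\<lambda>j. t j / m" "?V t" ?B]
      by (intro real_le_rsqrt) (simp only: power2_abs)
    also have "\<dots> \<le> (9 / 5 / 2 ^ N * (\<Sum>Q\<in>Pow ?B. \<bar>H Q t\<bar>)) * (C * (K * nn (z t)))"
    proof (rule mult_mono)
      show "sqrt (\<Sum>j\<in>?B. (t j / m)\<^sup>2) \<le> 9 / 5 / 2 ^ N * (\<Sum>Q\<in>Pow ?B. \<bar>H Q t\<bar>)"
        using Khinchine[of ?B "\<lambda>j. t j / m"] by (simp add: H_def N_def)
      have "sqrt (\<Sum>j\<in>?B. (?V t j)\<^sup>2) \<le> C * nn (?V t)"
        by (intro l2_le Wop_in) auto
      also have "\<dots> \<le> C * (K * nn (z t))"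
        using C_ge_1 by (intro mult_left_mono Wop_le z_in) auto
      finally show "sqrt (\<Sum>j\<in>?B. (?V t j)\<^sup>2) \<le> C * (K * nn (z t))" .
    qed (auto intro!: sum_nonneg)
    finally show "\<bar>\<Sum>j\<in>?B. t j / m * ?V t j\<bar>
        \<le> 9 / 5 / 2 ^ N * (\<Sum>Q\<in>Pow ?B. \<bar>H Q t\<bar>) * (C * (K * nn (z t)))" .
  qed
  also have "\<dots> = 9 / 5 / 2 ^ N * C * K * (\<Sum>Q\<in>Pow ?B. \<Sum>t\<in>T. \<bar>H Q t\<bar> * nn (z t))"
    by (simp add: sum_distrib_left sum_distrib_right sum_divide_distrib sum.swap[of _ T] mult_ac)
  also have "\<dots> \<le> 9 / 5 / 2 ^ N * C * K * (\<Sum>Q\<in>Pow ?B. C * (2 * (K * C * (C * ?E))))"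
    using C_ge_1 K_ge_1 by (intro mult_left_mono sum_mono H_sum) auto
  also have "\<dots> = 18 / 5 * K\<^sup>2 * C ^ 4 * ?E"
    by (simp add: card_Pow N_def power2_eq_square power4_eq_xxxx)
  finally have first: "\<bar>\<Sum>t\<in>T. \<Sum>j\<in>?B. t j / m * ?V t j\<bar> \<le> 18 / 5 * K\<^sup>2 * C ^ 4 * ?E" .
  have "\<bar>\<Sum>j\<in>?B. Wop R S (err j) j\<bar> \<le> (\<Sum>j\<in>?B. K * (K * C / N))"
  proof (intro order_trans[OF sum_abs] sum_mono)
    fix j assume j: "j \<in> ?B"
    have "\<bar>Wop R S (err j) j\<bar> \<le> nn (Wop R S (err j))"
      by (intro coordinate_le Wop_in)
    also have "\<dots> \<le> K * nn (err j)"
      by (intro Wop_le err_in)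
    also have "\<dots> \<le> K * (K * C / N)"
      using K_ge_1 j by (intro mult_left_mono nn_err) auto
    finally show "\<bar>Wop R S (err j) j\<bar> \<le> K * (K * C / N)" .
  qed
  also have "\<dots> = K\<^sup>2 * C * 1"
    using N by (simp add: N_def[symmetric] power2_eq_square)
  also have "\<dots> \<le> K\<^sup>2 * C ^ 3 * (C * ?E)"
    using C_ge_1 K_ge_1 one_le power_increasing[of 1 3 C]
    by (intro mult_mono mult_left_mono) auto
  also have "\<dots> = K\<^sup>2 * C ^ 4 * ?E"
    by (simp add: power4_eq_xxxx power3_eq_cube)
  finally have second: "\<bar>\<Sum>j\<in>?B. Wop R S (err j) j\<bar> \<le> K\<^sup>2 * C ^ 4 * ?E" .
  have "0 \<le> K\<^sup>2 * C ^ 4 * ?E"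
    using C_ge_1 D_pos[of k] by (simp add: bsize_def)
  then have "\<bar>\<Sum>j\<in>?B. Wop R S (y j) j\<bar> \<le> 5 * K\<^sup>2 * C ^ 4 * ?E"
    using first second unfolding split by linarith
  then show ?thesis
    by (simp add: y_def)
qed

section \<open>Splitting the trace of the identity of a block among the basis vectors\<close>

definition \<alpha> where "\<alpha> k n = (\<Sum>j\<in>block k. xs n (unit_seq j) * x n j)"

lemma \<alpha>_le: "\<bar>\<alpha> k n\<bar> \<le> C * K * \<sigma> k n"
proof -
  have "\<bar>\<alpha> k n\<bar> \<le> \<sigma> k n * sqrt (\<Sum>j\<in>block k. (x n j)\<^sup>2)"
    unfolding \<alpha>_def \<sigma>_def real_sqrt_mult[symmetric]
    by (intro real_le_rsqrt) (simp add: Cauchy_Schwarz_ineq_sum)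
  also have "\<dots> \<le> \<sigma> k n * (C * nn (x n))"
    by (intro mult_left_mono \<sigma>_nonneg l2_le x_in) auto
  also have "\<dots> \<le> \<sigma> k n * (C * K)"
    using C_ge_1 by (intro mult_left_mono \<sigma>_nonneg nn_x) auto
  finally show ?thesis by (simp add: mult_ac)
qed

text \<open>Averaging over the signs kills the off-diagonal terms.\<close>

lemma diagonal_bound:
  "\<bar>\<Sum>n<R. \<alpha> k n * xs n (prj {M (Suc k)..} (x n))\<bar> \<le> 5 * K\<^sup>2 * C ^ 4 * (bsize k / D k)"
proof -
  let ?B = "block k" and ?P = "Pow {..<R}" and ?p = "prj {M (Suc k)..}"
  let ?tr = "\<lambda>S. \<Sum>j\<in>?B. Wop R S (?p (Wop R S (unit_seq j))) j"
  \<comment> \<open>\<open>a n m\<close> is the coefficient of \<open>sg S n * sg S m\<close> in the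
    trace; the diagonal entries are the terms of the sum to be bounded.\<close>
  define a where "a = (\<lambda>n m. (\<Sum>j\<in>?B. xs m (unit_seq j) * x n j) * xs n (?p (x m)))"
  have prj_Wop: "?p (Wop R S u) = (\<Sum>m<R. (sg S m * xs m u) *\<^sub>R ?p (x m))" for S u
    by (rule ext) (simp add: prj_def Wop_def)
  have tr: "?tr S = (\<Sum>n<R. \<Sum>m<R. sg S n * sg S m * a n m)" for S
  proof -
    have "xs n (?p (Wop R S u)) = (\<Sum>m<R. sg S m * xs m u * xs n (?p (x m)))" for n u
      unfolding prj_Wop by (subst xs_sum) (auto simp: scale_in prj_in x_in xs_scale)
    then have "Wop R S (?p (Wop R S u)) j
        = (\<Sum>n<R. \<Sum>m<R. sg S n * sg S m * (xs m u * x n j * xs n (?p (x m))))" for u j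
      by (simp add: Wop_def sum_distrib_left sum_distrib_right mult_ac)
    then have "?tr S = (\<Sum>n<R. \<Sum>m<R. \<Sum>j\<in>?B.
        sg S n * sg S m * (xs m (unit_seq j) * x n j * xs n (?p (x m))))"
      by (simp add: sum.swap[of _ ?B])
    then show ?thesis
      by (simp add: a_def sum_distrib_left sum_distrib_right mult_ac)
  qed
  have "(\<Sum>S\<in>?P. ?tr S) = (\<Sum>n<R. \<Sum>m<R. (\<Sum>S\<in>?P. sg S n * sg S m) * a n m)"
    by (simp add: tr sum_distrib_right sum.swap[of _ ?P])
  also have "\<dots> = (\<Sum>n<R. \<Sum>m<R. if n = m then 2 ^ R * a n n else 0)"
    by (intro sum.cong refl) (simp add: sum_sg_orthogonal)
  also have "\<dots> = 2 ^ R * (\<Sum>n<R. a n n)"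
    by (simp add: sum_distrib_left)
  finally have "\<bar>\<Sum>n<R. a n n\<bar> = \<bar>\<Sum>S\<in>?P. ?tr S\<bar> / 2 ^ R"
    by (simp add: abs_mult)
  also have "\<dots> \<le> (\<Sum>S\<in>?P. 5 * K\<^sup>2 * C ^ 4 * (bsize k / D k)) / 2 ^ R"
    by (intro divide_right_mono order_trans[OF sum_abs] sum_mono trace_bound) auto
  also have "\<dots> = 5 * K\<^sup>2 * C ^ 4 * (bsize k / D k)"
    by (simp add: card_Pow)
  finally show ?thesis
    by (simp add: a_def \<alpha>_def)
qed

text \<open>Khinchine is applied at each coordinate. Passing from the norm to the
  \<open>l1\<close>-norm of the initial segment costs a factor \<open>D k\<close>, which cancels the
  gain \<open>1 / D k\<close> of \<open>nn_\<sigma>_sum\<close>.\<close>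

lemma initial_square_function:
  "(\<Sum>i<M (Suc k). sqrt (\<Sum>n<R. (\<sigma> k n * x n i)\<^sup>2)) \<le> 4 * K\<^sup>2 * C\<^sup>2 * bsize k"
proof -
  let ?P = "Pow {..<R}" and ?c = "9 / 5 / 2 ^ R :: real"
  define f where "f = (\<lambda>S. \<Sum>n<R. (sg S n * \<sigma> k n) *\<^sub>R x n)"
  have f_in: "f S \<in> Y" for S
    unfolding f_def by (intro sum_in scale_in x_in)
  have f_eq: "f S i = (\<Sum>n<R. sg S n * (\<sigma> k n * x n i))" for S i
    by (simp add: f_def mult_ac)
  have "(\<Sum>i<M (Suc k). sqrt (\<Sum>n<R. (\<sigma> k n * x n i)\<^sup>2))
      \<le> (\<Sum>i<M (Suc k). ?c * (\<Sum>S\<in>?P. \<bar>f S i\<bar>))"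
    using Khinchine[of "{..<R}"] by (intro sum_mono) (simp add: f_eq)
  also have "\<dots> = ?c * (\<Sum>S\<in>?P. \<Sum>i<M (Suc k). \<bar>f S i\<bar>)"
    by (simp add: sum_distrib_left sum.swap[of _ ?P])
  also have "\<dots> \<le> ?c * (\<Sum>S\<in>?P. 9 / 5 * K\<^sup>2 * C\<^sup>2 * bsize k)"
  proof (intro mult_left_mono sum_mono)
    fix S
    have "(\<Sum>i<M (Suc k). \<bar>f S i\<bar>) \<le> C * D k * nn (f S)"
      by (intro initial_l1 f_in)
    also have "\<dots> \<le> C * D k * (9 / 5 * K\<^sup>2 * (C * (bsize k / D k)))"
      unfolding f_def using C_ge_1 D_pos[of k] by (intro mult_left_mono nn_\<sigma>_sum) auto
    also have "\<dots> = 9 / 5 * K\<^sup>2 * C\<^sup>2 * bsize k"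
      using D_pos[of k] by (simp add: power2_eq_square)
    finally show "(\<Sum>i<M (Suc k). \<bar>f S i\<bar>) \<le> 9 / 5 * K\<^sup>2 * C\<^sup>2 * bsize k" .
  qed auto
  also have "\<dots> = 81 / 25 * (K\<^sup>2 * C\<^sup>2 * bsize k)"
    by (simp add: card_Pow)
  also have "\<dots> \<le> 4 * (K\<^sup>2 * C\<^sup>2 * bsize k)"
    by (intro mult_right_mono) (auto simp: bsize_def)
  finally show ?thesis by simp
qed

text \<open>Cauchy--Schwarz in \<open>n\<close> at each coordinate \<open>i\<close>: one factor is
  the square function just bounded, the other collects the small coefficients of
  \<open>unit_seq i\<close>, whose squares sum to at most \<open>4 * W * C * b\<close> by
  \<open>small_squares\<close>.\<close>

lemma small_part_bound:
  assumes "0 \<le> b"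
  shows "(\<Sum>n<R. \<bar>\<alpha> k n\<bar> * (\<Sum>i | i < M (Suc k) \<and> \<bar>xs n (unit_seq i)\<bar> \<le> b.
      \<bar>x n i * xs n (unit_seq i)\<bar>)) \<le> 4 * K ^ 3 * C ^ 3 * sqrt (4 * W * C * b) * bsize k"
proof -
  let ?M = "M (Suc k)"
  define e where "e = (\<lambda>n i. if \<bar>xs n (unit_seq i)\<bar> \<le> b then \<bar>xs n (unit_seq i)\<bar> else 0)"
  have "(\<Sum>i | i < ?M \<and> \<bar>xs n (unit_seq i)\<bar> \<le> b. \<bar>x n i * xs n (unit_seq i)\<bar>)
      = (\<Sum>i<?M. \<bar>x n i\<bar> * e n i)" for n
    by (rule sum.mono_neutral_cong_left) (auto simp: e_def abs_mult)
  then have "(\<Sum>n<R. \<bar>\<alpha> k n\<bar> * (\<Sum>i | i < ?M \<and> \<bar>xs n (unit_seq i)\<bar> \<le> b.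
      \<bar>x n i * xs n (unit_seq i)\<bar>)) = (\<Sum>n<R. \<bar>\<alpha> k n\<bar> * (\<Sum>i<?M. \<bar>x n i\<bar> * e n i))"
    by simp
  also have "\<dots> \<le> (\<Sum>n<R. C * K * \<sigma> k n * (\<Sum>i<?M. \<bar>x n i\<bar> * e n i))"
    by (intro sum_mono mult_right_mono \<alpha>_le sum_nonneg) (auto simp: e_def)
  also have "\<dots> = C * K * (\<Sum>i<?M. \<Sum>n<R. \<bar>\<sigma> k n * x n i\<bar> * e n i)"
    using \<sigma>_nonneg[of k]
    by (simp add: sum_distrib_left sum.swap[of _ "{..<R}"] abs_mult mult_ac)
  also have "\<dots> \<le> C * K * (\<Sum>i<?M. sqrt (\<Sum>n<R. (\<sigma> k n * x n i)\<^sup>2) * sqrt (4 * W * C * b))"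
  proof (intro mult_left_mono sum_mono)
    fix i
    have "(\<Sum>n<R. \<bar>\<sigma> k n * x n i\<bar> * e n i)
        \<le> sqrt (\<Sum>n<R. (\<sigma> k n * x n i)\<^sup>2) * sqrt (\<Sum>n<R. (e n i)\<^sup>2)"
      unfolding real_sqrt_mult[symmetric]
      using Cauchy_Schwarz_ineq_sum[of "\<lambda>n. \<bar>\<sigma> k n * x n i\<bar>" "\<lambda>n. e n i" "{..<R}"]
      by (intro real_le_rsqrt) simp
    moreover have "(\<Sum>n<R. (e n i)\<^sup>2) = (\<Sum>n | n < R \<and> \<bar>xs n (unit_seq i)\<bar> \<le> b. (xs n (unit_seq i))\<^sup>2)"
      by (rule sum.mono_neutral_cong_right) (auto simp: e_def)
    moreover have "\<dots> \<le> 4 * (W * nn (unit_seq i)) * b"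
      using assms by (intro small_squares unit_in) auto
    moreover have "\<dots> \<le> 4 * (W * C) * b"
      using assms W_pos nn_unit[of i] by (intro mult_right_mono mult_left_mono) auto
    ultimately have "(\<Sum>n<R. (e n i)\<^sup>2) \<le> 4 * W * C * b"
      "(\<Sum>n<R. \<bar>\<sigma> k n * x n i\<bar> * e n i)
        \<le> sqrt (\<Sum>n<R. (\<sigma> k n * x n i)\<^sup>2) * sqrt (\<Sum>n<R. (e n i)\<^sup>2)"
      by simp_all
    then show "(\<Sum>n<R. \<bar>\<sigma> k n * x n i\<bar> * e n i)
        \<le> sqrt (\<Sum>n<R. (\<sigma> k n * x n i)\<^sup>2) * sqrt (4 * W * C * b)"
      by (elim order_trans) (intro mult_left_mono real_sqrt_le_mono, auto intro!: sum_nonneg)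
  qed (use C_ge_1 K_ge_1 in auto)
  also have "\<dots> = C * K * sqrt (4 * W * C * b) * (\<Sum>i<?M. sqrt (\<Sum>n<R. (\<sigma> k n * x n i)\<^sup>2))"
    by (simp add: sum_distrib_left mult_ac)
  also have "\<dots> \<le> C * K * sqrt (4 * W * C * b) * (4 * K\<^sup>2 * C\<^sup>2 * bsize k)"
    using C_ge_1 K_ge_1 assms W_pos by (intro mult_left_mono initial_square_function) auto
  also have "\<dots> = 4 * K ^ 3 * C ^ 3 * sqrt (4 * W * C * b) * bsize k"
    by (simp add: power2_eq_square power3_eq_cube)
  finally show ?thesis .
qed

text \<open>The basis expansion of each \<open>unit_seq j\<close> converges at coordinate
  \<open>j\<close>, so the limit is the trace of the identity on the block.\<close>

lemma sum_\<alpha>_tendsto: "(\<lambda>R. \<Sum>n<R. \<alpha> k n) \<longlonglongrightarrow> bsize k"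
proof -
  have lim: "(\<lambda>R. \<Sum>n<R. xs n (unit_seq j) * x n j) \<longlonglongrightarrow> 1" for j
  proof -
    let ?r = "\<lambda>R. unit_seq j - (\<Sum>n<R. xs n (unit_seq j) *\<^sub>R x n)"
    have "(\<lambda>R. nn (?r R)) \<longlonglongrightarrow> 0"
      using expansion[OF unit_in] by (simp add: nrm_sums_def)
    moreover have "norm (?r R j) \<le> nn (?r R)" for R
      unfolding real_norm_def by (intro coordinate_le diff_in sum_in scale_in unit_in x_in)
    ultimately have "(\<lambda>R. ?r R j) \<longlonglongrightarrow> 0"
      by (rule Lim_null_comparison[rotated, OF _ always_eventually, rule_format])
    then have "(\<lambda>R. 1 - ?r R j) \<longlonglongrightarrow> 1 - 0"
      by (intro tendsto_intros)
    then show ?thesis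
      by (simp add: unit_seq_def)
  qed
  have "(\<lambda>R. \<Sum>j\<in>block k. \<Sum>n<R. xs n (unit_seq j) * x n j) \<longlonglongrightarrow> (\<Sum>j\<in>block k. 1)"
    by (intro tendsto_sum lim)
  moreover have "(\<Sum>j\<in>block k. \<Sum>n<R. xs n (unit_seq j) * x n j) = (\<Sum>n<R. \<alpha> k n)" for R
    by (simp add: \<alpha>_def sum.swap[of _ "block k"])
  ultimately show ?thesis
    by (simp add: bsize_def)
qed


text \<open>The sum is the \<open>n\<close>-th basis coordinate of a coordinate projection of
  \<open>x n\<close>.\<close>

lemma large_part_bound:
  "\<bar>\<Sum>i | i < m \<and> b < \<bar>xs n (unit_seq i)\<bar>. x n i * xs n (unit_seq i)\<bar> \<le> K\<^sup>2"
proof -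
  let ?I = "{i. i < m \<and> b < \<bar>xs n (unit_seq i)\<bar>}"
  have "(\<Sum>i\<in>?I. x n i * xs n (unit_seq i)) = xs n (prj ?I (x n))"
    by (subst prj_finite, simp, subst xs_sum) (auto simp: scale_in unit_in xs_scale)
  then have "\<bar>\<Sum>i\<in>?I. x n i * xs n (unit_seq i)\<bar> \<le> K * nn (prj ?I (x n))"
    by (simp only: xs_le prj_in x_in)
  also have "\<dots> \<le> K * K"
    using K_ge_1 order_trans[OF prj_le[OF x_in] nn_x] by (intro mult_left_mono) auto
  finally show ?thesis by (simp add: power2_eq_square)
qed

lemma xs_tail_split:
  "1 = xs n (prj {m..} (x n)) + (\<Sum>i<m. x n i * xs n (unit_seq i))"
proof -
  have "x n = prj {m..} (x n) + prj {..<m} (x n)"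
    by (rule ext) (simp add: prj_def)
  then have "xs n (x n) = xs n (prj {m..} (x n)) + xs n (prj {..<m} (x n))"
    by (metis xs_add prj_in x_in)
  also have "xs n (prj {..<m} (x n)) = (\<Sum>i<m. x n i * xs n (unit_seq i))"
    by (subst prj_finite, simp, subst xs_sum) (auto simp: scale_in unit_in xs_scale)
  finally show ?thesis by (simp add: xs_x)
qed

text \<open>For each of the \<open>m\<close> vectors \<open>unit_seq i\<close>,
  \<open>weak_l1\<close> leaves at most \<open>W * C / b\<close> indices.\<close>

lemma card_large:
  fixes m R :: nat
  assumes "b > 0"
  shows "card {n. n < R \<and> (\<exists>i<m. b < \<bar>xs n (unit_seq i)\<bar>)} \<le> m * (W * C / b)"
proof -
  let ?A = "\<lambda>i. {n. n < R \<and> b < \<bar>xs n (unit_seq i)\<bar>}"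
  have "real (card (?A i)) \<le> W * C / b" for i
  proof -
    have "b * card (?A i) \<le> W * nn (unit_seq i)"
      using assms by (intro weak_l1 unit_in) auto
    also have "\<dots> \<le> W * C"
      using W_pos by (intro mult_left_mono nn_unit) auto
    finally show ?thesis using assms by (simp add: field_simps)
  qed
  then have *: "(\<Sum>i<m. real (card (?A i))) \<le> (\<Sum>i<m. W * C / b)"
    by (intro sum_mono)
  have "{n. n < R \<and> (\<exists>i<m. b < \<bar>xs n (unit_seq i)\<bar>)} = (\<Union>i<m. ?A i)"
    by auto
  moreover have "card (\<Union>i<m. ?A i) \<le> (\<Sum>i<m. card (?A i))"
    by (intro card_UN_le) auto
  ultimately have "real (card {n. n < R \<and> (\<exists>i<m. b < \<bar>xs n (unit_seq i)\<bar>)})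
      \<le> real (\<Sum>i<m. card (?A i))"
    by (simp only: of_nat_le_iff)
  also have "\<dots> \<le> (\<Sum>i<m. W * C / b)"
    using * by simp
  finally show ?thesis by simp
qed

lemma contradiction: False
proof -
  \<comment> \<open>In order: \<open>b\<close> makes the small part at most \<open>N / 8\<close>;
    \<open>c\<close> is the proportion of \<open>N\<close> that the sum of
    \<open>\<sigma> k n\<close> over the large indices must reach; discarding the terms below
    \<open>t\<close> costs at most half of it; \<open>c'\<close> then comes out of
    Cauchy--Schwarz.\<close>
  define b where "b = 1 / (4 * W * C * (32 * K ^ 3 * C ^ 3)\<^sup>2)"
  define c where "c = 1 / (4 * C * K ^ 3)"
  define t where "t = c * b / (4 * W * C)"
  define c' where "c' = c\<^sup>2 / (16 * W * K * C\<^sup>2)"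
  have pos: "b > 0" "c > 0" "t > 0" "c' > 0"
    using C_ge_1 K_ge_1 W_pos by (auto simp: b_def c_def t_def c'_def)
  have sqrt_b: "sqrt (4 * W * C * b) = 1 / (32 * K ^ 3 * C ^ 3)"
    using C_ge_1 K_ge_1 W_pos by (simp add: b_def real_sqrt_divide)
  have "eventually (\<lambda>k. D k > B) sequentially" for B
    using D_lim by (simp add: filterlim_at_top_dense)
  \<comment> \<open>The first bound makes the part through the later blocks at most
    \<open>N / 8\<close>; the second contradicts the final estimate.\<close>
  from eventually_conj[OF this this] obtain k where k: "D k > 40 * K\<^sup>2 * C ^ 4" "D k > 9 / 5 * K ^ 3 * C / (t * lower * c')"
    unfolding eventually_sequentially by blast
  define N where "N = bsize k"
  \<comment> \<open>The block has at least half of the coordinates of the initial segment, so bounds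
    in terms of \<open>M (Suc k)\<close> become bounds in terms of \<open>N\<close>.\<close>
  have N: "N > 0" "real (M (Suc k)) \<le> 2 * N"
    using M_double[of k] M_ge[of "Suc k"] by (auto simp: N_def bsize_def block_def)
  let ?m = "M (Suc k)"
  have "eventually (\<lambda>R. N / 2 < (\<Sum>n<R. \<alpha> k n)) sequentially"
    using N(1) by (intro order_tendstoD(1)[OF sum_\<alpha>_tendsto[of k]]) (simp add: N_def)
  then obtain R where R: "N / 2 < (\<Sum>n<R. \<alpha> k n)"
    by (auto simp: eventually_sequentially)
  define A where "A = {n. n < R \<and> (\<exists>i<?m. b < \<bar>xs n (unit_seq i)\<bar>)}"
  have A: "finite A" "A \<subseteq> {..<R}"
    by (auto simp: A_def)
  define hi where "hi = (\<lambda>n. xs n (prj {?m..} (x n)))"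
  define sm where "sm = (\<lambda>n. \<Sum>i | i < ?m \<and> \<bar>xs n (unit_seq i)\<bar> \<le> b. x n i * xs n (unit_seq i))"
  define lg where "lg = (\<lambda>n. \<Sum>i | i < ?m \<and> b < \<bar>xs n (unit_seq i)\<bar>. x n i * xs n (unit_seq i))"
  have "(\<Sum>i<?m. x n i * xs n (unit_seq i)) = sm n + lg n" for n
    unfolding sm_def lg_def by (subst sum.union_disjoint[symmetric]) (auto intro!: sum.cong)
  then have one: "hi n + sm n + lg n = 1" for n
    using xs_tail_split[where n = n and m = ?m] by (simp add: hi_def)
  have "(\<Sum>n<R. \<alpha> k n) = (\<Sum>n<R. \<alpha> k n * (hi n + sm n + lg n))"
    by (simp add: one)
  also have "\<dots> = (\<Sum>n<R. \<alpha> k n * hi n) + (\<Sum>n<R. \<alpha> k n * sm n) + (\<Sum>n<R. \<alpha> k n * lg n)"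
    by (simp add: distrib_left sum.distrib)
  finally have total: "(\<Sum>n<R. \<alpha> k n)
      = (\<Sum>n<R. \<alpha> k n * hi n) + (\<Sum>n<R. \<alpha> k n * sm n) + (\<Sum>n<R. \<alpha> k n * lg n)" .
  have part1: "(\<Sum>n<R. \<alpha> k n * hi n) \<le> N / 8"
  proof -
    have "(\<Sum>n<R. \<alpha> k n * hi n) \<le> 5 * K\<^sup>2 * C ^ 4 * (N / D k)"
      using diagonal_bound[of k R] by (simp add: hi_def N_def)
    also have "\<dots> = (40 * K\<^sup>2 * C ^ 4) / D k * (N / 8)"
      by simp
    also have "\<dots> \<le> 1 * (N / 8)"
      using k(1) D_pos[of k] N by (intro mult_right_mono) (auto simp: divide_le_eq)
    finally show ?thesis by simp
  qed
  have part2: "(\<Sum>n<R. \<alpha> k n * sm n) \<le> N / 8"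
  proof -
    have "(\<Sum>n<R. \<alpha> k n * sm n) \<le> (\<Sum>n<R. \<bar>\<alpha> k n\<bar> * (\<Sum>i | i < ?m \<and> \<bar>xs n (unit_seq i)\<bar> \<le> b.
        \<bar>x n i * xs n (unit_seq i)\<bar>))"
    proof (rule sum_mono)
      fix n
      have "\<alpha> k n * sm n \<le> \<bar>\<alpha> k n\<bar> * \<bar>sm n\<bar>"
        by (metis abs_ge_self abs_mult)
      also have "\<dots> \<le> \<bar>\<alpha> k n\<bar> * (\<Sum>i | i < ?m \<and> \<bar>xs n (unit_seq i)\<bar> \<le> b.
          \<bar>x n i * xs n (unit_seq i)\<bar>)"
        unfolding sm_def by (intro mult_left_mono sum_abs) auto
      finally show "\<alpha> k n * sm n \<le> \<bar>\<alpha> k n\<bar> * (\<Sum>i | i < ?m \<and> \<bar>xs n (unit_seq i)\<bar> \<le> b.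
          \<bar>x n i * xs n (unit_seq i)\<bar>)" .
    qed
    also have "\<dots> \<le> 4 * K ^ 3 * C ^ 3 * sqrt (4 * W * C * b) * N"
      unfolding N_def using pos by (intro small_part_bound) auto
    also have "\<dots> = N / 8"
      unfolding sqrt_b using K_ge_1 C_ge_1 by simp
    finally show ?thesis .
  qed
  have part3: "(\<Sum>n<R. \<alpha> k n * lg n) \<le> C * K ^ 3 * (\<Sum>n\<in>A. \<sigma> k n)"
  proof -
    have "lg n = 0" if "n < R" "n \<notin> A" for n
    proof -
      have "{i. i < ?m \<and> b < \<bar>xs n (unit_seq i)\<bar>} = {}"
        using that by (auto simp: A_def)
      then show ?thesis unfolding lg_def by (simp only: sum.empty)
    qed
    then have "(\<Sum>n<R. \<alpha> k n * lg n) = (\<Sum>n\<in>A. \<alpha> k n * lg n)"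
      using A by (intro sum.mono_neutral_right) auto
    also have "\<dots> \<le> (\<Sum>n\<in>A. C * K * \<sigma> k n * K\<^sup>2)"
    proof (rule sum_mono)
      fix n
      have "\<alpha> k n * lg n \<le> \<bar>\<alpha> k n\<bar> * \<bar>lg n\<bar>"
        by (metis abs_ge_self abs_mult)
      also have "\<dots> \<le> C * K * \<sigma> k n * K\<^sup>2"
        using \<alpha>_le[of k n] large_part_bound[where m = ?m and b = b and n = n] C_ge_1 K_ge_1 \<sigma>_nonneg[of k n]
        unfolding lg_def by (intro mult_mono) auto
      finally show "\<alpha> k n * lg n \<le> C * K * \<sigma> k n * K\<^sup>2" .
    qed
    finally show ?thesis
      by (simp add: sum_distrib_left power2_eq_square power3_eq_cube mult_ac)
  qed
  \<comment> \<open>More than half of the trace is captured by \<open>R\<close> and two eighths are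
    lost, so a quarter passes through large coefficients, that is, through indices in
    \<open>A\<close>.\<close>
  have "N / 4 \<le> C * K ^ 3 * (\<Sum>n\<in>A. \<sigma> k n)"
    using R total part1 part2 part3 by linarith
  then have sum_A: "c * N \<le> (\<Sum>n\<in>A. \<sigma> k n)"
    using C_ge_1 K_ge_1 by (simp add: c_def field_simps)
  define A' where "A' = {n\<in>A. t \<le> \<sigma> k n}"
  have A': "finite A'" "A' \<subseteq> A"
    using A by (auto simp: A'_def)
  have card_A: "card A \<le> 2 * N * (W * C / b)"
  proof -
    have "card A \<le> ?m * (W * C / b)"
      unfolding A_def by (intro card_large pos)
    also have "\<dots> \<le> 2 * N * (W * C / b)"
      using N(2) W_pos C_ge_1 pos by (intro mult_right_mono) auto
    finally show ?thesis .
  qed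
  have "(\<Sum>n\<in>A - A'. \<sigma> k n) \<le> (\<Sum>n\<in>A - A'. t)"
    by (intro sum_mono) (auto simp: A'_def)
  also have "\<dots> \<le> (\<Sum>n\<in>A. t)"
    using A A' pos by (intro sum_mono2) auto
  also have "\<dots> = card A * t"
    by simp
  also have "\<dots> \<le> 2 * N * (W * C / b) * t"
    using card_A pos by (intro mult_right_mono) auto
  also have "\<dots> = c * N / 2"
    using pos W_pos C_ge_1 by (simp add: t_def field_simps)
  finally have "(\<Sum>n\<in>A - A'. \<sigma> k n) \<le> c * N / 2" .
  then have sum_A': "c * N / 2 \<le> (\<Sum>n\<in>A'. \<sigma> k n)"
    using sum_A sum.subset_diff[OF A'(2) A(1), of "\<sigma> k"] by simp
  have squares: "(\<Sum>n\<in>A'. (\<sigma> k n)\<^sup>2) \<le> 4 * W * K * C\<^sup>2 * N"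
  proof -
    have "(\<Sum>n\<in>A'. (\<sigma> k n)\<^sup>2) = (\<Sum>j\<in>block k. \<Sum>n\<in>A'. (xs n (unit_seq j))\<^sup>2)"
      by (simp add: \<sigma>_sq sum.swap[of _ A'])
    also have "\<dots> \<le> (\<Sum>j\<in>block k. 4 * W * K * C\<^sup>2)"
    proof (rule sum_mono)
      fix j
      have "(\<Sum>n\<in>A'. (xs n (unit_seq j))\<^sup>2) \<le> 4 * W * K * (nn (unit_seq j))\<^sup>2"
        by (intro all_squares unit_in A')
      also have "\<dots> \<le> 4 * W * K * C\<^sup>2"
        using W_pos K_ge_1 nn_unit nrm_nonneg[OF unit_in] by (intro mult_left_mono power_mono) auto
      finally show "(\<Sum>n\<in>A'. (xs n (unit_seq j))\<^sup>2) \<le> 4 * W * K * C\<^sup>2" .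
    qed
    finally show ?thesis by (simp add: N_def bsize_def mult_ac)
  qed
  \<comment> \<open>The values \<open>\<sigma> k n\<close> on \<open>A'\<close> have a sum of order
    \<open>N\<close>, but their squares sum only to a multiple of \<open>N\<close>: this forces
    \<open>A'\<close> to be large.\<close>
  have "(c * N / 2)\<^sup>2 \<le> (\<Sum>n\<in>A'. \<sigma> k n)\<^sup>2"
    using sum_A' pos N by (intro power_mono) auto
  also have "\<dots> \<le> card A' * (\<Sum>n\<in>A'. (\<sigma> k n)\<^sup>2)"
    using Cauchy_Schwarz_ineq_sum[of "\<lambda>_. 1" "\<sigma> k" A'] by simp
  also have "\<dots> \<le> card A' * (4 * W * K * C\<^sup>2 * N)"
    by (intro mult_left_mono squares) auto
  finally have card_A': "c' * N \<le> card A'"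
    using N(1) W_pos C_ge_1 K_ge_1 by (simp add: c'_def field_simps power2_eq_square)
  \<comment> \<open>The sum over \<open>A'\<close> is bounded below by \<open>l1_democracy\<close>
    and above by replacing \<open>t\<close> with \<open>\<sigma> k n\<close> and using
    \<open>nn_\<sigma>_sum\<close>.\<close>
  have "t * (lower * (c' * N)) \<le> t * (lower * card A')"
    using pos lower_pos card_A' by (intro mult_left_mono) auto
  also have "\<dots> \<le> t * nn (\<Sum>n\<in>A'. x n)"
    using pos by (intro mult_left_mono l1_democracy A') auto
  also have "\<dots> = nn (t *\<^sub>R (\<Sum>n\<in>A'. x n))"
    using pos by (simp add: nrm_scale sum_in x_in)
  also have "\<dots> = nn (\<Sum>n<R. (if n \<in> A' then t else 0) *\<^sub>R x n)"
    unfolding scaleR_sum_right using A A'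
    by (intro arg_cong[of _ _ nn] sum.mono_neutral_cong_left) auto
  also have "\<dots> \<le> K * nn (\<Sum>n<R. (1 * \<sigma> k n) *\<^sub>R x n)"
    using pos \<sigma>_nonneg[of k] by (intro compare) (auto simp: A'_def)
  also have "\<dots> \<le> K * (9 / 5 * K\<^sup>2 * (C * (N / D k)))"
    unfolding N_def using K_ge_1 by (intro mult_left_mono nn_\<sigma>_sum) auto
  finally have "t * lower * c' * N \<le> 9 / 5 * K ^ 3 * C * N / D k"
    by (simp add: power2_eq_square power3_eq_cube mult_ac)
  then have "D k * (t * lower * c') \<le> 9 / 5 * K ^ 3 * C"
    using N(1) D_pos[of k] by (simp add: field_simps)
  then show False
    using k(2) pos lower_pos by (simp add: field_simps)
qed

end

section \<open>Orlicz spaces\<close>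

text \<open>Finite index sets replace the series, so that no summability has to be carried along;
  \<open>modular_le_iff\<close> gives the equivalence for \<open>l > 0\<close>.\<close>

definition modular_le :: "(real \<Rightarrow> real) \<Rightarrow> real \<Rightarrow> (nat \<Rightarrow> real) \<Rightarrow> bool" where
  "modular_le F l u \<longleftrightarrow> (\<forall>I. finite I \<longrightarrow> (\<Sum>i\<in>I. F (\<bar>u i\<bar> / l)) \<le> 1)"

locale orlicz =
  fixes F :: "real \<Rightarrow> real"
  assumes F: "orlicz_function F"
begin

lemma F_convex: "convex_on {0..} F" and F_nonneg: "t \<ge> 0 \<Longrightarrow> F t \<ge> 0"
  and F_0 [simp]: "F 0 = 0" and F_1 [simp]: "F 1 = 1"
  using F by (auto simp: orlicz_function_def)

lemma F_star: "0 \<le> r \<Longrightarrow> r \<le> 1 \<Longrightarrow> 0 \<le> t \<Longrightarrow> F (r * t) \<le> r * F t"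
  using convex_onD[OF F_convex, of r 0 t] by simp

lemma F_mono: "0 \<le> s \<Longrightarrow> s \<le> t \<Longrightarrow> F s \<le> F t"
proof (cases "t = 0")
  case False
  assume st: "0 \<le> s" "s \<le> t"
  then have t: "t > 0" using False by simp
  have "F (s / t * t) \<le> s / t * F t"
    using st t by (intro F_star) auto
  also have "\<dots> \<le> 1 * F t"
    using st t F_nonneg[of t] by (intro mult_right_mono) auto
  finally show ?thesis using t by simp
qed simp

lemma F_superlinear:
  assumes "1 \<le> r" "0 \<le> t"
  shows "r * F t \<le> F (r * t)"
proof -
  have "F (1 / r * (r * t)) \<le> 1 / r * F (r * t)"
    using assms by (intro F_star) auto
  then show ?thesis
    using assms by (simp add: field_simps)
qed

lemma modular_le_iff:
  assumes "l > 0"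
  shows "modular_le F l u \<longleftrightarrow>
    summable (\<lambda>n. F (\<bar>u n\<bar> / l)) \<and> (\<Sum>n. F (\<bar>u n\<bar> / l)) \<le> 1"
proof -
  have nn: "0 \<le> F (\<bar>u n\<bar> / l)" for n
    using assms by (intro F_nonneg) auto
  have "summable (\<lambda>n. F (\<bar>u n\<bar> / l)) \<and> (\<Sum>n. F (\<bar>u n\<bar> / l)) \<le> 1" if "modular_le F l u"
  proof -
    have le: "(\<Sum>i<n. F (\<bar>u i\<bar> / l)) \<le> 1" for n
      using that by (simp add: modular_le_def)
    have "summable (\<lambda>n. F (\<bar>u n\<bar> / l))"
      using nn le by (rule summableI_nonneg_bounded)
    then show ?thesis
      using suminf_le_const[OF _ le] by simp
  qed
  moreover have "modular_le F l u"
    if *: "summable (\<lambda>n. F (\<bar>u n\<bar> / l))" "(\<Sum>n. F (\<bar>u n\<bar> / l)) \<le> 1"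
    unfolding modular_le_def
  proof (intro allI impI)
    fix I :: "nat set" assume "finite I"
    then have "(\<Sum>i\<in>I. F (\<bar>u i\<bar> / l)) \<le> (\<Sum>n. F (\<bar>u n\<bar> / l))"
      using * nn by (intro sum_le_suminf) auto
    then show "(\<Sum>i\<in>I. F (\<bar>u i\<bar> / l)) \<le> 1"
      using * by simp
  qed
  ultimately show ?thesis by blast
qed

lemma modular_le_mono:
  assumes "modular_le F l u" "0 < l" "l \<le> l'" "\<And>i. \<bar>v i\<bar> \<le> \<bar>u i\<bar>"
  shows "modular_le F l' v"
  unfolding modular_le_def
proof (intro allI impI)
  fix I :: "nat set" assume "finite I"
  then have "(\<Sum>i\<in>I. F (\<bar>u i\<bar> / l)) \<le> 1"
    using assms(1) by (simp add: modular_le_def)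
  moreover have "(\<Sum>i\<in>I. F (\<bar>v i\<bar> / l')) \<le> (\<Sum>i\<in>I. F (\<bar>u i\<bar> / l))"
    using assms by (intro sum_mono F_mono frac_le) auto
  ultimately show "(\<Sum>i\<in>I. F (\<bar>v i\<bar> / l')) \<le> 1" by linarith
qed

lemma in_space_iff: "u \<in> orlicz_space F \<longleftrightarrow> (\<exists>l>0. modular_le F l u)"
proof
  assume "u \<in> orlicz_space F"
  then obtain t where t: "t > 0" "summable (\<lambda>n. F (\<bar>u n\<bar> / t))"
    by (auto simp: orlicz_space_def)
  \<comment> \<open>By \<open>F_star\<close>, enlarging the scale by \<open>r \<ge> 1\<close>
    divides the modular at least by \<open>r\<close>, which brings it down to at most 1.\<close>
  define r where "r = max 1 (\<Sum>n. F (\<bar>u n\<bar> / t))"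
  have r: "r \<ge> 1" "(\<Sum>n. F (\<bar>u n\<bar> / t)) \<le> r"
    by (auto simp: r_def)
  have "modular_le F (t * r) u"
    unfolding modular_le_def
  proof (intro allI impI)
    fix I :: "nat set" assume I: "finite I"
    have "(\<Sum>i\<in>I. F (\<bar>u i\<bar> / (t * r))) \<le> (\<Sum>i\<in>I. 1 / r * F (\<bar>u i\<bar> / t))"
    proof (rule sum_mono)
      fix i
      have "F (1 / r * (\<bar>u i\<bar> / t)) \<le> 1 / r * F (\<bar>u i\<bar> / t)"
        using r t by (intro F_star) auto
      then show "F (\<bar>u i\<bar> / (t * r)) \<le> 1 / r * F (\<bar>u i\<bar> / t)"
        by (simp add: mult.commute)
    qed
    also have "\<dots> = 1 / r * (\<Sum>i\<in>I. F (\<bar>u i\<bar> / t))"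
      by (simp add: sum_distrib_left)
    also have "\<dots> \<le> 1 / r * (\<Sum>n. F (\<bar>u n\<bar> / t))"
      using t r I by (intro mult_left_mono sum_le_suminf) (auto intro!: F_nonneg)
    also have "\<dots> \<le> 1"
      using r by (simp add: divide_le_eq)
    finally show "(\<Sum>i\<in>I. F (\<bar>u i\<bar> / (t * r))) \<le> 1" .
  qed
  then show "\<exists>l>0. modular_le F l u"
    using t r by (intro exI[of _ "t * r"]) auto
next
  assume "\<exists>l>0. modular_le F l u"
  then show "u \<in> orlicz_space F"
    using modular_le_iff by (auto simp: orlicz_space_def)
qed

lemma norm_eq: "orlicz_norm F u = Inf {l. l > 0 \<and> modular_le F l u}"
proof -
  have "{t. t > 0 \<and> summable (\<lambda>n. F (\<bar>u n\<bar> / t)) \<and> (\<Sum>n. F (\<bar>u n\<bar> / t)) \<le> 1}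
      = {l. l > 0 \<and> modular_le F l u}"
    using modular_le_iff by blast
  then show ?thesis by (simp add: orlicz_norm_def)
qed

lemma norm_le: "0 < l \<Longrightarrow> modular_le F l u \<Longrightarrow> orlicz_norm F u \<le> l"
  unfolding norm_eq by (intro cInf_lower bdd_belowI[of _ 0]) auto

lemma norm_ge:
  assumes "u \<in> orlicz_space F" "\<And>l. 0 < l \<Longrightarrow> modular_le F l u \<Longrightarrow> r \<le> l"
  shows "r \<le> orlicz_norm F u"
  unfolding norm_eq using assms in_space_iff by (intro cInf_greatest) auto

lemma norm_nonneg: "u \<in> orlicz_space F \<Longrightarrow> 0 \<le> orlicz_norm F u"
  by (rule norm_ge) auto

lemma modular_le_of_norm_less:
  assumes "u \<in> orlicz_space F" "orlicz_norm F u < l"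
  shows "0 < l" "modular_le F l u"
proof -
  show "0 < l"
    using norm_nonneg[OF assms(1)] assms(2) by simp
  have "{l. l > 0 \<and> modular_le F l u} \<noteq> {}"
    using assms(1) in_space_iff by auto
  from cInf_lessD[OF this assms(2)[unfolded norm_eq]]
  obtain l' where "l' > 0" "modular_le F l' u" "l' < l"
    by auto
  then show "modular_le F l u"
    using modular_le_mono[of l' u l u] by simp
qed

text \<open>A bound that is homogeneous in \<open>l\<close> and holds for every admissible
  \<open>l\<close> passes to the infimum; this reduces norm estimates to modular ones.\<close>

lemma norm_limit:
  assumes "u \<in> orlicz_space F" "0 < B"
    and "\<And>l. 0 < l \<Longrightarrow> modular_le F l u \<Longrightarrow> X \<le> B * l"
  shows "X \<le> B * orlicz_norm F u"
proof -
  have "X / B \<le> orlicz_norm F u"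
    using assms by (intro norm_ge) (auto simp: divide_le_eq mult.commute)
  then show ?thesis
    using assms(2) by (simp add: divide_le_eq mult.commute)
qed

lemma solid_space:
  assumes "u \<in> orlicz_space F" "\<And>i. \<bar>v i\<bar> \<le> \<bar>u i\<bar>"
  shows "v \<in> orlicz_space F" "orlicz_norm F v \<le> orlicz_norm F u"
proof -
  have *: "modular_le F l v" if "0 < l" "modular_le F l u" for l
    using modular_le_mono[OF that(2,1)] assms(2) by blast
  then show "v \<in> orlicz_space F"
    using assms(1) unfolding in_space_iff by blast
  show "orlicz_norm F v \<le> orlicz_norm F u"
    using * by (intro norm_ge assms(1) norm_le)
qed

text \<open>\<open>(u + v) / (l + k)\<close> is the convex combination of \<open>u / l\<close> and
  \<open>v / k\<close> with weights \<open>l / (l + k)\<close> and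
  \<open>k / (l + k)\<close>.\<close>

lemma modular_le_add:
  assumes "modular_le F l u" "modular_le F k v" "0 < l" "0 < k"
  shows "modular_le F (l + k) (u + v)"
  unfolding modular_le_def
proof (intro allI impI)
  fix I :: "nat set" assume I: "finite I"
  define r where "r = k / (l + k)"
  have r: "0 \<le> r" "r \<le> 1" "1 - r = l / (l + k)"
    using assms(3,4) by (auto simp: r_def field_simps)
  have "(\<Sum>i\<in>I. F (\<bar>(u + v) i\<bar> / (l + k)))
      \<le> (\<Sum>i\<in>I. (1 - r) * F (\<bar>u i\<bar> / l) + r * F (\<bar>v i\<bar> / k))"
  proof (rule sum_mono)
    fix i
    have "\<bar>(u + v) i\<bar> / (l + k) \<le> (\<bar>u i\<bar> + \<bar>v i\<bar>) / (l + k)"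
      using assms(3,4) by (intro divide_right_mono) auto
    also have "\<dots> = (1 - r) *\<^sub>R (\<bar>u i\<bar> / l) + r *\<^sub>R (\<bar>v i\<bar> / k)"
      unfolding r(3) using assms(3,4) by (simp add: r_def add_divide_distrib)
    finally have "F (\<bar>(u + v) i\<bar> / (l + k)) \<le> F ((1 - r) *\<^sub>R (\<bar>u i\<bar> / l) + r *\<^sub>R (\<bar>v i\<bar> / k))"
      using assms(3,4) by (intro F_mono) auto
    also have "\<dots> \<le> (1 - r) * F (\<bar>u i\<bar> / l) + r * F (\<bar>v i\<bar> / k)"
      using r assms(3,4) by (intro convex_onD[OF F_convex]) auto
    finally show "F (\<bar>(u + v) i\<bar> / (l + k)) \<le> (1 - r) * F (\<bar>u i\<bar> / l) + r * F (\<bar>v i\<bar> / k)" .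
  qed
  also have "\<dots> = (1 - r) * (\<Sum>i\<in>I. F (\<bar>u i\<bar> / l)) + r * (\<Sum>i\<in>I. F (\<bar>v i\<bar> / k))"
    by (simp add: sum.distrib sum_distrib_left)
  also have "\<dots> \<le> (1 - r) * 1 + r * 1"
    using assms I r by (intro add_mono mult_left_mono) (auto simp: modular_le_def)
  finally show "(\<Sum>i\<in>I. F (\<bar>(u + v) i\<bar> / (l + k))) \<le> 1" by simp
qed

lemma modular_le_scale: "r \<noteq> 0 \<Longrightarrow> modular_le F (\<bar>r\<bar> * l) (r *\<^sub>R u) \<longleftrightarrow> modular_le F l u"
  by (simp add: modular_le_def abs_mult)

lemma modular_le_zero: "modular_le F l 0"
  by (simp add: modular_le_def)

lemma orlicz_normed_subspace: "normed_subspace (orlicz_space F) (orlicz_norm F)"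
proof
  have zero: "0 \<in> orlicz_space F"
    using modular_le_zero zero_less_one unfolding in_space_iff by blast
  have scale: "r *\<^sub>R u \<in> orlicz_space F \<and> orlicz_norm F (r *\<^sub>R u) = \<bar>r\<bar> * orlicz_norm F u"
    if u: "u \<in> orlicz_space F" for r u
  proof (cases "r = 0")
    case True
    have "orlicz_norm F 0 \<le> 0"
      by (rule field_le_epsilon) (use norm_le modular_le_zero in auto)
    then have "orlicz_norm F 0 = 0"
      using norm_nonneg[OF zero] by simp
    then show ?thesis using True zero by simp
  next
    case False
    have le: "r *\<^sub>R u \<in> orlicz_space F \<and> orlicz_norm F (r *\<^sub>R u) \<le> \<bar>r\<bar> * orlicz_norm F u"
      if "r \<noteq> 0" "u \<in> orlicz_space F" for r u
    proof
      have *: "0 < \<bar>r\<bar> * l \<and> modular_le F (\<bar>r\<bar> * l) (r *\<^sub>R u)" if "0 < l" "modular_le F l u" for l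
        using that \<open>r \<noteq> 0\<close> modular_le_scale by simp
      show "r *\<^sub>R u \<in> orlicz_space F"
        using that(2) * unfolding in_space_iff by blast
      show "orlicz_norm F (r *\<^sub>R u) \<le> \<bar>r\<bar> * orlicz_norm F u"
        using that * by (intro norm_limit norm_le) auto
    qed
    \<comment> \<open>The reverse inequality is the one just shown, for the factor
      \<open>1 / r\<close>.\<close>
    have "orlicz_norm F ((1 / r) *\<^sub>R (r *\<^sub>R u)) \<le> \<bar>1 / r\<bar> * orlicz_norm F (r *\<^sub>R u)"
      using le[of "1 / r" "r *\<^sub>R u"] le[OF False u] False by simp
    then have "\<bar>r\<bar> * orlicz_norm F u \<le> orlicz_norm F (r *\<^sub>R u)"
      using False by (simp add: field_simps)
    then show ?thesis
      using le[OF False u] by simp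
  qed
  have add: "u + v \<in> orlicz_space F \<and> orlicz_norm F (u + v) \<le> orlicz_norm F u + orlicz_norm F v"
    if "u \<in> orlicz_space F" "v \<in> orlicz_space F" for u v
  proof
    show "u + v \<in> orlicz_space F"
      using that modular_le_add unfolding in_space_iff by (blast intro: add_pos_pos)
    show "orlicz_norm F (u + v) \<le> orlicz_norm F u + orlicz_norm F v"
    proof (rule field_le_epsilon)
      fix e :: real assume e: "e > 0"
      then have "orlicz_norm F u < orlicz_norm F u + e / 2" "orlicz_norm F v < orlicz_norm F v + e / 2"
        by auto
      note modular_le_of_norm_less[OF that(1) this(1)] modular_le_of_norm_less[OF that(2) this(2)]
      then have "orlicz_norm F (u + v) \<le> (orlicz_norm F u + e / 2) + (orlicz_norm F v + e / 2)"
        by (intro norm_le modular_le_add) auto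
      then show "orlicz_norm F (u + v) \<le> orlicz_norm F u + orlicz_norm F v + e"
        by simp
    qed
  qed
  show "subspace (orlicz_space F)"
    using zero scale add by (auto simp: subspace_def)
  show "orlicz_norm F (u + v) \<le> orlicz_norm F u + orlicz_norm F v"
    if "u \<in> orlicz_space F" "v \<in> orlicz_space F" for u v
    using add that by blast
  show "orlicz_norm F (r *\<^sub>R u) = \<bar>r\<bar> * orlicz_norm F u" if "u \<in> orlicz_space F" for r u
    using scale that by blast
qed (rule norm_nonneg)

end

section \<open>The function \<open>orlicz_F1\<close>\<close>

locale log_orlicz =
  fixes a :: real
  assumes a_pos: "a > 0"
begin

abbreviation F where "F \<equiv> orlicz_F1 a"

sublocale orlicz F
  by standard (rule orlicz_function_orlicz_F1[OF a_pos])

lemma neg_ln_gt_1: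
  fixes t :: real
  assumes "0 < t" "t < 1 / exp 1"
  shows "1 < - ln t"
proof -
  have "ln t < ln (1 / exp 1)"
    using assms by (intro ln_strict_mono) auto
  then show ?thesis by (simp add: ln_div)
qed

lemma F_pos:
  assumes "0 < t"
  shows "0 < F t"
proof (cases "t < 1 / exp 1")
  case True
  then have "0 < (- ln t) powr (- a)"
    using neg_ln_gt_1[OF assms True] by (subst powr_gt_zero) linarith
  then show ?thesis
    using assms True by (simp add: orlicz_F1_def)
qed (use assms in \<open>simp add: orlicz_F1_def\<close>)

text \<open>On the logarithmic branch \<open>F\<close> is linear up to a power of this quotient of
  logarithms, which is the quantity to control in later estimates.\<close>

lemma F_scale:
  assumes "0 < t" "t < 1 / exp 1" "0 < r" "r * t < 1 / exp 1"
  shows "F (r * t) = r * F t * ((- ln t) / (- ln t - ln r)) powr a"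
proof -
  have gt: "1 < - ln t" "1 < - ln (r * t)"
    by (intro neg_ln_gt_1 mult_pos_pos assms)+
  have "F (r * t) = exp (- a) * (r * t) * (- ln (r * t)) powr (- a)"
    using assms by (simp add: orlicz_F1_def not_le)
  also have "\<dots> = r * (exp (- a) * t * (- ln t) powr (- a)) * ((- ln t) / (- ln (r * t))) powr a"
  proof -
    have "((- ln t) / (- ln (r * t))) powr a = (- ln t) powr a / (- ln (r * t)) powr a"
      by (rule powr_divide)
    moreover have "0 < (- ln t) powr a" "0 < (- ln (r * t)) powr a"
      using gt by auto
    ultimately show ?thesis
      by (simp add: powr_minus field_simps)
  qed
  also have "exp (- a) * t * (- ln t) powr (- a) = F t"
    using assms by (simp add: orlicz_F1_def not_le)
  also have "- ln (r * t) = - ln t - ln r"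
    using assms by (simp add: ln_mult)
  finally show ?thesis .
qed

text \<open>For \<open>t \<le> r\<close> the logarithm of \<open>r * t\<close> is in absolute value
  at most twice that of \<open>t\<close>, so linearity is lost only up to the factor
  \<open>2 powr a\<close>.\<close>

lemma F_scale_ge:
  assumes "0 \<le> t" "t < 1 / exp 1" "0 < r" "r \<le> 1" "t \<le> r"
  shows "r * F t / 2 powr a \<le> F (r * t)"
proof (cases "t = 0")
  case False
  then have t: "0 < t" using assms by simp
  have gt: "1 < - ln t"
    using t assms by (intro neg_ln_gt_1)
  have "ln t \<le> ln r" "ln r \<le> 0"
    using t assms by auto
  then have "(1 / 2) powr a \<le> ((- ln t) / (- ln t - ln r)) powr a"
    using gt a_pos by (intro powr_mono2) (auto simp: field_simps)
  then have "r * F t * (1 / 2) powr a \<le> r * F t * ((- ln t) / (- ln t - ln r)) powr a"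
    using assms F_nonneg by (intro mult_left_mono) auto
  also have "\<dots> = F (r * t)"
  proof (rule F_scale[symmetric])
    have "r * t \<le> 1 * t"
      using t assms by (intro mult_right_mono) auto
    then show "r * t < 1 / exp 1" using assms by linarith
  qed (use t assms in auto)
  finally show ?thesis
    by (simp add: powr_divide)
qed (use assms in simp)

text \<open>The doubling condition, which will make modulars finite at every scale and hence tails
  small. The exponent \<open>1 + 2 * a\<close> serves both branches and the crossing between
  them.\<close>

lemma F_doubling:
  assumes "0 \<le> t"
  shows "F (2 * t) \<le> 2 powr (1 + 2 * a) * F t"
proof -
  have ln2: "ln 2 < (1 :: real)"
    using ln_2_less_1 by simp
  consider "t = 0" | "0 < t" "2 * t < 1 / exp 1" | "1 / exp 1 \<le> 2 * t" "t < 1 / exp 1"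
    | "1 / exp 1 \<le> t"
    using assms by fastforce
  then show ?thesis
  proof cases
    case 2
    have "1 < - ln (2 * t)"
      using 2 by (intro neg_ln_gt_1) auto
    then have gt: "1 < - ln t - ln 2"
      using 2 by (simp add: ln_mult)
    have "((- ln t) / (- ln t - ln 2)) powr a \<le> 2 powr a"
    proof (intro powr_mono2)
      have "0 < ln (2 :: real)" by simp
      then have "0 < - ln t" using gt by linarith
      then show "0 \<le> (- ln t) / (- ln t - ln 2)"
        using gt by (intro divide_nonneg_nonneg) auto
      show "(- ln t) / (- ln t - ln 2) \<le> 2"
        using gt ln2 by (subst pos_divide_le_eq) simp_all
    qed (use a_pos in auto)
    also have "2 powr a \<le> 2 powr (2 * a)"
      using a_pos by (intro powr_mono) auto
    finally have "2 * F t * ((- ln t) / (- ln t - ln 2)) powr a \<le> 2 * F t * 2 powr (2 * a)"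
      using 2 F_pos[of t] by (intro mult_left_mono) auto
    moreover have "F (2 * t) = 2 * F t * ((- ln t) / (- ln t - ln 2)) powr a"
      using 2 by (intro F_scale) auto
    ultimately show ?thesis
      by (simp add: powr_add mult_ac)
  next
    \<comment> \<open>Here \<open>t\<close> and \<open>2 * t\<close> lie on different branches, but
      then \<open>- ln t\<close> is between 1 and 2, where both branches agree up to
      constants.\<close>
    case 3
    have t: "0 < t"
      using 3(1) less_le_trans[of 0 "1 / exp 1" "2 * t"] by simp
    have gt: "1 < - ln t"
      using t 3 by (intro neg_ln_gt_1)
    have "ln (1 / exp 1) \<le> ln (2 * t)"
      using 3 t by (subst ln_le_cancel_iff) auto
    then have "- ln t \<le> 2"
      using t ln2 by (simp add: ln_div ln_mult)
    then have "2 powr (- a) \<le> (- ln t) powr (- a)"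
      using gt a_pos by (intro powr_mono2') auto
    then have "exp (- a) * t * 2 powr (- a) \<le> exp (- a) * t * (- ln t) powr (- a)"
      using t by (intro mult_left_mono) auto
    also have "\<dots> = F t"
      using t 3 by (simp add: orlicz_F1_def not_le)
    finally have low: "exp (- a) * t * 2 powr (- a) \<le> F t" .
    have "t powr a \<le> (1 / exp 1) powr a"
      using t 3 a_pos by (intro powr_mono2) auto
    also have "\<dots> = exp (- a)"
      by (simp add: powr_def ln_div)
    finally have up: "t powr a \<le> exp (- a)" .
    have "F (2 * t) = (2 * t) powr (1 + a)"
      using t 3 by (simp add: orlicz_F1_def not_le)
    also have "\<dots> = 2 * 2 powr a * t * t powr a"
      using t by (simp add: powr_add powr_mult)
    also have "\<dots> \<le> 2 * 2 powr a * t * exp (- a)"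
      using t up by (intro mult_left_mono) auto
    also have "\<dots> = 2 powr (1 + 2 * a) * (exp (- a) * t * 2 powr (- a))"
    proof -
      have "2 powr (1 + 2 * a) * 2 powr (- a) = 2 powr (1 + a)"
        by (simp add: add.commute flip: powr_add)
      also have "\<dots> = 2 * 2 powr a"
        by (simp add: powr_add)
      finally have "2 * 2 powr a = 2 powr (1 + 2 * a) * 2 powr (- a)" ..
      then show ?thesis by simp
    qed
    also have "\<dots> \<le> 2 powr (1 + 2 * a) * F t"
      using low by (intro mult_left_mono) auto
    finally show ?thesis .
  next
    case 4
    then have t: "0 < t"
      using less_le_trans[of 0 "1 / exp 1" t] by simp
    have "F (2 * t) = (2 * t) powr (1 + a)"
      using t 4 by (simp add: orlicz_F1_def not_le)
    also have "\<dots> = 2 powr (1 + a) * F t"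
      using t 4 by (simp add: orlicz_F1_def not_le powr_mult)
    also have "\<dots> \<le> 2 powr (1 + 2 * a) * F t"
      using t a_pos F_pos[of t] by (intro mult_right_mono powr_mono) auto
    finally show ?thesis .
  qed simp
qed

end

section \<open>A complemented subspace spanned by constant blocks\<close>

context log_orlicz begin

text \<open>Block \<open>k\<close> has \<open>N \<approx> exp (2 m b)\<close> coordinates \<open>j\<close>, each of which is a constant block of
  about \<open>1 / F (exp (- b))\<close> coordinates of the Orlicz space. Then \<open>N\<close> normalized coordinate vectors
  have a sum of norm about \<open>N / (1 + m)\<^sup>a\<close>. The parameter \<open>b\<close> is huge with respect to the size
  \<open>M k\<close> of the union of the earlier blocks.\<close>

definition width :: "nat \<Rightarrow> nat" where
  "width k = nat \<lceil>(real k + 1) powr (1 / a)\<rceil>"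

text \<open>Each summand secures one lower bound: \<open>a\<close> for \<open>Phi_flat\<close>, 2 to
  keep twice the height on the logarithmic branch, \<open>n\<close> for \<open>M_double\<close>, and
  the last one so that \<open>exp (- depth)\<close> times the number of patterns is at most 1 / 2 in
  \<open>disjoint_l1_X\<close>.\<close>

definition depth_of :: "nat \<Rightarrow> nat" where
  "depth_of n = nat \<lceil>a\<rceil> + 2 + n + 2 * (2 * n\<^sup>2 + 1) ^ n"

primrec M :: "nat \<Rightarrow> nat" where
  "M 0 = 0"
| "M (Suc k) = M k + nat \<lceil>exp (2 * real (width k) * real (depth_of (M k)))\<rceil>"

declare M.simps(2) [simp del]

definition depth :: "nat \<Rightarrow> nat" where
  "depth k = depth_of (M k)"

definition bsz :: "nat \<Rightarrow> real" where
  "bsz k = real (M (Suc k) - M k)"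

definition D :: "nat \<Rightarrow> real" where
  "D k = (1 + real (width k)) powr a"

definition blk :: "nat \<Rightarrow> nat" where
  "blk j = (LEAST k. j < M (Suc k))"

definition height :: "nat \<Rightarrow> real" where
  "height j = exp (- real (depth (blk j)))"

text \<open>Chosen so that a constant block of this height has modular between 1 and 2.\<close>

definition len :: "nat \<Rightarrow> nat" where
  "len j = nat \<lceil>1 / F (height j)\<rceil>"

section \<open>Growth of widths, depths and block sizes\<close>

lemma width_pos: "1 \<le> width k"
proof -
  have "1 powr (1 / a) \<le> (real k + 1) powr (1 / a)"
    using a_pos by (intro powr_mono2) auto
  then show ?thesis by (simp add: width_def le_nat_iff le_ceiling_iff)
qed

lemma width_mono: "k \<le> k' \<Longrightarrow> width k \<le> width k'"
  unfolding width_def using a_pos by (intro nat_mono ceiling_mono powr_mono2) auto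

lemma D_pos: "0 < D k"
  by (simp add: D_def)

lemma D_mono: "k \<le> k' \<Longrightarrow> D k \<le> D k'"
  unfolding D_def using a_pos width_mono by (intro powr_mono2) auto

text \<open>The power \<open>a\<close> undoes the exponent \<open>1 / a\<close> in
  \<open>width\<close>. Besides divergence, this pays for one unit per block in
  \<open>initial_l1_X\<close>.\<close>

lemma D_ge: "real k + 1 \<le> D k"
proof -
  have "(real k + 1) powr (1 / a) \<le> 1 + real (width k)"
    unfolding width_def by linarith
  then have "((real k + 1) powr (1 / a)) powr a \<le> D k"
    unfolding D_def using a_pos by (intro powr_mono2) auto
  then show ?thesis
    using a_pos by (simp add: powr_powr)
qed

lemma depth_ge: "2 \<le> depth k" "a \<le> depth k" "M k \<le> depth k" "2 * (2 * (M k)\<^sup>2 + 1) ^ M k \<le> depth k"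
proof -
  have "real (nat \<lceil>a\<rceil>) \<le> real (depth k)"
    unfolding depth_def depth_of_def by (intro of_nat_mono trans_le_add1 order_refl)
  then show "a \<le> real (depth k)" by linarith
qed (auto simp: depth_def depth_of_def)

lemma bsz_eq: "bsz k = real (nat \<lceil>exp (2 * real (width k) * real (depth k))\<rceil>)"
  by (simp add: bsz_def depth_def M.simps(2))

lemma bsz_ge: "exp (2 * real (width k) * real (depth k)) \<le> bsz k"
  unfolding bsz_eq by linarith

lemma wd_ge: "2 \<le> real (width k) * real (depth k)" "real (depth k) \<le> real (width k) * real (depth k)"
proof -
  have "1 * real (depth k) \<le> real (width k) * real (depth k)"
    using width_pos[of k] by (intro mult_right_mono) auto
  moreover have "2 \<le> real (depth k)"
    using depth_ge(1)[of k] by simp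
  ultimately show "2 \<le> real (width k) * real (depth k)"
    "real (depth k) \<le> real (width k) * real (depth k)"
    by linarith+
qed

lemma bsz_le: "bsz k \<le> exp (3 * real (width k) * real (depth k))"
proof -
  let ?x = "real (width k) * real (depth k)"
  have "exp (2 * ?x) \<ge> 1"
    using wd_ge[of k] by simp
  then have "bsz k \<le> 2 * exp (2 * ?x)"
    unfolding bsz_eq mult.assoc by linarith
  also have "\<dots> \<le> exp ?x * exp (2 * ?x)"
  proof (intro mult_right_mono)
    show "2 \<le> exp ?x"
      using wd_ge(1)[of k] exp_ge_add_one_self[of ?x] by linarith
  qed simp
  also have "\<dots> = exp (3 * ?x)"
    by (simp flip: exp_add)
  finally show ?thesis by (simp add: mult.assoc)
qed

lemma bsz_ge_depth: "real (depth k) \<le> bsz k"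
  using bsz_ge[of k] exp_ge_add_one_self[of "2 * real (width k) * real (depth k)"] wd_ge[of k]
  by linarith

lemma M_Suc_real: "real (M (Suc k)) = real (M k) + bsz k"
  by (simp add: bsz_def M.simps(2))

lemma M_double: "2 * M k \<le> M (Suc k)"
proof -
  have "real (2 * M k) \<le> real (M (Suc k))"
    unfolding M_Suc_real using bsz_ge_depth[of k] depth_ge(3)[of k] by simp
  then show ?thesis by (simp only: of_nat_le_iff)
qed

lemma M_less: "M k < M (Suc k)"
proof -
  have "real (M k) < real (M (Suc k))"
    unfolding M_Suc_real using bsz_ge_depth[of k] depth_ge(1)[of k] by simp
  then show ?thesis by (simp only: of_nat_less_iff)
qed

lemma M_strict_mono: "strict_mono M"
  using M_less by (simp add: strict_mono_Suc_iff)

lemma M_ge: "k \<le> M k"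
  using M_strict_mono by (rule strict_mono_imp_increasing)

lemma depth_mono: "k \<le> k' \<Longrightarrow> depth k \<le> depth k'"
proof -
  assume "k \<le> k'"
  then have m: "M k \<le> M k'"
    using M_strict_mono strict_mono_less_eq by blast
  have "(2 * (M k)\<^sup>2 + 1) ^ M k \<le> (2 * (M k')\<^sup>2 + 1) ^ M k"
    using m by (intro power_mono add_mono mult_left_mono) auto
  also have "\<dots> \<le> (2 * (M k')\<^sup>2 + 1) ^ M k'"
    using m by (intro power_increasing) auto
  finally show ?thesis
    using m by (simp add: depth_def depth_of_def)
qed

lemma less_M_blk: "j < M (Suc (blk j))"
proof -
  have "j < M (Suc j)"
    using M_ge[of "Suc j"] by simp
  then show ?thesis
    unfolding blk_def by (rule LeastI)
qed

lemma blk_le: "j < M (Suc k) \<Longrightarrow> blk j \<le> k"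
  unfolding blk_def by (rule Least_le)

lemma blk_ge: "M k \<le> j \<Longrightarrow> k \<le> blk j"
proof (rule ccontr)
  assume "M k \<le> j" "\<not> k \<le> blk j"
  then have "M (Suc (blk j)) \<le> M k"
    by (subst strict_mono_less_eq[OF M_strict_mono]) simp
  then show False
    using less_M_blk[of j] \<open>M k \<le> j\<close> by simp
qed

lemma blk_eq: "M k \<le> j \<Longrightarrow> j < M (Suc k) \<Longrightarrow> blk j = k"
  using blk_le blk_ge by (simp add: antisym)

lemma height_pos: "0 < height j"
  by (simp add: height_def)

lemma neg_ln_height: "- ln (height j) = depth (blk j)"
  by (simp add: height_def)

lemma height_le: "height j \<le> exp (- 2)"
  using depth_ge(1)[of "blk j"] by (simp add: height_def)

lemma two_exp_neg_2: "2 * exp (- 2) < 1 / (exp 1 :: real)"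
proof -
  have "2 < exp (1 :: real)"
    using exp_lower_Taylor_quadratic[of "1::real"] by simp
  then have "2 * exp (- 2) < exp 1 * exp (- 2 :: real)"
    by (intro mult_strict_right_mono) auto
  also have "\<dots> = 1 / exp 1"
  proof -
    have "exp 1 * exp (- 2) = exp (- 1 :: real)"
      by (simp flip: exp_add)
    then show ?thesis by (simp add: exp_minus inverse_eq_divide)
  qed
  finally show ?thesis .
qed

lemma height_less: "height j < 1 / exp 1" "2 * height j < 1 / exp 1"
  using height_le[of j] two_exp_neg_2 height_pos[of j] by linarith+

lemma len_F: "1 \<le> len j * F (height j)" "len j * F (height j) \<le> 2"
proof -
  let ?f = "F (height j)"
  have f: "0 < ?f" "?f \<le> 1"
    using F_pos[OF height_pos] F_mono[of "height j" 1] height_pos[of j] height_less(1)[of j]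
      less_trans[of "height j" "1 / exp 1" 1] by auto
  have "1 / ?f \<le> len j" "len j \<le> 1 / ?f + 1"
    unfolding len_def using f real_nat_ceiling_ge[of "1 / ?f"] of_int_ceiling_le_add_one[of "1 / ?f"]
    by simp_all
  then show "1 \<le> len j * ?f"
    using f by (simp add: divide_le_eq)
  have "len j * ?f \<le> (1 / ?f + 1) * ?f"
    using \<open>len j \<le> 1 / ?f + 1\<close> f by (intro mult_right_mono) auto
  also have "\<dots> = 1 + ?f"
    using f by (simp add: field_simps)
  finally show "len j * ?f \<le> 2" using f by simp
qed

lemma len_pos: "0 < len j"
  using len_F(1)[of j] by (intro Nat.gr0I) simp

section \<open>The Musielak--Orlicz functions of the normalized coordinates\<close>

definition Phi :: "nat \<Rightarrow> real \<Rightarrow> real" where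
  "Phi j t = len j * F (height j * t)"

lemma Phi_nonneg: "0 \<le> t \<Longrightarrow> 0 \<le> Phi j t"
  unfolding Phi_def using height_pos[of j] by (intro mult_nonneg_nonneg F_nonneg) auto

lemma Phi_0 [simp]: "Phi j 0 = 0"
  by (simp add: Phi_def)

lemma Phi_mono: "0 \<le> s \<Longrightarrow> s \<le> t \<Longrightarrow> Phi j s \<le> Phi j t"
  unfolding Phi_def using height_pos[of j] by (intro mult_left_mono F_mono) auto

lemma Phi_ge_self:
  assumes "1 \<le> t"
  shows "t \<le> Phi j t"
proof -
  have "t * 1 \<le> t * (len j * F (height j))"
    using assms len_F(1)[of j] by (intro mult_left_mono) auto
  also have "\<dots> \<le> Phi j t"
    using mult_left_mono[OF F_superlinear[of t "height j"], of "len j"] assms height_pos[of j]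
    by (simp add: Phi_def mult_ac)
  finally show ?thesis by simp
qed

lemma Phi_half: "Phi j (1 / 2) \<le> 1"
proof -
  have "Phi j (1 / 2) \<le> len j * (1 / 2 * F (height j))"
    unfolding Phi_def using F_star[of "1 / 2" "height j"] height_pos[of j]
    by (intro mult_left_mono) (auto simp: mult.commute)
  then show ?thesis using len_F(2)[of j] by simp
qed

lemma Phi_doubling: "0 \<le> t \<Longrightarrow> Phi j (2 * t) \<le> 2 powr (1 + 2 * a) * Phi j t"
  using mult_left_mono[OF F_doubling[of "height j * t"], of "len j"] height_pos[of j]
  by (simp add: Phi_def mult_ac)

text \<open>For \<open>t \<le> 2\<close> the condition \<open>2 * height j \<le> r\<close> gives the
  hypothesis of \<open>F_scale_ge\<close>. At small heights \<open>Phi j\<close> is thus nearly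
  linear over a long range of scales, which makes late blocks behave like \<open>l1\<close>.\<close>

lemma Phi_scale_ge:
  assumes "0 \<le> t" "t \<le> 2" "0 < r" "r \<le> 1" "2 * height j \<le> r"
  shows "r * Phi j t / 2 powr a \<le> Phi j (r * t)"
proof -
  have "height j * t \<le> height j * 2"
    using assms height_pos[of j] by (intro mult_left_mono) auto
  then have "height j * t < 1 / exp 1" "height j * t \<le> r"
    using assms height_less(2)[of j] by linarith+
  then have "r * F (height j * t) / 2 powr a \<le> F (r * (height j * t))"
    using assms height_pos[of j] by (intro F_scale_ge) auto
  then have "len j * (r * F (height j * t) / 2 powr a) \<le> len j * F (r * (height j * t))"
    by (intro mult_left_mono) auto
  then show ?thesis
    by (simp add: Phi_def mult_ac)
qed

text \<open>As \<open>len j * F (height j)\<close> lies between 1 and 2, this is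
  \<open>c * (1 - ln c / b) powr (- a)\<close> up to a factor 2, with \<open>b\<close> the depth of
  the block.\<close>

lemma Phi_eq:
  assumes "0 < c" "c \<le> 1"
  shows "Phi j c = len j * F (height j) * c * (depth (blk j) / (depth (blk j) - ln c)) powr a"
proof -
  have "c * height j \<le> 1 * height j"
    using assms height_pos[of j] by (intro mult_right_mono) auto
  then have "c * height j < 1 / exp 1"
    using height_less(1)[of j] by linarith
  then have "F (c * height j) = c * F (height j) * ((- ln (height j)) / (- ln (height j) - ln c)) powr a"
    using assms height_pos[of j] height_less(1)[of j] by (intro F_scale) auto
  then show ?thesis
    unfolding neg_ln_height by (simp add: Phi_def mult_ac)
qed

lemma Phi_ge:
  fixes r :: real
  assumes "0 < c" "c \<le> 1" "depth (blk j) - ln c \<le> r * depth (blk j)" "0 < r"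
  shows "c / r powr a \<le> Phi j c"
proof -
  have d: "0 < real (depth (blk j))"
    using depth_ge(1)[of "blk j"] by simp
  have lnc: "ln c \<le> 0" using assms by simp
  have "1 / r \<le> depth (blk j) / (depth (blk j) - ln c)"
  proof -
    have "1 \<le> (r * depth (blk j)) / (depth (blk j) - ln c)"
      using assms(3) d lnc by (subst pos_le_divide_eq) auto
    then show ?thesis
      using assms(4) by (simp add: pos_divide_le_eq mult.commute)
  qed
  then have "(1 / r) powr a \<le> (depth (blk j) / (depth (blk j) - ln c)) powr a"
    using assms a_pos by (intro powr_mono2) auto
  then have "1 * c * (1 / r) powr a \<le> Phi j c"
    unfolding Phi_eq[OF assms(1,2)] using len_F(1)[of j] assms
    by (intro mult_mono mult_right_mono) auto
  then show ?thesis
    by (simp add: powr_divide)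
qed

text \<open>A power beats the logarithm: \<open>- ln c \<le> a * c powr (- (1 / a))\<close>. Hence
  \<open>Phi_ge\<close> applies with an \<open>r\<close> whose \<open>a\<close>-th power is a
  multiple of \<open>1 / c\<close>. This yields the \<open>l2\<close> bound.\<close>

lemma Phi_ge_square:
  assumes "0 \<le> c" "c \<le> 1"
  shows "c\<^sup>2 / (1 + a) powr a \<le> Phi j c"
proof (cases "c = 0")
  case False
  then have c: "0 < c" using assms by simp
  define r where "r = (1 + a) * c powr (- (1 / a))"
  have d: "1 \<le> real (depth (blk j))"
    using depth_ge(1)[of "blk j"] by simp
  have "- ln c / a \<le> c powr (- (1 / a))"
    using c exp_ge_add_one_self[of "- ln c / a"] by (simp add: powr_def)
  then have "- ln c \<le> a * c powr (- (1 / a))"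
    using a_pos mult_left_mono[of "- ln c / a" "c powr (- (1 / a))" a] by simp
  moreover have "1 \<le> c powr (- (1 / a))"
    using powr_mono'[of "- (1 / a)" 0 c] c assms a_pos by simp
  ultimately have "1 - ln c \<le> r"
    by (simp add: r_def distrib_right)
  have "real (depth (blk j)) - ln c \<le> real (depth (blk j)) - ln c * depth (blk j)"
    using d c assms mult_left_mono[of 1 "real (depth (blk j))" "- ln c"] by simp
  also have "\<dots> = (1 - ln c) * depth (blk j)"
    by (simp add: algebra_simps)
  also have "\<dots> \<le> r * depth (blk j)"
    using \<open>1 - ln c \<le> r\<close> by (intro mult_right_mono) auto
  finally have "c / r powr a \<le> Phi j c"
    using c assms a_pos by (intro Phi_ge) (auto simp: r_def)
  moreover have "r powr a = (1 + a) powr a / c"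
  proof -
    have "r powr a = (1 + a) powr a * (c powr (- (1 / a))) powr a"
      unfolding r_def by (rule powr_mult)
    also have "(c powr (- (1 / a))) powr a = c powr (- 1)"
      using a_pos by (simp only: powr_powr) simp
    finally show ?thesis
      using c by (simp add: powr_minus_divide)
  qed
  ultimately show ?thesis
    using c by (simp add: power2_eq_square)
qed simp

text \<open>Values up to \<open>1 / bsz k\<close> are negligible, since they sum to at most 1 over
  the block. For larger ones \<open>- ln c\<close> is at most \<open>3 * width k * depth k\<close>,
  and the logarithms cost at most a multiple of \<open>D k\<close>.\<close>

lemma Phi_block:
  assumes "M k \<le> j" "j < M (Suc k)" "0 \<le> c" "c \<le> 1"
  shows "c \<le> 1 / bsz k + 3 powr a * D k * Phi j c"
proof (cases "c \<le> 1 / bsz k")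
  case True
  then show ?thesis
    using Phi_nonneg[OF assms(3), of j] D_pos[of k] by (simp add: add_increasing2)
next
  case False
  have b: "0 < bsz k"
    using bsz_ge_depth[of k] depth_ge(1)[of k] by simp
  have c: "0 < c" "1 / bsz k < c"
    using False b less_trans[of 0 "1 / bsz k" c] by auto
  have blk: "blk j = k"
    using assms by (intro blk_eq)
  have "ln (bsz k) \<le> ln (exp (3 * real (width k) * real (depth k)))"
    using b bsz_le[of k] by (intro ln_mono) auto
  moreover have "ln (1 / bsz k) \<le> ln c"
    using c b by (intro ln_mono) auto
  ultimately have "- ln c \<le> 3 * real (width k) * depth k"
    using b by (simp add: ln_div)
  then have "depth k - ln c \<le> (1 + 3 * real (width k)) * depth k"
    by (simp add: algebra_simps)
  also have "\<dots> \<le> (3 * (1 + real (width k))) * depth k"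
    by (intro mult_right_mono) auto
  finally have "c / (3 * (1 + real (width k))) powr a \<le> Phi j c"
    using c assms by (intro Phi_ge) (auto simp: blk)
  also have "(3 * (1 + real (width k))) powr a = 3 powr a * D k"
    unfolding D_def by (rule powr_mult)
  finally have "c \<le> 3 powr a * D k * Phi j c"
    using D_pos[of k] by (simp add: field_simps)
  then show ?thesis
    using b by (simp add: add_increasing)
qed

text \<open>\<open>bsz k / D k\<close> is at least \<open>exp (width k * depth k)\<close>, so the
  logarithmic factor at this value is at most \<open>1 / D k\<close>; the factor 2 pays for the
  upper bound in \<open>len_F\<close>.\<close>

lemma Phi_flat:
  assumes "M k \<le> j" "j < M (Suc k)"
  shows "Phi j (1 / (2 * (bsz k / D k))) \<le> 1 / bsz k"
proof -
  have b: "0 < bsz k"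
    using bsz_ge_depth[of k] depth_ge(1)[of k] by simp
  define l where "l = 2 * (bsz k / D k)"
  let ?w = "real (width k)" and ?d = "real (depth k)"
  have blk: "blk j = k"
    using assms by (intro blk_eq)
  have "D k = exp (a * ln (1 + ?w))"
    by (simp add: D_def powr_def)
  also have "\<dots> \<le> exp (?d * ?w)"
    using depth_ge(2)[of k] a_pos ln_add_one_self_le_self[of ?w]
    by (simp add: mult_mono)
  finally have D: "D k \<le> exp (?w * ?d)" by (simp add: mult.commute)
  have "exp (?w * ?d) * D k \<le> exp (?w * ?d) * exp (?w * ?d)"
    using D by (intro mult_left_mono) auto
  also have "\<dots> = exp (2 * ?w * ?d)"
    by (simp flip: exp_add add: algebra_simps)
  also have "\<dots> \<le> bsz k"
    by (rule bsz_ge)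
  finally have l: "exp (?w * ?d) \<le> l"
    using D_pos[of k] b by (simp add: l_def field_simps)
  moreover have "1 \<le> exp (?w * ?d)" by simp
  ultimately have l1: "1 \<le> l" by linarith
  have ln_l: "?w * ?d \<le> ln l"
    using l l1 by (simp add: ln_ge_iff)
  have d: "0 < ?d" using depth_ge(1)[of k] by simp
  have ln_l0: "0 \<le> ln l" using l1 by simp
  have "?d / (?d + ln l) \<le> ?d / (?d + ?w * ?d)"
    using d ln_l ln_l0 by (intro divide_left_mono) (auto intro!: mult_pos_pos add_pos_nonneg)
  also have "\<dots> = 1 / (1 + ?w)"
  proof -
    have "?d + ?w * ?d = (1 + ?w) * ?d"
      by (simp add: algebra_simps)
    then show ?thesis using d by simp
  qed
  finally have ratio: "?d / (?d + ln l) \<le> 1 / (1 + ?w)" .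
  have "Phi j (1 / l) = len j * F (height j) * (1 / l) * (?d / (?d - ln (1 / l))) powr a"
    using l1 by (subst Phi_eq) (auto simp: blk)
  also have "?d - ln (1 / l) = ?d + ln l"
    using l1 by (simp add: ln_div)
  also have "len j * F (height j) * (1 / l) * (?d / (?d + ln l)) powr a
      \<le> 2 * (1 / l) * (1 / (1 + ?w)) powr a"
    using len_F(2)[of j] l1 ratio d ln_l0 a_pos
    by (intro mult_mono powr_mono2 mult_right_mono) (auto intro!: divide_nonneg_nonneg)
  also have "(1 / (1 + ?w)) powr a = 1 / D k"
    by (simp add: powr_divide D_def)
  also have "2 * (1 / l) * (1 / D k) = 1 / bsz k"
    using D_pos[of k] b by (simp add: l_def)
  finally show ?thesis by (simp add: l_def)
qed

text \<open>Each block contributes 1. This is the total of what \<open>Phi_block\<close>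
  neglects.\<close>

lemma sum_inverse_bsz: "(\<Sum>i<M (Suc k). 1 / bsz (blk i)) = k + 1"
proof -
  have step: "(\<Sum>i\<in>{M k..<M (Suc k)}. 1 / bsz (blk i)) = 1" for k
  proof -
    have "(\<Sum>i\<in>{M k..<M (Suc k)}. 1 / bsz (blk i)) = (\<Sum>i\<in>{M k..<M (Suc k)}. 1 / bsz k)"
      by (intro sum.cong refl) (simp add: blk_eq[of k])
    also have "\<dots> = 1"
      using M_less[of k] by (simp add: bsz_def)
    finally show ?thesis .
  qed
  show ?thesis
  proof (induction k)
    case 0
    then show ?case
      using step[of 0] by (simp add: lessThan_atLeast0)
  next
    case (Suc k)
    have "(\<Sum>i<M (Suc (Suc k)). 1 / bsz (blk i))
        = (\<Sum>i<M (Suc k). 1 / bsz (blk i)) + (\<Sum>i\<in>{M (Suc k)..<M (Suc (Suc k))}. 1 / bsz (blk i))"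
      unfolding lessThan_atLeast0
      using M_less[of "Suc k"] by (intro sum.atLeastLessThan_concat[symmetric]) auto
    then show ?case
      using Suc step[of "Suc k"] by simp
  qed
qed


section \<open>Partition of the Orlicz coordinates into intervals\<close>

definition start :: "nat \<Rightarrow> nat" where
  "start j = (\<Sum>i<j. len i)"

definition fib :: "nat \<Rightarrow> nat set" where
  "fib j = {start j..<start (Suc j)}"

text \<open>The number of the interval that contains \<open>i\<close>, as \<open>in_fib_iff\<close>
  shows.\<close>

definition p :: "nat \<Rightarrow> nat" where
  "p i = (LEAST j. i < start (Suc j))"

lemma start_Suc: "start (Suc j) = start j + len j"
  by (simp add: start_def)

lemma start_strict_mono: "strict_mono start"
  using len_pos by (simp add: strict_mono_Suc_iff start_Suc)

lemma card_fib [simp]: "card (fib j) = len j"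
  by (simp add: fib_def start_Suc)

lemma finite_fib [simp]: "finite (fib j)"
  by (simp add: fib_def)

lemma in_fib_iff: "i \<in> fib j \<longleftrightarrow> p i = j"
proof
  assume i: "i \<in> fib j"
  show "p i = j"
    unfolding p_def
  proof (rule Least_equality)
    show "i < start (Suc j)"
      using i by (simp add: fib_def)
    fix m assume "i < start (Suc m)"
    then have "start j < start (Suc m)"
      using i by (simp add: fib_def)
    then show "j \<le> m"
      by (simp add: strict_mono_less[OF start_strict_mono])
  qed
next
  assume j: "p i = j"
  have "i < start (Suc i)"
    using strict_mono_imp_increasing[OF start_strict_mono, of "Suc i"] by simp
  then have "i < start (Suc j)"
    unfolding j[symmetric] p_def by (rule LeastI)
  moreover have "start j \<le> i"
  proof (cases j)
    case (Suc m)
    then have "m < p i" using j by simp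
    then have "\<not> i < start (Suc m)"
      unfolding p_def by (rule not_less_Least)
    then show ?thesis using Suc by simp
  qed (simp add: start_def)
  ultimately show "i \<in> fib j"
    by (simp add: fib_def)
qed

lemma p_start: "p (start j) = j"
  using len_pos[of j] by (subst in_fib_iff[symmetric]) (simp add: fib_def start_Suc)

lemma sum_fibres: "finite J \<Longrightarrow> (\<Sum>i\<in>(\<Union>j\<in>J. fib j). g i) = (\<Sum>j\<in>J. \<Sum>i\<in>fib j. g i)"
  by (intro sum.UNION_disjoint) (auto simp: in_fib_iff)

lemma sum_le_fibres:
  fixes g :: "nat \<Rightarrow> real"
  assumes "finite I" "\<And>i. 0 \<le> g i"
  shows "(\<Sum>i\<in>I. g i) \<le> (\<Sum>j\<in>p ` I. \<Sum>i\<in>fib j. g i)"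
proof -
  have "(\<Sum>i\<in>I. g i) \<le> (\<Sum>i\<in>(\<Union>j\<in>p ` I. fib j). g i)"
    using assms by (intro sum_mono2) (auto simp: in_fib_iff)
  then show ?thesis
    using assms(1) by (subst (asm) sum_fibres) auto
qed

section \<open>Passage between normalized coordinates and sequences constant on the
  intervals\<close>

definition emb :: "(nat \<Rightarrow> real) \<Rightarrow> nat \<Rightarrow> real" where
  "emb c i = height (p i) * c (p i)"

text \<open>The value is read off at the first index of each interval; on the range of
  \<open>emb\<close> this is the inverse map.\<close>

definition dec :: "(nat \<Rightarrow> real) \<Rightarrow> nat \<Rightarrow> real" where
  "dec y j = y (start j) / height j"

lemma dec_emb [simp]: "dec (emb c) = c"
  using height_pos by (simp add: dec_def emb_def p_start fun_eq_iff less_imp_neq[symmetric])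

lemma emb_add: "emb (c + d) = emb c + emb d"
  and emb_diff: "emb (c - d) = emb c - emb d"
  and emb_scale: "emb (r *\<^sub>R c) = r *\<^sub>R emb c"
  and emb_zero: "emb 0 = 0"
  by (rule ext, simp add: emb_def algebra_simps)+

lemma emb_sum: "emb (\<Sum>a\<in>A. f a) = (\<Sum>a\<in>A. emb (f a))"
  by (rule ext) (simp add: emb_def sum_distrib_left)

definition block_modular_le :: "real \<Rightarrow> (nat \<Rightarrow> real) \<Rightarrow> bool" where
  "block_modular_le l c \<longleftrightarrow> (\<forall>J. finite J \<longrightarrow> (\<Sum>j\<in>J. Phi j (\<bar>c j\<bar> / l)) \<le> 1)"

lemma block_modular_leD: "block_modular_le l c \<Longrightarrow> finite J \<Longrightarrow> (\<Sum>j\<in>J. Phi j (\<bar>c j\<bar> / l)) \<le> 1"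
  by (simp add: block_modular_le_def)

lemma sum_fib_emb: "(\<Sum>i\<in>fib j. F (\<bar>emb c i\<bar> / l)) = Phi j (\<bar>c j\<bar> / l)"
proof -
  have "(\<Sum>i\<in>fib j. F (\<bar>emb c i\<bar> / l)) = (\<Sum>i\<in>fib j. F (height j * (\<bar>c j\<bar> / l)))"
    using height_pos[of j] by (intro sum.cong) (auto simp: in_fib_iff emb_def abs_mult)
  then show ?thesis by (simp add: Phi_def)
qed

lemma modular_le_emb:
  assumes "l > 0"
  shows "modular_le F l (emb c) \<longleftrightarrow> block_modular_le l c"
proof
  assume *: "modular_le F l (emb c)"
  show "block_modular_le l c"
    unfolding block_modular_le_def
  proof (intro allI impI)
    fix J :: "nat set" assume J: "finite J"
    have "(\<Sum>j\<in>J. Phi j (\<bar>c j\<bar> / l)) = (\<Sum>i\<in>(\<Union>j\<in>J. fib j). F (\<bar>emb c i\<bar> / l))"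
      using J by (simp add: sum_fibres sum_fib_emb)
    also have "\<dots> \<le> 1"
      using * J by (simp add: modular_le_def)
    finally show "(\<Sum>j\<in>J. Phi j (\<bar>c j\<bar> / l)) \<le> 1" .
  qed
next
  assume *: "block_modular_le l c"
  show "modular_le F l (emb c)"
    unfolding modular_le_def
  proof (intro allI impI)
    fix I :: "nat set" assume I: "finite I"
    have "(\<Sum>i\<in>I. F (\<bar>emb c i\<bar> / l)) \<le> (\<Sum>j\<in>p ` I. \<Sum>i\<in>fib j. F (\<bar>emb c i\<bar> / l))"
      using I assms by (intro sum_le_fibres F_nonneg) auto
    also have "\<dots> \<le> 1"
      unfolding sum_fib_emb using * I by (intro block_modular_leD) auto
    finally show "(\<Sum>i\<in>I. F (\<bar>emb c i\<bar> / l)) \<le> 1" .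
  qed
qed

section \<open>The coordinate space and its lattice axioms\<close>

definition X :: "(nat \<Rightarrow> real) set" where
  "X = {c. emb c \<in> orlicz_space F}"

definition nn :: "(nat \<Rightarrow> real) \<Rightarrow> real" where
  "nn c = orlicz_norm F (emb c)"

lemma X_iff: "c \<in> X \<longleftrightarrow> (\<exists>l>0. block_modular_le l c)"
  using modular_le_emb by (auto simp: X_def in_space_iff)

lemma nn_le: "0 < l \<Longrightarrow> block_modular_le l c \<Longrightarrow> nn c \<le> l"
  unfolding nn_def using modular_le_emb by (intro norm_le) auto

lemma nn_limit:
  assumes "c \<in> X" "0 < B" "\<And>l. 0 < l \<Longrightarrow> block_modular_le l c \<Longrightarrow> r \<le> B * l"
  shows "r \<le> B * nn c"
  unfolding nn_def using assms modular_le_emb by (intro norm_limit) (auto simp: X_def)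

lemma abs_emb_mono: "\<bar>v (p i)\<bar> \<le> \<bar>u (p i)\<bar> \<Longrightarrow> \<bar>emb v i\<bar> \<le> \<bar>emb u i\<bar>"
  using height_pos[of "p i"] by (simp add: emb_def abs_mult mult_left_mono)

lemma normed_subspace_X: "normed_subspace X nn"
proof -
  interpret O: normed_subspace "orlicz_space F" "orlicz_norm F"
    by (rule orlicz_normed_subspace)
  show ?thesis
  proof
    show "subspace X"
      by (auto simp: subspace_def X_def emb_add emb_scale emb_zero O.add_in O.scale_in O.zero_in)
  qed (auto simp: X_def nn_def emb_add emb_scale O.nrm_triangle O.nrm_scale O.nrm_nonneg)
qed

lemma block_modular_le_mono:
  assumes "block_modular_le l u" "0 < l" "\<And>i. \<bar>v i\<bar> \<le> \<bar>u i\<bar>"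
  shows "block_modular_le l v"
  using assms modular_le_mono[of l "emb u" l "emb v"] modular_le_emb abs_emb_mono by auto

lemma solid_X:
  assumes "u \<in> X" "\<And>i. \<bar>v i\<bar> \<le> \<bar>u i\<bar>"
  shows "v \<in> X" "nn v \<le> nn u"
  using assms solid_space[of "emb u" "emb v"] abs_emb_mono by (auto simp: X_def nn_def)

lemma coordinate_le_l:
  assumes "block_modular_le l c" "0 < l"
  shows "\<bar>c j\<bar> \<le> l"
proof (rule ccontr)
  assume "\<not> \<bar>c j\<bar> \<le> l"
  then have gt: "1 < \<bar>c j\<bar> / l" using assms(2) by simp
  then have "1 < Phi j (\<bar>c j\<bar> / l)"
    using Phi_ge_self[of "\<bar>c j\<bar> / l" j] by linarith
  then show False
    using block_modular_leD[OF assms(1), of "{j}"] by simp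
qed

lemma coordinate_le_X: "c \<in> X \<Longrightarrow> \<bar>c j\<bar> \<le> nn c"
  using nn_limit[of c 1 "\<bar>c j\<bar>"] coordinate_le_l by simp

lemma unit_X: "unit_seq j \<in> X" "nn (unit_seq j) \<le> 2"
proof -
  have "block_modular_le 2 (unit_seq j)"
    unfolding block_modular_le_def
  proof (intro allI impI)
    fix J :: "nat set" assume J: "finite J"
    have "(\<Sum>i\<in>J. Phi i (\<bar>unit_seq j i\<bar> / 2)) = (\<Sum>i\<in>J. if i = j then Phi j (1 / 2) else 0)"
      by (intro sum.cong) (auto simp: unit_seq_def)
    also have "\<dots> \<le> 1"
      using J Phi_half[of j] by simp
    finally show "(\<Sum>i\<in>J. Phi i (\<bar>unit_seq j i\<bar> / 2)) \<le> 1" .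
  qed
  then show "unit_seq j \<in> X" "nn (unit_seq j) \<le> 2"
    using X_iff nn_le by (auto intro: exI[of _ 2])
qed

definition C :: real where
  "C = 2 + 2 * 2 powr a + (1 + a) powr a + 3 powr a"

lemma C_ge: "2 \<le> C" "(1 + a) powr a \<le> C" "1 + 3 powr a \<le> C" "2 + 2 * 2 powr a \<le> C"
  by (auto simp: C_def add_increasing add_increasing2)

lemma l2_le_X:
  assumes "u \<in> X" "finite J"
  shows "sqrt (\<Sum>j\<in>J. (u j)\<^sup>2) \<le> C * nn u"
proof (rule nn_limit[OF assms(1)])
  show "0 < C" using C_ge by simp
  fix l :: real assume l: "0 < l" "block_modular_le l u"
  let ?q = "(1 + a) powr a"
  have q: "1 \<le> ?q"
    using a_pos ge_one_powr_ge_zero[of "1 + a" a] by simp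
  have "(\<Sum>j\<in>J. (\<bar>u j\<bar> / l)\<^sup>2 / ?q) \<le> (\<Sum>j\<in>J. Phi j (\<bar>u j\<bar> / l))"
    using l coordinate_le_l[OF l(2,1)] by (intro sum_mono Phi_ge_square) auto
  also have "\<dots> \<le> 1"
    by (intro block_modular_leD l assms)
  finally have "(\<Sum>j\<in>J. (u j)\<^sup>2) / (l\<^sup>2 * ?q) \<le> 1"
    by (simp add: power_divide sum_divide_distrib)
  then have "(\<Sum>j\<in>J. (u j)\<^sup>2) \<le> l\<^sup>2 * ?q"
  proof (subst (asm) pos_divide_le_eq)
    show "0 < l\<^sup>2 * ?q" using l(1) q by (intro mult_pos_pos) auto
  qed simp
  also have "\<dots> \<le> l\<^sup>2 * C\<^sup>2"
    using C_ge(1,2) power2_eq_square[of C] mult_mono[of ?q C 1 C] by (intro mult_left_mono) auto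
  finally show "sqrt (\<Sum>j\<in>J. (u j)\<^sup>2) \<le> C * l"
    using l C_ge(1) by (intro real_le_lsqrt) (auto simp: power_mult_distrib mult.commute)
qed

lemma Phi_doubling_iterated:
  assumes "0 \<le> t"
  shows "Phi j (2 ^ q * t) \<le> (2 powr (1 + 2 * a)) ^ q * Phi j t"
proof (induction q)
  case (Suc q)
  have "Phi j (2 * (2 ^ q * t)) \<le> 2 powr (1 + 2 * a) * Phi j (2 ^ q * t)"
    using assms by (intro Phi_doubling) auto
  also have "\<dots> \<le> 2 powr (1 + 2 * a) * ((2 powr (1 + 2 * a)) ^ q * Phi j t)"
    using Suc by (intro mult_left_mono) auto
  finally show ?case by (simp add: mult_ac)
qed simp

text \<open>Membership in \<open>X\<close> controls the modular at one scale only; iterated doubling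
  carries this to every scale.\<close>

lemma summable_Phi:
  assumes "u \<in> X" "0 < e"
  shows "summable (\<lambda>j. Phi j (\<bar>u j\<bar> / e))"
proof -
  obtain l where l: "0 < l" "block_modular_le l u"
    using assms(1) X_iff by blast
  obtain q :: nat where q: "l / e < 2 ^ q"
    using real_arch_pow[of 2 "l / e"] by auto
  let ?Q = "(2 powr (1 + 2 * a)) ^ q"
  show ?thesis
  proof (rule summableI_nonneg_bounded)
    fix n
    have "(\<Sum>j<n. Phi j (\<bar>u j\<bar> / e)) \<le> (\<Sum>j<n. ?Q * Phi j (\<bar>u j\<bar> / l))"
    proof (rule sum_mono)
      fix j
      have "\<bar>u j\<bar> / e = l / e * (\<bar>u j\<bar> / l)"
        using l by simp
      also have "\<dots> \<le> 2 ^ q * (\<bar>u j\<bar> / l)"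
        using q l by (intro mult_right_mono) auto
      finally have "Phi j (\<bar>u j\<bar> / e) \<le> Phi j (2 ^ q * (\<bar>u j\<bar> / l))"
        using assms(2) by (intro Phi_mono) auto
      also have "\<dots> \<le> ?Q * Phi j (\<bar>u j\<bar> / l)"
        using l by (intro Phi_doubling_iterated) auto
      finally show "Phi j (\<bar>u j\<bar> / e) \<le> ?Q * Phi j (\<bar>u j\<bar> / l)" .
    qed
    also have "\<dots> = ?Q * (\<Sum>j<n. Phi j (\<bar>u j\<bar> / l))"
      by (simp add: sum_distrib_left)
    also have "\<dots> \<le> ?Q * 1"
      by (intro mult_left_mono block_modular_leD l) auto
    finally show "(\<Sum>j<n. Phi j (\<bar>u j\<bar> / e)) \<le> ?Q" by simp
  qed (use assms(2) in \<open>auto intro!: Phi_nonneg\<close>)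
qed

text \<open>Once the tail of the convergent modular at scale \<open>r / 2\<close> is below 1, the
  tail has norm at most \<open>r / 2\<close>.\<close>

lemma tails_X:
  assumes "u \<in> X"
  shows "(\<lambda>n. nn (prj {n..} u)) \<longlonglongrightarrow> 0"
proof (rule LIMSEQ_I)
  interpret normed_subspace X nn by (rule normed_subspace_X)
  fix r :: real assume "0 < r"
  then have e: "0 < r / 2" by simp
  obtain n0 where n0: "\<And>m n. n0 \<le> m \<Longrightarrow> norm (\<Sum>j\<in>{m..<n}. Phi j (\<bar>u j\<bar> / (r / 2))) < 1"
    using summable_Phi[OF assms e] unfolding summable_Cauchy by (metis zero_less_one)
  have "nn (prj {n..} u) \<le> r / 2" if "n0 \<le> n" for n
  proof (rule nn_le[OF e])
    show "block_modular_le (r / 2) (prj {n..} u)"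
      unfolding block_modular_le_def
    proof (intro allI impI)
      fix J :: "nat set" assume J: "finite J"
      then obtain m where m: "J \<subseteq> {..<m}"
        using finite_nat_iff_bounded by auto
      have "(\<Sum>j\<in>J. Phi j (\<bar>prj {n..} u j\<bar> / (r / 2))) = (\<Sum>j\<in>J \<inter> {n..}. Phi j (\<bar>u j\<bar> / (r / 2)))"
        using J by (intro sum.mono_neutral_cong_right) (auto simp: prj_def)
      also have "\<dots> \<le> (\<Sum>j\<in>{n..<m}. Phi j (\<bar>u j\<bar> / (r / 2)))"
        using m e by (intro sum_mono2) (auto intro!: Phi_nonneg)
      also have "\<dots> \<le> 1"
        using n0[OF that, of m] by simp
      finally show "(\<Sum>j\<in>J. Phi j (\<bar>prj {n..} u j\<bar> / (r / 2))) \<le> 1" .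
    qed
  qed
  moreover have "0 \<le> nn (prj {n..} u)" for n
    using solid_X(1)[OF assms, of "prj {n..} u"] by (intro nrm_nonneg) (auto simp: prj_def)
  ultimately have "norm (nn (prj {n..} u) - 0) < r" if "n0 \<le> n" for n
    using that e by (smt (verit) real_norm_def field_sum_of_halves)
  then show "\<exists>no. \<forall>n\<ge>no. norm (nn (prj {n..} u) - 0) < r"
    by blast
qed

lemma block_norm_X:
  "nn (prj {M k..<M (Suc k)} (\<lambda>_. 1)) \<le> C * (real (card {M k..<M (Suc k)}) / D k)"
proof -
  let ?l = "2 * (bsz k / D k)" and ?B = "{M k..<M (Suc k)}"
  have b: "0 < bsz k"
    using bsz_ge_depth[of k] depth_ge(1)[of k] by simp
  have l: "0 < ?l"
    using b D_pos[of k] by simp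
  have "block_modular_le ?l (prj ?B (\<lambda>_. 1))"
    unfolding block_modular_le_def
  proof (intro allI impI)
    fix J :: "nat set" assume J: "finite J"
    have "(\<Sum>j\<in>J. Phi j (\<bar>prj ?B (\<lambda>_. 1) j\<bar> / ?l)) = (\<Sum>j\<in>J \<inter> ?B. Phi j (1 / ?l))"
      using J by (intro sum.mono_neutral_cong_right) (auto simp: prj_def)
    also have "\<dots> \<le> (\<Sum>j\<in>?B. Phi j (1 / ?l))"
      using less_imp_le[OF l] by (intro sum_mono2 Phi_nonneg divide_nonneg_nonneg) auto
    also have "\<dots> \<le> (\<Sum>j\<in>?B. 1 / bsz k)"
      by (intro sum_mono Phi_flat) auto
    also have "\<dots> = 1"
      using b by (simp add: bsz_def)
    finally show "(\<Sum>j\<in>J. Phi j (\<bar>prj ?B (\<lambda>_. 1) j\<bar> / ?l)) \<le> 1" .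
  qed
  then have "nn (prj ?B (\<lambda>_. 1)) \<le> ?l"
    using l by (intro nn_le)
  also have "\<dots> \<le> C * (bsz k / D k)"
    using C_ge(1) b D_pos[of k] by (intro mult_right_mono) auto
  finally show ?thesis by (simp add: bsz_def)
qed

text \<open>\<open>Phi_block\<close> is summed over the blocks up to \<open>k\<close>. The neglected
  values add up to \<open>k + 1 \<le> D k\<close>, and \<open>D\<close> is monotone.\<close>

lemma initial_l1_X:
  assumes "u \<in> X"
  shows "(\<Sum>i<M (Suc k). \<bar>u i\<bar>) \<le> C * D k * nn u"
proof (rule nn_limit[OF assms])
  show "0 < C * D k" using C_ge(1) D_pos[of k] by simp
  fix l :: real assume l: "0 < l" "block_modular_le l u"
  have "(\<Sum>i<M (Suc k). \<bar>u i\<bar> / l)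
      \<le> (\<Sum>i<M (Suc k). 1 / bsz (blk i) + 3 powr a * D k * Phi i (\<bar>u i\<bar> / l))"
  proof (rule sum_mono)
    fix i assume i: "i \<in> {..<M (Suc k)}"
    have "M (blk i) \<le> i"
    proof (cases "blk i")
      case (Suc m)
      then show ?thesis
        using blk_le[of i m] by force
    qed simp
    then have "\<bar>u i\<bar> / l \<le> 1 / bsz (blk i) + 3 powr a * D (blk i) * Phi i (\<bar>u i\<bar> / l)"
      using l coordinate_le_l[OF l(2,1), of i] less_M_blk[of i] by (intro Phi_block) auto
    also have "\<dots> \<le> 1 / bsz (blk i) + 3 powr a * D k * Phi i (\<bar>u i\<bar> / l)"
      using i l blk_le[of i k] by (intro add_mono mult_right_mono mult_left_mono D_mono Phi_nonneg) auto
    finally show "\<bar>u i\<bar> / l \<le> 1 / bsz (blk i) + 3 powr a * D k * Phi i (\<bar>u i\<bar> / l)" .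
  qed
  also have "\<dots> = (real k + 1) + 3 powr a * D k * (\<Sum>i<M (Suc k). Phi i (\<bar>u i\<bar> / l))"
    by (simp only: sum.distrib sum_inverse_bsz sum_distrib_left)
  also have "\<dots> \<le> D k + 3 powr a * D k * 1"
    using D_pos[of k] by (intro add_mono D_ge mult_left_mono block_modular_leD l) auto
  also have "\<dots> = (1 + 3 powr a) * D k"
    by (simp add: algebra_simps)
  also have "\<dots> \<le> C * D k"
    using C_ge(3) D_pos[of k] by (intro mult_right_mono) auto
  finally show "(\<Sum>i<M (Suc k). \<bar>u i\<bar>) \<le> C * D k * l"
    using l by (simp add: sum_divide_distrib[symmetric] divide_le_eq)
qed

text \<open>For the vectors that are not tiny compared with \<open>l\<close>, rescaling to
  \<open>l\<close> is linear up to \<open>2 powr a\<close>, so on disjoint supports their norms add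
  up through the modular of the sum. The tiny ones are too few to matter.\<close>

lemma disjoint_l1_X:
  fixes T :: "nat set"
  assumes T: "finite T" "card T \<le> (2 * (M (Suc k))\<^sup>2 + 1) ^ M (Suc k)"
    and z: "\<And>t. t \<in> T \<Longrightarrow> z t \<in> X" "\<And>t i. t \<in> T \<Longrightarrow> i < M (Suc k) \<Longrightarrow> z t i = 0"
    and disj: "\<And>s t i. s \<in> T \<Longrightarrow> t \<in> T \<Longrightarrow> s \<noteq> t \<Longrightarrow> z s i = 0 \<or> z t i = 0"
  shows "(\<Sum>t\<in>T. nn (z t)) \<le> C * nn (\<Sum>t\<in>T. z t)"
proof (rule nn_limit)
  interpret normed_subspace X nn by (rule normed_subspace_X)
  show "(\<Sum>t\<in>T. z t) \<in> X" by (intro sum_in z)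
  show "0 < C" using C_ge(1) by simp
  define Z where "Z = (\<Sum>t\<in>T. z t)"
  fix l :: real assume l: "0 < l" "block_modular_le l (\<Sum>t\<in>T. z t)"
  then have lZ: "block_modular_le l Z" by (simp add: Z_def)
  have Z_eq: "Z i = z t i" if "t \<in> T" "z t i \<noteq> 0" for t i
  proof -
    have "(\<Sum>s\<in>T. z s i) = (\<Sum>s\<in>T. if s = t then z t i else 0)"
      using that disj by (intro sum.cong) auto
    then show ?thesis using T(1) that(1) by (simp add: Z_def)
  qed
  define h where "h = exp (- real (depth (Suc k)))"
  have h: "0 < h" "height i \<le> h" if "M (Suc k) \<le> i" for i
    using depth_mono[OF blk_ge[OF that]] by (auto simp: h_def height_def)
  have h0: "0 < h" by (simp add: h_def)
  \<comment> \<open>With \<open>r = nn (z t)\<close>, the bound \<open>4 * h * l < r\<close> gives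
    the condition \<open>2 * height j \<le> r / (2 * l)\<close> of
    \<open>Phi_scale_ge\<close>.\<close>
  define T1 where "T1 = {t\<in>T. 4 * h * l < nn (z t)}"
  have T1: "T1 \<subseteq> T" "finite T1" using T(1) by (auto simp: T1_def)
  have "\<exists>J. finite J \<and> (\<forall>j\<in>J. z t j \<noteq> 0) \<and> nn (z t) / (2 * l) / 2 powr a \<le> (\<Sum>j\<in>J. Phi j (\<bar>Z j\<bar> / l))"
    if t: "t \<in> T1" for t
  proof -
    define r where "r = nn (z t)"
    have tT: "t \<in> T" and r: "4 * h * l < r" using t by (auto simp: T1_def r_def)
    have "0 < 4 * h * l" using h0 l(1) by simp
    then have r0: "0 < r" using r by linarith
    have "\<bar>z t i\<bar> \<le> \<bar>Z i\<bar>" for i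
      using Z_eq[OF tT, of i] by (cases "z t i = 0") auto
    then have "r \<le> l"
      unfolding r_def by (rule nn_le[OF l(1) block_modular_le_mono[OF lZ l(1)]])
    \<comment> \<open>As \<open>r / 2\<close> is below the norm, the modular at \<open>r / 2\<close>
      exceeds 1 on some finite set. Scaling by \<open>r / (2 * l)\<close> turns it into the modular
      of \<open>Z\<close> at \<open>l\<close>.\<close>
    have "\<not> block_modular_le (r / 2) (z t)"
      using nn_le[of "r / 2" "z t"] r0 by (auto simp: r_def)
    then obtain J where J: "finite J" "1 < (\<Sum>j\<in>J. Phi j (\<bar>z t j\<bar> / (r / 2)))"
      unfolding block_modular_le_def by (auto simp: not_le)
    define J' where "J' = {j\<in>J. z t j \<noteq> 0}"
    have J': "finite J'" using J(1) by (simp add: J'_def)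
    have "(\<Sum>j\<in>J. Phi j (\<bar>z t j\<bar> / (r / 2))) = (\<Sum>j\<in>J'. Phi j (\<bar>z t j\<bar> / (r / 2)))"
      using J(1) by (intro sum.mono_neutral_right) (auto simp: J'_def)
    then have "r / (2 * l) * 1 / 2 powr a
        \<le> r / (2 * l) * (\<Sum>j\<in>J'. Phi j (\<bar>z t j\<bar> / (r / 2))) / 2 powr a"
      using J(2) r0 l(1) by (intro divide_right_mono mult_left_mono) auto
    also have "\<dots> = (\<Sum>j\<in>J'. r / (2 * l) * Phi j (\<bar>z t j\<bar> / (r / 2)) / 2 powr a)"
      by (simp add: sum_distrib_left sum_divide_distrib)
    also have "\<dots> \<le> (\<Sum>j\<in>J'. Phi j (\<bar>Z j\<bar> / l))"
    proof (rule sum_mono)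
      fix j assume j: "j \<in> J'"
      then have "M (Suc k) \<le> j"
        using z(2)[OF tT, of j] by (force simp: J'_def)
      then have hj: "height j \<le> h" by (rule h)
      have "\<bar>z t j\<bar> \<le> r"
        unfolding r_def by (intro coordinate_le_X z tT)
      then have "r / (2 * l) * Phi j (\<bar>z t j\<bar> / (r / 2)) / 2 powr a
          \<le> Phi j (r / (2 * l) * (\<bar>z t j\<bar> / (r / 2)))"
        using r0 l(1) r hj \<open>r \<le> l\<close>
        by (intro Phi_scale_ge) (auto simp: divide_le_eq le_divide_eq mult_left_mono
            intro: order_trans[of _ "4 * h * l" r])
      also have "r / (2 * l) * (\<bar>z t j\<bar> / (r / 2)) = \<bar>Z j\<bar> / l"
        using Z_eq[OF tT, of j] j r0 by (simp add: J'_def)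
      finally show "r / (2 * l) * Phi j (\<bar>z t j\<bar> / (r / 2)) / 2 powr a \<le> Phi j (\<bar>Z j\<bar> / l)" .
    qed
    finally show ?thesis
      using J' by (intro exI[of _ J']) (auto simp: J'_def r_def)
  qed
  then obtain J where J: "\<And>t. t \<in> T1 \<Longrightarrow> finite (J t)" "\<And>t j. t \<in> T1 \<Longrightarrow> j \<in> J t \<Longrightarrow> z t j \<noteq> 0"
    "\<And>t. t \<in> T1 \<Longrightarrow> nn (z t) / (2 * l) / 2 powr a \<le> (\<Sum>j\<in>J t. Phi j (\<bar>Z j\<bar> / l))"
    by metis
  have "(\<Sum>t\<in>T1. nn (z t)) / (2 * l) / 2 powr a = (\<Sum>t\<in>T1. nn (z t) / (2 * l) / 2 powr a)"
    by (simp add: sum_divide_distrib)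
  also have "\<dots> \<le> (\<Sum>t\<in>T1. \<Sum>j\<in>J t. Phi j (\<bar>Z j\<bar> / l))"
    by (intro sum_mono J)
  also have "\<dots> = (\<Sum>j\<in>(\<Union>t\<in>T1. J t). Phi j (\<bar>Z j\<bar> / l))"
  proof (rule sum.UNION_disjoint[symmetric])
    show "\<forall>s\<in>T1. \<forall>t\<in>T1. s \<noteq> t \<longrightarrow> J s \<inter> J t = {}"
      using J(2) disj T1(1) by (metis disjoint_iff subsetD)
  qed (use T1 J(1) in auto)
  also have "\<dots> \<le> 1"
    using T1 J(1) by (intro block_modular_leD lZ) auto
  finally have part1: "(\<Sum>t\<in>T1. nn (z t)) \<le> 2 * 2 powr a * l"
    using l(1) by (simp add: divide_le_eq mult_ac)
  have card: "real (card T) * h \<le> 1 / 2"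
  proof -
    have "2 * card T \<le> depth (Suc k)"
      using T(2) depth_ge(4)[of "Suc k"] by linarith
    then have "2 * real (card T) \<le> exp (real (depth (Suc k)))"
      using exp_ge_add_one_self[of "real (depth (Suc k))"] by linarith
    then show ?thesis
      by (simp add: h_def exp_minus field_simps)
  qed
  have "(\<Sum>t\<in>T - T1. nn (z t)) \<le> (\<Sum>t\<in>T - T1. 4 * h * l)"
    by (intro sum_mono) (auto simp: T1_def)
  also have "\<dots> \<le> (\<Sum>t\<in>T. 4 * h * l)"
    using T(1) h0 l(1) by (intro sum_mono2) auto
  also have "\<dots> = (real (card T) * h) * (4 * l)"
    by simp
  also have "\<dots> \<le> 1 / 2 * (4 * l)"
    using l(1) by (intro mult_right_mono card) auto
  finally have "(\<Sum>t\<in>T. nn (z t)) \<le> (2 + 2 * 2 powr a) * l"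
    using part1 sum.subset_diff[OF T1(1) T(1), of "\<lambda>t. nn (z t)"] by (simp add: algebra_simps)
  also have "\<dots> \<le> C * l"
    using C_ge(4) l(1) by (intro mult_right_mono) auto
  finally show "(\<Sum>t\<in>T. nn (z t)) \<le> C * l" .
qed

lemma sequence_lattice_X: "sequence_lattice X nn M D C"
proof -
  interpret normed_subspace X nn by (rule normed_subspace_X)
  show ?thesis
  proof
    show "filterlim D at_top sequentially"
    proof (intro filterlim_at_top_mono[OF filterlim_real_sequentially] always_eventually allI)
      show "real k \<le> D k" for k
        using D_ge[of k] by linarith
    qed
    show "(\<Sum>t\<in>T. nn (z t)) \<le> C * nn (\<Sum>t\<in>T. z t)"
      if "finite T" "card T \<le> (2 * (M (Suc k))\<^sup>2 + 1) ^ M (Suc k)" "\<And>t. t \<in> T \<Longrightarrow> z t \<in> X"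
        "\<And>t i. t \<in> T \<Longrightarrow> i < M (Suc k) \<Longrightarrow> z t i = 0"
        "\<And>s t i. s \<in> T \<Longrightarrow> t \<in> T \<Longrightarrow> s \<noteq> t \<Longrightarrow> z s i = 0 \<or> z t i = 0"
      for T :: "nat set" and k z
      using that by (rule disjoint_l1_X)
    show "v \<in> X \<and> nn v \<le> nn u" if "u \<in> X" "\<And>i. \<bar>v i\<bar> \<le> \<bar>u i\<bar>" for u v
      using solid_X[OF that] by blast
    show "nn (unit_seq j) \<le> C" for j
      using unit_X(2)[of j] C_ge(1) by linarith
    show "1 \<le> C"
      using C_ge(1) by linarith
  qed (rule coordinate_le_X unit_X l2_le_X tails_X M_double M_ge D_pos block_norm_X initial_l1_X; assumption)+
qed


section \<open>The complemented subspace and its bases\<close>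

definition Y :: "(nat \<Rightarrow> real) set" where
  "Y = emb ` X"

lemma emb_in: "c \<in> X \<Longrightarrow> emb c \<in> Y"
  and emb_dec: "y \<in> Y \<Longrightarrow> emb (dec y) = y"
  and dec_in: "y \<in> Y \<Longrightarrow> dec y \<in> X"
  and Y_subset: "Y \<subseteq> orlicz_space F"
  by (auto simp: Y_def X_def)

lemma normed_subspace_Y: "normed_subspace Y (orlicz_norm F)"
proof -
  interpret X: normed_subspace X nn by (rule normed_subspace_X)
  interpret O: normed_subspace "orlicz_space F" "orlicz_norm F" by (rule orlicz_normed_subspace)
  show ?thesis
  proof
    show "subspace Y"
      unfolding Y_def
      by (intro linear_subspace_image X.subspace_Y linearI emb_add emb_scale)
    show "orlicz_norm F (u + v) \<le> orlicz_norm F u + orlicz_norm F v" if "u \<in> Y" "v \<in> Y" for u v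
      using that Y_subset by (intro O.nrm_triangle) auto
    show "orlicz_norm F (r *\<^sub>R v) = \<bar>r\<bar> * orlicz_norm F v" if "v \<in> Y" for r v
      using that Y_subset by (intro O.nrm_scale) auto
    show "0 \<le> orlicz_norm F v" if "v \<in> Y" for v
      using that Y_subset by (intro O.nrm_nonneg) auto
  qed
qed

definition avg :: "(nat \<Rightarrow> real) \<Rightarrow> nat \<Rightarrow> real" where
  "avg y i = (\<Sum>i'\<in>fib (p i). y i') / len (p i)"

lemma avg_eq_emb: "avg y = emb (dec (avg y))"
  using height_pos by (simp add: fun_eq_iff emb_def dec_def avg_def p_start less_imp_neq[symmetric])

lemma avg_emb: "avg (emb c) = emb c"
proof
  fix i
  have "(\<Sum>i'\<in>fib (p i). emb c i') = (\<Sum>i'\<in>fib (p i). emb c i)"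
    by (intro sum.cong refl) (simp add: in_fib_iff emb_def)
  then show "avg (emb c) i = emb c i"
    using len_pos[of "p i"] by (simp add: avg_def)
qed

text \<open>Jensen's inequality on each interval: averaging does not increase the modular, so the
  projection has norm at most 1.\<close>

lemma modular_le_avg:
  assumes "modular_le F l y" "0 < l"
  shows "modular_le F l (avg y)"
  unfolding modular_le_def
proof (intro allI impI)
  fix I :: "nat set" assume I: "finite I"
  have Jensen: "(\<Sum>i\<in>fib j. F (\<bar>avg y i\<bar> / l)) \<le> (\<Sum>i\<in>fib j. F (\<bar>y i\<bar> / l))" for j
  proof -
    have n: "0 < len j" by (rule len_pos)
    have ne: "fib j \<noteq> {}"
      using n card_fib[of j] by (metis card.empty less_irrefl)
    have "\<bar>\<Sum>i\<in>fib j. y i\<bar> / len j / l \<le> (\<Sum>i\<in>fib j. \<bar>y i\<bar>) / len j / l"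
      using assms(2) by (intro divide_right_mono sum_abs) auto
    also have "\<dots> = (\<Sum>i\<in>fib j. (1 / len j) *\<^sub>R (\<bar>y i\<bar> / l))"
      by (simp add: sum_divide_distrib mult.commute)
    finally have "F (\<bar>\<Sum>i\<in>fib j. y i\<bar> / len j / l) \<le> F (\<Sum>i\<in>fib j. (1 / len j) *\<^sub>R (\<bar>y i\<bar> / l))"
      using assms(2) by (intro F_mono) auto
    also have "\<dots> \<le> (\<Sum>i\<in>fib j. (1 / len j) * F (\<bar>y i\<bar> / l))"
      using assms(2) n ne by (intro convex_on_sum[OF _ _ F_convex]) auto
    finally have "len j * F (\<bar>\<Sum>i\<in>fib j. y i\<bar> / len j / l)
        \<le> len j * (\<Sum>i\<in>fib j. (1 / len j) * F (\<bar>y i\<bar> / l))"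
      by (intro mult_left_mono) auto
    also have "\<dots> = (\<Sum>i\<in>fib j. F (\<bar>y i\<bar> / l))"
      using n by (simp add: sum_divide_distrib[symmetric])
    also have "len j * F (\<bar>\<Sum>i\<in>fib j. y i\<bar> / len j / l) = (\<Sum>i\<in>fib j. F (\<bar>avg y i\<bar> / l))"
    proof -
      have "(\<Sum>i\<in>fib j. F (\<bar>avg y i\<bar> / l)) = (\<Sum>i\<in>fib j. F (\<bar>\<Sum>i\<in>fib j. y i\<bar> / len j / l))"
        by (intro sum.cong refl) (simp add: in_fib_iff avg_def abs_divide)
      then show ?thesis by simp
    qed
    finally show ?thesis .
  qed
  have "(\<Sum>i\<in>I. F (\<bar>avg y i\<bar> / l)) \<le> (\<Sum>j\<in>p ` I. \<Sum>i\<in>fib j. F (\<bar>avg y i\<bar> / l))"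
    using I assms(2) by (intro sum_le_fibres F_nonneg) auto
  also have "\<dots> \<le> (\<Sum>j\<in>p ` I. \<Sum>i\<in>fib j. F (\<bar>y i\<bar> / l))"
    by (intro sum_mono Jensen)
  also have "\<dots> = (\<Sum>i\<in>(\<Union>j\<in>p ` I. fib j). F (\<bar>y i\<bar> / l))"
    using I by (intro sum_fibres[symmetric]) auto
  also have "\<dots> \<le> 1"
    using assms(1) I by (simp add: modular_le_def)
  finally show "(\<Sum>i\<in>I. F (\<bar>avg y i\<bar> / l)) \<le> 1" .
qed

lemma avg_in: "v \<in> orlicz_space F \<Longrightarrow> avg v \<in> orlicz_space F"
  using modular_le_avg unfolding in_space_iff by blast

lemma avg_in_Y: "v \<in> orlicz_space F \<Longrightarrow> avg v \<in> Y"
  using avg_in[of v] avg_eq_emb[of v] unfolding Y_def X_def by (metis (mono_tags) image_eqI mem_Collect_eq)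

lemma complemented_Y: "complemented_subspace (orlicz_space F) (orlicz_norm F) Y"
  unfolding complemented_subspace_def
proof (intro conjI exI[of _ avg])
  show "subspace Y"
    using normed_subspace_Y by (simp add: normed_subspace_def)
  show "bounded_projection_onto (orlicz_space F) (orlicz_norm F) Y avg"
    unfolding bounded_projection_onto_def
  proof (intro conjI ballI allI exI[of _ 1])
    show "avg (u + v) = avg u + avg v" for u v
      by (rule ext) (simp add: avg_def sum.distrib add_divide_distrib)
    show "avg (r *\<^sub>R v) = r *\<^sub>R avg v" for r v
      by (rule ext) (simp add: avg_def sum_distrib_left[symmetric])
    show "orlicz_norm F (avg v) \<le> 1 * orlicz_norm F v" if "v \<in> orlicz_space F" for v
      using that by (intro norm_limit) (auto intro!: norm_le modular_le_avg)
    show fixed: "avg y = y" if "y \<in> Y" for y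
      using that avg_emb unfolding Y_def by auto
    show "avg ` orlicz_space F = Y"
    proof
      show "avg ` orlicz_space F \<subseteq> Y"
        using avg_in_Y by auto
      show "Y \<subseteq> avg ` orlicz_space F"
      proof
        fix y assume "y \<in> Y"
        then show "y \<in> avg ` orlicz_space F"
          using fixed[of y] Y_subset by (intro image_eqI[of _ _ y]) auto
      qed
    qed
  qed
qed (rule Y_subset)

lemma nrm_sums_emb:
  "nrm_sums (orlicz_norm F) (\<lambda>n. d n *\<^sub>R emb (f n)) (emb c)
    \<longleftrightarrow> (\<lambda>N. nn (c - (\<Sum>n<N. d n *\<^sub>R f n))) \<longlonglongrightarrow> 0"
  by (simp add: nrm_sums_def nn_def emb_diff emb_sum emb_scale)

lemma unit_expansion: "finite S \<Longrightarrow> c - (\<Sum>n\<in>S. c n *\<^sub>R unit_seq n) = prj (- S) c"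
  by (rule ext) (simp add: prj_finite[symmetric] prj_def)

text \<open>For uniqueness: coordinate \<open>j\<close> of the remainder stays equal to
  \<open>c j - d j\<close> from \<open>N = Suc j\<close> on, and it is bounded by a norm that tends
  to 0.\<close>

lemma unit_sums_iff:
  assumes "c \<in> X"
  shows "nrm_sums (orlicz_norm F) (\<lambda>n. d n *\<^sub>R emb (unit_seq n)) (emb c) \<longleftrightarrow> d = c"
proof
  interpret normed_subspace X nn by (rule normed_subspace_X)
  show "nrm_sums (orlicz_norm F) (\<lambda>n. d n *\<^sub>R emb (unit_seq n)) (emb c)" if "d = c"
  proof -
    have "c - (\<Sum>n<N. d n *\<^sub>R unit_seq n) = prj {N..} c" for N
      using unit_expansion[of "{..<N}" c] that by (simp add: Compl_lessThan)
    then show ?thesis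
      unfolding nrm_sums_emb using tails_X[OF assms] by simp
  qed
  assume "nrm_sums (orlicz_norm F) (\<lambda>n. d n *\<^sub>R emb (unit_seq n)) (emb c)"
  then have lim: "(\<lambda>N. nn (c - (\<Sum>n<N. d n *\<^sub>R unit_seq n))) \<longlonglongrightarrow> 0"
    by (simp add: nrm_sums_emb)
  show "d = c"
  proof
    fix j
    have "\<bar>c j - d j\<bar> \<le> nn (c - (\<Sum>n<N. d n *\<^sub>R unit_seq n))" if "Suc j \<le> N" for N
    proof -
      have "(\<Sum>n<N. d n * unit_seq n j) = (\<Sum>n<N. if n = j then d j else 0)"
        by (intro sum.cong) (auto simp: unit_seq_def)
      then have "(c - (\<Sum>n<N. d n *\<^sub>R unit_seq n)) j = c j - d j"
        using that by simp
      moreover have "c - (\<Sum>n<N. d n *\<^sub>R unit_seq n) \<in> X"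
        by (intro diff_in sum_in scale_in unit_X assms)
      ultimately show ?thesis
        using coordinate_le_X by metis
    qed
    then have "\<bar>c j - d j\<bar> \<le> 0"
      by (intro LIMSEQ_le_const[OF lim]) blast
    then show "d j = c j" by simp
  qed
qed

lemma unconditional_basis_Y: "unconditional_basis (orlicz_norm F) Y (\<lambda>j. emb (unit_seq j))"
proof -
  interpret normed_subspace X nn by (rule normed_subspace_X)
  let ?x = "\<lambda>j. emb (unit_seq j)"
  have ge1: "1 \<le> nn (unit_seq j)" for j
    using coordinate_le_X[OF unit_X(1), of j j] by (simp add: unit_seq_def)
  have "basis_of (orlicz_norm F) Y ?x"
    unfolding basis_of_def
  proof (intro conjI ballI)
    show "range ?x \<subseteq> Y"
      using unit_X(1) emb_in by auto
    have "1 \<le> (INF n. orlicz_norm F (?x n))"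
      using ge1 by (intro cINF_greatest) (auto simp: nn_def)
    moreover have "bdd_above (range (\<lambda>n. orlicz_norm F (?x n)))"
      using unit_X(2) by (intro bdd_aboveI[of _ 2]) (auto simp: nn_def)
    ultimately show "semi_normalized (orlicz_norm F) ?x"
      by (simp add: semi_normalized_def)
    fix v assume "v \<in> Y"
    then obtain c where "c \<in> X" "v = emb c"
      by (auto simp: Y_def)
    then show "\<exists>!d. nrm_sums (orlicz_norm F) (\<lambda>n. d n *\<^sub>R ?x n) v"
      using unit_sums_iff by simp
  qed
  moreover have "nrm_sums (orlicz_norm F)
      (\<lambda>n. basis_coord (orlicz_norm F) ?x (\<pi> n) v *\<^sub>R ?x (\<pi> n)) v"
    if v: "v \<in> Y" and \<pi>: "bij \<pi>" for v \<pi>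
  proof -
    obtain c where c: "c \<in> X" "v = emb c"
      using v by (auto simp: Y_def)
    have coord: "basis_coord (orlicz_norm F) ?x n v = c n" for n
      using unit_sums_iff[OF c(1)] by (simp add: basis_coord_def c(2))
    have inj: "inj_on \<pi> A" for A
      using \<pi> by (meson bij_is_inj inj_on_subset subset_UNIV)
    have rest: "c - (\<Sum>n<N. c (\<pi> n) *\<^sub>R unit_seq (\<pi> n)) = prj (- \<pi> ` {..<N}) c" for N
      by (subst unit_expansion[symmetric]) (simp_all add: sum.reindex[OF inj])
    have "(\<lambda>N. nn (prj (- \<pi> ` {..<N}) c)) \<longlonglongrightarrow> 0"
    proof (rule LIMSEQ_I)
      fix r :: real assume "0 < r"
      then obtain m where m: "norm (nn (prj {m..} c) - 0) < r"
        using LIMSEQ_D[OF tails_X[OF c(1)]] by blast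
      \<comment> \<open>Once the rearranged partial sum contains the first \<open>m\<close>
        coordinates, its remainder is dominated coordinatewise by the tail from \<open>m\<close>
        on.\<close>
      have "finite (\<pi> -` {..<m})"
        using inj by (intro finite_vimageI) auto
      then obtain N0 where N0: "\<pi> -` {..<m} \<subseteq> {..<N0}"
        using finite_nat_iff_bounded by auto
      have "norm (nn (prj (- \<pi> ` {..<N}) c) - 0) < r" if "N0 \<le> N" for N
      proof -
        have sub: "i \<in> \<pi> ` {..<N}" if "i < m" for i
        proof -
          obtain n where n: "i = \<pi> n"
            using \<pi> by (meson bij_pointE)
          then have "n < N0" using that N0 by auto
          then show ?thesis using n \<open>N0 \<le> N\<close> by auto
        qed
        have in_X: "prj S c \<in> X" for S
          by (rule solid_X(1)[OF c(1)]) (simp add: prj_def)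
        have "nn (prj (- \<pi> ` {..<N}) c) \<le> nn (prj {m..} c)"
          using sub by (intro solid_X(2) in_X) (force simp: prj_def)
        then show ?thesis
          using m nrm_nonneg[OF in_X] by simp
      qed
      then show "\<exists>no. \<forall>N\<ge>no. norm (nn (prj (- \<pi> ` {..<N}) c) - 0) < r"
        by blast
    qed
    then show ?thesis
      unfolding c(2) coord[unfolded c(2)] nrm_sums_emb rest .
  qed
  ultimately show ?thesis
    by (simp add: unconditional_basis_def)
qed

lemma no_greedy_basis: "\<not> greedy_basis (orlicz_norm F) Y x"
proof
  assume "greedy_basis (orlicz_norm F) Y x"
  then interpret G: greedy_setting Y "orlicz_norm F" x
    by (intro greedy_setting.intro greedy_setting_axioms.intro normed_subspace_Y)
  obtain c B where cB: "0 < c" "\<And>n. c \<le> orlicz_norm F (x n)" "\<And>n. orlicz_norm F (x n) \<le> B"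
    using G.nrm_x_bounds by blast
  obtain K1 where K1: "\<And>v A l. v \<in> Y \<Longrightarrow> finite A \<Longrightarrow> \<forall>n\<in>A. \<bar>l n\<bar> \<le> 1 \<Longrightarrow>
      orlicz_norm F (\<Sum>n\<in>A. (l n * G.xs n v) *\<^sub>R x n) \<le> K1 * orlicz_norm F v"
    using G.multiplier_bound by metis
  obtain K2 where K2: "\<And>A A'. finite A \<Longrightarrow> finite A' \<Longrightarrow> A \<inter> A' = {} \<Longrightarrow> card A = card A' \<Longrightarrow>
      orlicz_norm F (\<Sum>n\<in>A'. x n) \<le> K2 * orlicz_norm F (\<Sum>n\<in>A. x n)"
    using G.disjoint_democracy by metis
  \<comment> \<open>\<open>K1 / c\<close> bounds the coordinate functionals: the multiplier bound on
    a single index controls \<open>\<bar>G.xs n (emb u)\<bar> * orlicz_norm F (x n)\<close>, and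
    \<open>c\<close> bounds \<open>orlicz_norm F (x n)\<close> from below.\<close>
  define K where "K = max 1 (max B (max K1 (max K2 (K1 / c))))"
  have K: "1 \<le> K" "B \<le> K" "K1 \<le> K" "K2 \<le> K" "K1 / c \<le> K"
    by (auto simp: K_def)
  have scale_K: "k * orlicz_norm F v \<le> K * orlicz_norm F v" if "k \<le> K" "v \<in> Y" for k v
    using that by (intro mult_right_mono G.nrm_nonneg)
  interpret S: sequence_lattice X nn M D C
    by (rule sequence_lattice_X)
  \<comment> \<open>The greedy basis is transported to normalized coordinates; \<open>emb\<close> is
    an isometry of \<open>X\<close> onto \<open>Y\<close> by the definition of
    \<open>nn\<close>.\<close>
  have "democratic_system X nn M D C (\<lambda>n. dec (x n)) (\<lambda>n c. G.xs n (emb c)) K"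
  proof
    show "dec (x n) \<in> X" for n
      by (intro dec_in G.x_in)
    show "G.xs n (emb (u + v)) = G.xs n (emb u) + G.xs n (emb v)" if "u \<in> X" "v \<in> X" for n u v
      using that by (simp add: emb_add G.coord_add emb_in)
    show "G.xs n (emb (r *\<^sub>R u)) = r * G.xs n (emb u)" if "u \<in> X" for n r u
      using that by (simp add: emb_scale G.coord_scale emb_in)
    show "G.xs n (emb (dec (x m))) = (if n = m then 1 else 0)" for n m
      by (simp add: emb_dec G.x_in G.coord_basis)
    have sums: "emb (\<Sum>n\<in>A. d n *\<^sub>R dec (x n)) = (\<Sum>n\<in>A. d n *\<^sub>R x n)" for A d
      by (simp add: emb_sum emb_scale emb_dec G.x_in)
    show "nrm_sums nn (\<lambda>n. G.xs n (emb u) *\<^sub>R dec (x n)) u" if "u \<in> X" for u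
      using G.coord_sums[OF emb_in[OF that]] by (simp add: nrm_sums_def nn_def emb_diff sums)
    show "1 \<le> K" by (rule K)
    show "nn (dec (x n)) \<le> K" for n
      using cB(3)[of n] K(2) by (simp add: nn_def emb_dec G.x_in)
    show "\<bar>G.xs n (emb u)\<bar> \<le> K * nn u" if "u \<in> X" for n u
    proof -
      have "\<bar>G.xs n (emb u)\<bar> * c \<le> \<bar>G.xs n (emb u)\<bar> * orlicz_norm F (x n)"
        by (intro mult_left_mono cB) auto
      also have "\<dots> = orlicz_norm F (\<Sum>m\<in>{n}. (1 * G.xs m (emb u)) *\<^sub>R x m)"
        by (simp add: G.nrm_scale G.x_in)
      also have "\<dots> \<le> K1 * orlicz_norm F (emb u)"
        using that by (intro K1 emb_in) auto
      finally have "\<bar>G.xs n (emb u)\<bar> \<le> K1 / c * orlicz_norm F (emb u)"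
        using cB(1) by (simp add: field_simps)
      also have "\<dots> \<le> K * orlicz_norm F (emb u)"
        using that by (intro scale_K K emb_in)
      finally show ?thesis by (simp add: nn_def)
    qed
    show "nn (\<Sum>n\<in>A. (l n * G.xs n (emb u)) *\<^sub>R dec (x n)) \<le> K * nn u"
      if "u \<in> X" "finite A" "\<And>n. n \<in> A \<Longrightarrow> \<bar>l n\<bar> \<le> 1" for u A l
      unfolding nn_def sums
      using that by (intro order_trans[OF K1 scale_K] emb_in K) auto
    show "nn (\<Sum>n\<in>A'. dec (x n)) \<le> K * nn (\<Sum>n\<in>A. dec (x n))"
      if "finite A" "finite A'" "A \<inter> A' = {}" "card A = card A'" for A A'
    proof -
      have e: "emb (\<Sum>n\<in>A. dec (x n)) = (\<Sum>n\<in>A. x n)" for A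
        by (simp add: emb_sum emb_dec G.x_in)
      show ?thesis
        unfolding nn_def e
        using that by (intro order_trans[OF K2 scale_K] K G.sum_in G.x_in)
    qed
  qed
  then show False
    by (rule democratic_system.contradiction)
qed

end

theorem theorem4p10:
  fixes a :: real
  assumes "a > 0"
  shows "\<exists>Y. complemented_subspace (orlicz_space (orlicz_F1 a)) (orlicz_norm (orlicz_F1 a)) Y \<and>
             (\<exists>x. unconditional_basis (orlicz_norm (orlicz_F1 a)) Y x) \<and>
             \<not> (\<exists>x. greedy_basis (orlicz_norm (orlicz_F1 a)) Y x)"
proof -
  interpret log_orlicz a
    using assms by unfold_locales
  show ?thesis
    using complemented_Y unconditional_basis_Y no_greedy_basis by blast
qed

end
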